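(* Let $G$ be a connected 3-dimensional unimodular Lie group with a left-invariant contact sub-Riemannian structure, and let $f_0,f_1,f_2$ be a left-invariant frame on $G$ such that $f_1,f_2$ is an orthonormal frame of the structure and $$[f_2,f_1]=f_0,\qquad [f_1,f_0]=(\chi+\kappa)f_2,\qquad [f_2,f_0]=(\chi-\kappa)f_1$$ for some constants $\chi\ge 0$, $\kappa\in\mathbb{R}$. Let $h_i$, $g_i$ ($i=0,1,2$), $H=\frac12(h_1^2+h_2^2)$, $E=2h_0^2-2\chi(h_1^2-h_2^2)$ be the functions on $T^*G$ defined in the context, and let $\overrightarrow{H}$ be the Hamiltonian vector field of $H$ on $T^*G$. Then: (1) The Hamiltonian vector field $\overrightarrow{H}$ has the integrals $H, E, g_0, g_1, g_2$, and their only nonzero Poisson brackets (up to antisymmetry) are those given by $$\{g_2,g_1\}=g_0,\qquad \{g_1,g_0\}=(\chi+\kappa)g_2,\qquad \{g_2,g_0\}=(\chi-\kappa)g_1;$$ that is, all other brackets between two different functions among $H,E,g_0,g_1,g_2$ vanish identically. (2) The integrals $H,E,g_0,g_1,g_2$ are functionally dependent, since on $T^*G$ $$4\kappa H+E=2\left(g_0^2+(\kappa-\chi)g_1^2+(\kappa+\chi)g_2^2\right).$$ The functions in the left-hand side and in the right-hand side of this identity are Casimir functions on $L^*$. (3) The field $\overrightarrow{H}$ is Liouville integrable. Specifically: (3.1) If $\chi\neq 0$, then for any $g=\alpha_0g_0+\alpha_1g_1+\alpha_2g_2$ with $(\alpha_0,\alpha_1,\alpha_2)\in\mathbb{R}^3\setminus\{0\}$,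 the integrals $H,E,g$ are in involution and are functionally independent on an open dense subset of $T^*G$. (3.2) If $\chi=0$, then for any $g=\alpha_0g_0+\alpha_1g_1+\alpha_2g_2$ with $(\alpha_0,\alpha_1,\alpha_2)\in\mathbb{R}^3$ and $\alpha_1^2+\alpha_2^2\neq 0$, the integrals $H,E,g$ are in involution and are functionally independent on an open dense subset of $T^*G$.
   Context: Let $G$ be a connected 3-dimensional Lie group and $L$ the Lie algebra of left-invariant vector fields on $G$. A left-invariant contact sub-Riemannian structure on $G$ is a rank 2 left-invariant subbundle $\Delta\subset TG$ with $\Delta+[\Delta,\Delta]=TG$, endowed with a left-invariant inner product in $\Delta$. If $G$ is unimodular (in this setting: its Lie algebra is one of $\mathrm{h}_3$, $\mathrm{so}(3)$, $\mathrm{sl}(2)$, $\mathrm{se}(2)$, $\mathrm{sh}(2)$), it is known that there is a left-invariant frame $f_0,f_1,f_2$ with $f_1,f_2$ an orthonormal frame of $\Delta$, satisfying the bracket relations of the claim for some $\chi\ge0$, $\kappa\in\mathbb{R}$; such a frame is fixed. Let $\pi:T^*G\to G$ be the canonical projection. Set $h_i(\lambda)=\langle\lambda,f_i(q)\rangle$, $q=\pi(\lambda)$, $i=0,1,2$. Let $i:G\to G$, $i(q)=q^{-1}$, be the inversion, and $e_j=i_*f_j$ the right-invariant vector field on $G$ with $e_j(\mathrm{Id})=-f_j(\mathrm{Id})$, $j=0,1,2$. Set $g_j(\lambda)=\langle\lambda,e_j(q)\rangle$, $q=\pi(\lambda)$. $T^*G$ carries the symplectic form $\sigma=ds$, $s_\lambda=\lambda\circ\pi_*$.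 The Hamiltonian vector field $\overrightarrow{a}$ of $a\in C^\infty(T^*G)$ is defined by $\sigma_\lambda(\cdot,\overrightarrow{a})=d_\lambda a$, and the Poisson bracket is $\{a,b\}=\overrightarrow{a}\,b$; with this convention, for vector fields $X,Y$ on $G$ the functions $h_X(\lambda)=\langle\lambda,X\rangle$ satisfy $\{h_X,h_Y\}=h_{[X,Y]}$. An integral of $\overrightarrow{H}$ is a function $a\in C^\infty(T^*G)$ with $\{H,a\}=0$. Functions are in involution if their pairwise Poisson brackets vanish. Functions are functionally independent on a set if their differentials are linearly independent at each point of that set. Casimir functions on $L^*$: the left-hand side $4\kappa H+E$ is a polynomial in $h_0,h_1,h_2$, and the right-hand side is a polynomial in $g_0,g_1,g_2$; the functions $h_i$ (respectively $g_i$) play the role of linear coordinates on the dual $L^*$ of the Lie algebra with its Lie--Poisson bracket. A Casimir function is one that Poisson-commutes with all these coordinates; as functions on $T^*G$, both sides having this property means that each of them has zero Poisson bracket with every $h_i$ and every $g_i$, $i=0,1,2$. A Hamiltonian vector field $\overrightarrow{H}$ on a symplectic manifold $M$, $\dim M=2d$, is Liouville integrable if there exist functions $f_1=H,f_2,\dots,f_d\in C^\infty(M)$ with $\{f_i,f_j\}=0$ for all $i,j=1,\dots,d$ that are functionally independent on an open dense subset of $M$ (here $M=T^*G$, $d=3$). *)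

theory Defs
  imports
    "HOL-Analysis.Analysis"
    "HOL-Library.Function_Algebras"
    "HOL-Algebra.Coset"
begin

section \<open>Real vector space structure on function spaces\<close>

text \<open>Tangent vectors are represented as operators on functions, so linear algebra is done in the
  pointwise vector space \<^typ>\<open>'a \<Rightarrow> real\<close>.\<close>

instantiation "fun" :: (type, real_vector) real_vector
begin

definition scaleR_fun :: "real \<Rightarrow> ('a \<Rightarrow> 'b) \<Rightarrow> 'a \<Rightarrow> 'b"
  where "scaleR_fun c f = (\<lambda>x. c *\<^sub>R f x)"

instance
  by standard (auto simp: scaleR_fun_def fun_eq_iff scaleR_add_left scaleR_add_right)

end


section \<open>Smooth manifolds given by an atlas\<close>

text \<open>The functions \<open>Ck_on\<close> and \<open>smooth_on\<close> are only used on open sets.\<close>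

primrec Ck_on :: "nat \<Rightarrow> ('a::real_normed_vector \<Rightarrow> 'b::real_normed_vector) \<Rightarrow> 'a set \<Rightarrow> bool" where
  "Ck_on 0 f S \<longleftrightarrow> continuous_on S f"
| "Ck_on (Suc k) f S \<longleftrightarrow> (\<forall>x\<in>S. f differentiable (at x)) \<and>
     (\<forall>w. Ck_on k (\<lambda>x. frechet_derivative f (at x) w) S)"

definition smooth_on :: "('a::real_normed_vector \<Rightarrow> 'b::real_normed_vector) \<Rightarrow> 'a set \<Rightarrow> bool"
  where "smooth_on f S \<longleftrightarrow> (\<forall>k. Ck_on k f S)"

text \<open>A chart is a pair of its domain and its coordinate map; values of the coordinate map outside
  the domain are irrelevant.\<close>

type_synonym ('m, 'e) chart = "'m set \<times> ('m \<Rightarrow> 'e)"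

definition points :: "('m, 'e) chart set \<Rightarrow> 'm set"
  where "points A = (\<Union>c\<in>A. fst c)"

definition is_atlas :: "('m, 'e::euclidean_space) chart set \<Rightarrow> bool" where
  "is_atlas A \<longleftrightarrow>
     (\<forall>(U, \<phi>)\<in>A. inj_on \<phi> U \<and> open (\<phi> ` U)) \<and>
     (\<forall>(U, \<phi>)\<in>A. \<forall>(V, \<psi>)\<in>A.
        open (\<phi> ` (U \<inter> V)) \<and> smooth_on (\<psi> \<circ> inv_into U \<phi>) (\<phi> ` (U \<inter> V)))"

definition mtop :: "('m, 'e::euclidean_space) chart set \<Rightarrow> 'm topology" where
  "mtop A = topology (\<lambda>W. W \<subseteq> points A \<and> (\<forall>(U, \<phi>)\<in>A. open (\<phi> ` (U \<inter> W))))"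

definition smooth_manifold :: "('m, 'e::euclidean_space) chart set \<Rightarrow> bool" where
  "smooth_manifold A \<longleftrightarrow>
     is_atlas A \<and> Hausdorff_space (mtop A) \<and> second_countable (mtop A)"

definition prod_atlas ::
  "('m, 'e) chart set \<Rightarrow> ('n, 'f) chart set \<Rightarrow> ('m \<times> 'n, 'e \<times> 'f) chart set" where
  "prod_atlas A B = {(U \<times> V, map_prod \<phi> \<psi>) | U \<phi> V \<psi>. (U, \<phi>) \<in> A \<and> (V, \<psi>) \<in> B}"

text \<open>Smoothness on an open set \<open>W\<close> of points.\<close>

definition smooth_fun_on ::
  "('m, 'e::euclidean_space) chart set \<Rightarrow> 'm set \<Rightarrow> ('m \<Rightarrow> real) \<Rightarrow> bool" where
  "smooth_fun_on A W a \<longleftrightarrow> (\<forall>(U, \<phi>)\<in>A. smooth_on (a \<circ> inv_into U \<phi>) (\<phi> ` (U \<inter> W)))"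

abbreviation smooth_fun :: "('m, 'e::euclidean_space) chart set \<Rightarrow> ('m \<Rightarrow> real) \<Rightarrow> bool"
  where "smooth_fun A \<equiv> smooth_fun_on A (points A)"

definition smooth_near ::
  "('m, 'e::euclidean_space) chart set \<Rightarrow> 'm \<Rightarrow> ('m \<Rightarrow> real) \<Rightarrow> bool" where
  "smooth_near A p a \<longleftrightarrow> (\<exists>W. openin (mtop A) W \<and> p \<in> W \<and> smooth_fun_on A W a)"

text \<open>The openness requirement expresses continuity.\<close>

definition smooth_map ::
  "('m, 'e::euclidean_space) chart set \<Rightarrow> ('n, 'f::euclidean_space) chart set
    \<Rightarrow> ('m \<Rightarrow> 'n) \<Rightarrow> bool" where
  "smooth_map A B F \<longleftrightarrow>
     F ` points A \<subseteq> points B \<and>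
     (\<forall>(U, \<phi>)\<in>A. \<forall>(V, \<psi>)\<in>B.
        open (\<phi> ` (U \<inter> F -` V)) \<and>
        smooth_on (\<psi> \<circ> F \<circ> inv_into U \<phi>) (\<phi> ` (U \<inter> F -` V)))"


section \<open>Tangent vectors, vector fields, one-forms\<close>

text \<open>A tangent vector at \<open>p\<close> is the directional derivative at \<open>p\<close>, in some chart and some direction
  \<open>w\<close>, acting on the functions smooth near \<open>p\<close>. On all other functions it is set to \<open>0\<close>, which makes
  the operator representing a tangent vector unique.\<close>

definition coord_vec ::
  "('m, 'e::euclidean_space) chart set \<Rightarrow> ('m, 'e) chart \<Rightarrow> 'm \<Rightarrow> 'e \<Rightarrow> ('m \<Rightarrow> real) \<Rightarrow> real" where
  "coord_vec A c p w = (\<lambda>a.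
     if smooth_near A p a
     then frechet_derivative (a \<circ> inv_into (fst c) (snd c)) (at (snd c p)) w
     else 0)"

definition tangent_space ::
  "('m, 'e::euclidean_space) chart set \<Rightarrow> 'm \<Rightarrow> (('m \<Rightarrow> real) \<Rightarrow> real) set" where
  "tangent_space A p = {coord_vec A c p w | c w. c \<in> A \<and> p \<in> fst c}"

text \<open>The differential \<open>F\<^sub>* : T\<^sub>pM \<rightarrow> T\<^bsub>F p\<^esub>N\<close> of a smooth map.\<close>

definition push ::
  "('n, 'f::euclidean_space) chart set \<Rightarrow> ('m \<Rightarrow> 'n) \<Rightarrow> 'm
    \<Rightarrow> (('m \<Rightarrow> real) \<Rightarrow> real) \<Rightarrow> (('n \<Rightarrow> real) \<Rightarrow> real)" where
  "push B F p v = (\<lambda>a. if smooth_near B (F p) a then v (a \<circ> F) else 0)"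

type_synonym 'm vfield = "'m \<Rightarrow> ('m \<Rightarrow> real) \<Rightarrow> real"

definition vector_field_on ::
  "('m, 'e::euclidean_space) chart set \<Rightarrow> 'm set \<Rightarrow> 'm vfield \<Rightarrow> bool" where
  "vector_field_on A W X \<longleftrightarrow>
     (\<forall>p\<in>W. X p \<in> tangent_space A p) \<and>
     (\<forall>W' a. openin (mtop A) W' \<and> W' \<subseteq> W \<and> smooth_fun_on A W' a
        \<longrightarrow> smooth_fun_on A W' (\<lambda>p. X p a))"

abbreviation vector_field :: "('m, 'e::euclidean_space) chart set \<Rightarrow> 'm vfield \<Rightarrow> bool"
  where "vector_field A \<equiv> vector_field_on A (points A)"

definition lie_bracket ::
  "('m, 'e::euclidean_space) chart set \<Rightarrow> 'm vfield \<Rightarrow> 'm vfield \<Rightarrow> 'm vfield" where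
  "lie_bracket A X Y = (\<lambda>p a.
     if smooth_near A p a then X p (\<lambda>q. Y q a) - Y p (\<lambda>q. X q a) else 0)"

definition is_frame ::
  "('m, 'e::euclidean_space) chart set \<Rightarrow> 'i set \<Rightarrow> ('i \<Rightarrow> 'm vfield) \<Rightarrow> bool" where
  "is_frame A I X \<longleftrightarrow>
     (\<forall>i\<in>I. vector_field A (X i)) \<and>
     (\<forall>p\<in>points A. inj_on (\<lambda>i. X i p) I \<and> independent ((\<lambda>i. X i p) ` I) \<and>
        span ((\<lambda>i. X i p) ` I) = tangent_space A p)"

type_synonym 'm oneform = "'m \<Rightarrow> (('m \<Rightarrow> real) \<Rightarrow> real) \<Rightarrow> real"
type_synonym 'm twoform = "'m \<Rightarrow> (('m \<Rightarrow> real) \<Rightarrow> real) \<Rightarrow> (('m \<Rightarrow> real) \<Rightarrow> real) \<Rightarrow> real"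

text \<open>The exterior derivative of a smooth one-form by the invariant formula
  \<open>d\<omega>(X, Y) = X(\<omega>(Y)) - Y(\<omega>(X)) - \<omega>([X, Y])\<close>, where \<open>X\<close>, \<open>Y\<close> are arbitrary smooth extensions of
  \<open>v\<close>, \<open>w\<close> to a neighbourhood of \<open>p\<close>.\<close>

definition ext_deriv ::
  "('m, 'e::euclidean_space) chart set \<Rightarrow> 'm oneform \<Rightarrow> 'm twoform" where
  "ext_deriv A \<omega> p v w = (THE r. \<forall>W X Y.
     openin (mtop A) W \<and> p \<in> W \<and> vector_field_on A W X \<and> vector_field_on A W Y \<and>
     X p = v \<and> Y p = w \<longrightarrow>
     r = X p (\<lambda>q. \<omega> q (Y q)) - Y p (\<lambda>q. \<omega> q (X q)) - \<omega> p (lie_bracket A X Y p))"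


section \<open>Hamiltonian mechanics on a symplectic manifold\<close>

text \<open>\<open>\<sigma>\<^sub>p(\<eta>, \<xi>) = d\<^sub>pa(\<eta>)\<close> for all tangent vectors \<open>\<eta>\<close>, where \<open>d\<^sub>pa(\<eta>) = \<eta> a\<close>.\<close>

definition ham_field ::
  "('m, 'e::euclidean_space) chart set \<Rightarrow> 'm twoform \<Rightarrow> ('m \<Rightarrow> real) \<Rightarrow> 'm vfield" where
  "ham_field A \<sigma> a p =
     (THE \<xi>. \<xi> \<in> tangent_space A p \<and> (\<forall>\<eta>\<in>tangent_space A p. \<sigma> p \<eta> \<xi> = \<eta> a))"

definition poisson ::
  "('m, 'e::euclidean_space) chart set \<Rightarrow> 'm twoform
    \<Rightarrow> ('m \<Rightarrow> real) \<Rightarrow> ('m \<Rightarrow> real) \<Rightarrow> 'm \<Rightarrow> real" where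
  "poisson A \<sigma> a b p = ham_field A \<sigma> a p b"

definition is_integral ::
  "('m, 'e::euclidean_space) chart set \<Rightarrow> 'm twoform \<Rightarrow> ('m \<Rightarrow> real) \<Rightarrow> ('m \<Rightarrow> real) \<Rightarrow> bool" where
  "is_integral A \<sigma> H a \<longleftrightarrow> smooth_fun A a \<and> (\<forall>p\<in>points A. poisson A \<sigma> H a p = 0)"

definition in_involution ::
  "('m, 'e::euclidean_space) chart set \<Rightarrow> 'm twoform \<Rightarrow> ('m \<Rightarrow> real) list \<Rightarrow> bool" where
  "in_involution A \<sigma> as \<longleftrightarrow>
     (\<forall>a\<in>set as. \<forall>b\<in>set as. \<forall>p\<in>points A. poisson A \<sigma> a b p = 0)"

text \<open>\<open>differentials_relation A as p c\<close>: the linear combination of the differentials at \<open>p\<close> of the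
  functions in \<open>as\<close>, with coefficients \<open>c\<close>, vanishes on \<open>T\<^sub>pM\<close>.\<close>

definition differentials_relation ::
  "('m, 'e::euclidean_space) chart set \<Rightarrow> ('m \<Rightarrow> real) list \<Rightarrow> 'm \<Rightarrow> (nat \<Rightarrow> real) \<Rightarrow> bool" where
  "differentials_relation A as p c \<longleftrightarrow>
     (\<forall>v\<in>tangent_space A p. (\<Sum>i<length as. c i * v (as ! i)) = 0)"

definition functionally_independent_on ::
  "('m, 'e::euclidean_space) chart set \<Rightarrow> 'm set \<Rightarrow> ('m \<Rightarrow> real) list \<Rightarrow> bool" where
  "functionally_independent_on A S as \<longleftrightarrow>
     (\<forall>p\<in>S. \<forall>c. differentials_relation A as p c \<longrightarrow> (\<forall>i<length as. c i = 0))"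

definition functionally_dependent_on ::
  "('m, 'e::euclidean_space) chart set \<Rightarrow> 'm set \<Rightarrow> ('m \<Rightarrow> real) list \<Rightarrow> bool" where
  "functionally_dependent_on A S as \<longleftrightarrow>
     (\<forall>p\<in>S. \<exists>c. differentials_relation A as p c \<and> (\<exists>i<length as. c i \<noteq> 0))"

definition independent_on_open_dense ::
  "('m, 'e::euclidean_space) chart set \<Rightarrow> ('m \<Rightarrow> real) list \<Rightarrow> bool" where
  "independent_on_open_dense A as \<longleftrightarrow>
     (\<exists>S. openin (mtop A) S \<and> mtop A closure_of S = points A \<and>
        functionally_independent_on A S as)"

definition liouville_integrable ::
  "('m, 'e::euclidean_space) chart set \<Rightarrow> 'm twoform \<Rightarrow> ('m \<Rightarrow> real) \<Rightarrow> bool" where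
  "liouville_integrable A \<sigma> H \<longleftrightarrow>
     (\<exists>as. 2 * length (H # as) = DIM('e) \<and> (\<forall>a\<in>set (H # as). smooth_fun A a) \<and>
        in_involution A \<sigma> (H # as) \<and> independent_on_open_dense A (H # as))"


section \<open>The cotangent bundle\<close>

text \<open>Covectors at \<open>q\<close> are linear forms on the tangent space at \<open>q\<close>, made unique as functions by
  extensionality.\<close>

definition cotangent_space ::
  "('m, 'e::euclidean_space) chart set \<Rightarrow> 'm \<Rightarrow> ((('m \<Rightarrow> real) \<Rightarrow> real) \<Rightarrow> real) set" where
  "cotangent_space A q =
     {l \<in> extensional (tangent_space A q).
        (\<forall>v\<in>tangent_space A q. \<forall>w\<in>tangent_space A q. l (v + w) = l v + l w) \<and>
        (\<forall>r. \<forall>v\<in>tangent_space A q. l (r *\<^sub>R v) = r * l v)}"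

type_synonym 'm covec = "'m \<times> ((('m \<Rightarrow> real) \<Rightarrow> real) \<Rightarrow> real)"

definition cotangent_bundle :: "('m, 'e::euclidean_space) chart set \<Rightarrow> 'm covec set"
  where "cotangent_bundle A = (SIGMA q:points A. cotangent_space A q)"

text \<open>Every chart \<open>(U, x)\<close> induces the canonical chart \<open>(x, p)\<close> over \<open>U\<close>, with \<open>p\<^sub>b = \<lambda>(\<partial>/\<partial>x\<^sub>b)\<close>.\<close>

definition cotangent_atlas ::
  "('m, 'e::euclidean_space) chart set \<Rightarrow> ('m covec, 'e \<times> 'e) chart set" where
  "cotangent_atlas A = (\<lambda>c.
     ({l \<in> cotangent_bundle A. fst l \<in> fst c},
      \<lambda>l. (snd c (fst l), \<Sum>b\<in>Basis. snd l (coord_vec A c (fst l) b) *\<^sub>R b))) ` A"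

definition liouville_form :: "('m, 'e::euclidean_space) chart set \<Rightarrow> 'm covec oneform"
  where "liouville_form A l \<xi> = snd l (push A fst l \<xi>)"

definition symplectic_form :: "('m, 'e::euclidean_space) chart set \<Rightarrow> 'm covec twoform"
  where "symplectic_form A = ext_deriv (cotangent_atlas A) (liouville_form A)"

definition pairing :: "'m vfield \<Rightarrow> 'm covec \<Rightarrow> real"
  where "pairing X l = snd l (X (fst l))"


section \<open>Lie groups and left-invariant structures\<close>

definition lie_group ::
  "('g, 'x) monoid_scheme \<Rightarrow> ('g, 'e::euclidean_space) chart set \<Rightarrow> bool" where
  "lie_group G A \<longleftrightarrow>
     group G \<and> smooth_manifold A \<and> carrier G = points A \<and>
     smooth_map (prod_atlas A A) A (\<lambda>(a, b). a \<otimes>\<^bsub>G\<^esub> b) \<and>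
     smooth_map A A (\<lambda>a. inv\<^bsub>G\<^esub> a)"

text \<open>Unimodularity: there is a Haar measure that is both left- and right-invariant.\<close>

definition unimodular ::
  "('g, 'x) monoid_scheme \<Rightarrow> ('g, 'e::euclidean_space) chart set \<Rightarrow> bool" where
  "unimodular G A \<longleftrightarrow>
     (\<exists>\<mu>. space \<mu> = carrier G \<and> sets \<mu> = sigma_sets (carrier G) {W. openin (mtop A) W} \<and>
        emeasure \<mu> (carrier G) \<noteq> 0 \<and>
        (\<forall>K. compactin (mtop A) K \<longrightarrow> emeasure \<mu> K < \<infinity>) \<and>
        (\<forall>a\<in>carrier G. \<forall>S\<in>sets \<mu>.
           emeasure \<mu> (a <#\<^bsub>G\<^esub> S) = emeasure \<mu> S \<and> emeasure \<mu> (S #>\<^bsub>G\<^esub> a) = emeasure \<mu> S))"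

definition left_push ::
  "('g, 'x) monoid_scheme \<Rightarrow> ('g, 'e::euclidean_space) chart set \<Rightarrow> 'g \<Rightarrow> 'g
    \<Rightarrow> (('g \<Rightarrow> real) \<Rightarrow> real) \<Rightarrow> (('g \<Rightarrow> real) \<Rightarrow> real)" where
  "left_push G A a q = push A (\<lambda>x. a \<otimes>\<^bsub>G\<^esub> x) q"

definition left_invariant_field ::
  "('g, 'x) monoid_scheme \<Rightarrow> ('g, 'e::euclidean_space) chart set \<Rightarrow> 'g vfield \<Rightarrow> bool" where
  "left_invariant_field G A X \<longleftrightarrow>
     vector_field A X \<and>
     (\<forall>a\<in>carrier G. \<forall>q\<in>carrier G. left_push G A a q (X q) = X (a \<otimes>\<^bsub>G\<^esub> q))"

text \<open>The push-forward \<open>i\<^sub>*X\<close> of a vector field by the inversion \<open>i\<close>; note \<open>i\<inverse> = i\<close>.\<close>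

definition inversion_push ::
  "('g, 'x) monoid_scheme \<Rightarrow> ('g, 'e::euclidean_space) chart set \<Rightarrow> 'g vfield \<Rightarrow> 'g vfield" where
  "inversion_push G A X q =
     push A (\<lambda>x. inv\<^bsub>G\<^esub> x) (inv\<^bsub>G\<^esub> q) (X (inv\<^bsub>G\<^esub> q))"

definition inner_product_on :: "'v::real_vector set \<Rightarrow> ('v \<Rightarrow> 'v \<Rightarrow> real) \<Rightarrow> bool" where
  "inner_product_on V ip \<longleftrightarrow>
     (\<forall>u\<in>V. \<forall>v\<in>V. ip u v = ip v u) \<and>
     (\<forall>u\<in>V. \<forall>v\<in>V. \<forall>w\<in>V. ip (u + v) w = ip u w + ip v w) \<and>
     (\<forall>r. \<forall>u\<in>V. \<forall>v\<in>V. ip (r *\<^sub>R u) v = r * ip u v) \<and>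
     (\<forall>u\<in>V. u \<noteq> 0 \<longrightarrow> ip u u > 0)"

text \<open>A left-invariant rank 2 distribution \<open>\<Delta>\<close> with \<open>\<Delta> + [\<Delta>, \<Delta>] = TG\<close> and a left-invariant inner
  product on it. Smooth dependence on the point is a consequence of left-invariance.\<close>

definition contact_sub_riemannian ::
  "('g, 'x) monoid_scheme \<Rightarrow> ('g, 'e::euclidean_space) chart set
    \<Rightarrow> ('g \<Rightarrow> (('g \<Rightarrow> real) \<Rightarrow> real) set)
    \<Rightarrow> ('g \<Rightarrow> (('g \<Rightarrow> real) \<Rightarrow> real) \<Rightarrow> (('g \<Rightarrow> real) \<Rightarrow> real) \<Rightarrow> real) \<Rightarrow> bool" where
  "contact_sub_riemannian G A \<Delta> ip \<longleftrightarrow>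
     (\<forall>q\<in>carrier G. \<Delta> q \<subseteq> tangent_space A q \<and> subspace (\<Delta> q) \<and> dim (\<Delta> q) = 2 \<and>
        inner_product_on (\<Delta> q) (ip q)) \<and>
     (\<forall>a\<in>carrier G. \<forall>q\<in>carrier G.
        left_push G A a q ` \<Delta> q = \<Delta> (a \<otimes>\<^bsub>G\<^esub> q) \<and>
        (\<forall>v\<in>\<Delta> q. \<forall>w\<in>\<Delta> q.
           ip (a \<otimes>\<^bsub>G\<^esub> q) (left_push G A a q v) (left_push G A a q w) = ip q v w)) \<and>
     (\<forall>q\<in>carrier G.
        span (\<Delta> q \<union> {lie_bracket A X Y q | X Y.
           vector_field A X \<and> vector_field A Y \<and>
           (\<forall>p\<in>carrier G. X p \<in> \<Delta> p \<and> Y p \<in> \<Delta> p)}) = tangent_space A q)"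

end

theory Submission
  imports Defs
begin

text \<open>The Hamiltonian \<open>H\<close> is a quadratic polynomial in the momenta \<open>h i\<close> of left-invariant fields. Left
  translations commute with right translations, so \<open>[f i, e j] = 0\<close>, and since
  \<open>{pairing X, pairing Y} = pairing [X, Y]\<close> (\<open>poisson_pairing\<close>) every \<open>g j\<close> commutes with every \<open>h i\<close>,
  hence with \<open>H\<close> and \<open>E\<close>. The inversion carries \<open>f\<close> to \<open>e\<close> and preserves brackets, so the \<open>g i\<close> have the
  structure constants of the \<open>h i\<close>. The polynomial \<open>2 (x\<^sup>2 + (\<kappa> - chi) y\<^sup>2 + (\<kappa> + chi) z\<^sup>2)\<close> is a Casimir for
  these constants; evaluated on the \<open>h i\<close> it is \<open>4 \<kappa> H + E\<close>, which gives \<open>{H, E} = 0\<close>.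

  The equality of the two Casimirs (\<open>casimir_identity\<close>) is invariance under the adjoint action of a
  connected group: evaluate the left momenta on a right-invariant one-form; the derivative of the
  Casimir of the resulting functions along each \<open>f k\<close> vanishes, so it is constant on the group, and at
  the unit the left and right momenta differ by the sign only, because the differential of the
  inversion is \<open>- id\<close> there (\<open>i_push_one\<close>).

  For independence (\<open>independent_triple\<close>) suppose \<open>a dH + b dE + c dg = 0\<close> at a covector. The
  Hamiltonian field of \<open>h 2\<close> annihilates \<open>g\<close>, and where \<open>h 0\<close> and \<open>h 1\<close> do not vanish this forces
  \<open>a = 4 \<kappa> b\<close>. What remains is a relation between the differential of the Casimir in the \<open>g i\<close> and that of
  \<open>g\<close>, both combinations of the independent \<open>dg i\<close>. It is trivial unless the coefficient vectors are
  parallel, and one component of their cross product is a nonzero linear form in the \<open>g i\<close>. So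
  independence holds where the momenta of three nowhere vanishing fields are all nonzero, and such a
  set is open and dense (\<open>dense_pairing_nonzero\<close>).

  The geometry is done in charts. Both \<open>[f i, e j] = 0\<close> and the bracket of coordinate fields rest on the
  symmetry of second derivatives (\<open>fd_fd_commute\<close>); the symplectic form, defined by extending tangent
  vectors to fields, is computed in canonical coordinates (\<open>symplectic_coord\<close>).\<close>

section \<open>Smooth functions on open sets\<close>

abbreviation fd :: "('a::real_normed_vector \<Rightarrow> 'b::real_normed_vector) \<Rightarrow> 'a \<Rightarrow> 'a \<Rightarrow> 'b"
  where "fd f x \<equiv> frechet_derivative f (at x)"

lemma has_fd: "f differentiable (at x) \<Longrightarrow> (f has_derivative fd f x) (at x)"
  by (simp add: frechet_derivative_works)

lemma fd_eqI: "(f has_derivative f') (at x) \<Longrightarrow> fd f x = f'"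
  using frechet_derivative_at by metis

lemma fd_cong:
  assumes "open S" "x \<in> S" "\<And>y. y \<in> S \<Longrightarrow> f y = g y"
  shows "fd f x = fd g x"
proof -
  have *: "(f has_derivative F) (at x) \<longleftrightarrow> (g has_derivative F) (at x)" for F
    using has_derivative_transform_within_open[OF _ assms(1,2)] assms(3) by metis
  show ?thesis unfolding frechet_derivative_def * ..
qed

lemma differentiable_cong_open:
  assumes "open S" "x \<in> S" "\<And>y. y \<in> S \<Longrightarrow> f y = g y" "f differentiable (at x)"
  shows "g differentiable (at x)"
  using assms has_derivative_transform_within_open[OF _ assms(1,2)] unfolding differentiable_def by metis

lemma Ck_on_cong:
  assumes "open S" "\<And>x. x \<in> S \<Longrightarrow> f x = g x" "Ck_on k f S"
  shows "Ck_on k g S"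
  using assms(2,3)
proof (induction k arbitrary: f g)
  case 0
  then show ?case using continuous_on_cong by auto
next
  case (Suc k)
  have "g differentiable (at x)" if "x \<in> S" for x
    using differentiable_cong_open[OF assms(1) that] Suc.prems that by auto
  moreover have "Ck_on k (\<lambda>x. fd g x w) S" for w
    by (rule Suc.IH[of "\<lambda>x. fd f x w"]) (use Suc.prems fd_cong[OF assms(1), of _ f g] in auto)
  ultimately show ?case by simp
qed

lemma Ck_on_subset: "Ck_on k f S \<Longrightarrow> T \<subseteq> S \<Longrightarrow> Ck_on k f T"
proof (induction k arbitrary: f)
  case 0
  then show ?case using continuous_on_subset by auto
next
  case (Suc k)
  then show ?case by auto
qed

lemma Ck_on_local:
  assumes "\<And>x. x \<in> S \<Longrightarrow> \<exists>T. open T \<and> x \<in> T \<and> Ck_on k f T"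
  shows "Ck_on k f S"
  using assms
proof (induction k arbitrary: f)
  case 0
  have "isCont f x" if "x \<in> S" for x
    using 0[OF that] by (auto simp: continuous_on_eq_continuous_at)
  then show ?case by (simp add: continuous_at_imp_continuous_on)
next
  case (Suc k)
  have "f differentiable (at x)" if "x \<in> S" for x
    using Suc.prems[OF that] by auto
  moreover have "Ck_on k (\<lambda>x. fd f x w) S" for w
    by (rule Suc.IH) (use Suc.prems in fastforce)
  ultimately show ?case by simp
qed

lemma Ck_on_SucD: "Ck_on (Suc k) f S \<Longrightarrow> Ck_on k f S"
proof (induction k arbitrary: f)
  case 0
  then show ?case
    by (simp add: continuous_at_imp_continuous_on differentiable_imp_continuous_within)
next
  case (Suc k)
  have "Ck_on k (\<lambda>x. fd f x w) S" for w
    using Suc.prems Ck_on.simps(2)[of "Suc k" f S] by (intro Suc.IH) blast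
  with Suc.prems show ?case by simp
qed

lemma Ck_on_const: "Ck_on k (\<lambda>x. c) S"
proof (induction k arbitrary: c)
  case (Suc k)
  then show ?case by (simp)
qed simp

lemma Ck_on_linear:
  assumes "open S" "bounded_linear L" "Ck_on k f S"
  shows "Ck_on k (\<lambda>x. L (f x)) S"
  using assms(3)
proof (induction k arbitrary: f)
  case 0
  then show ?case using assms(2) by (simp add: bounded_linear.continuous_on)
next
  case (Suc k)
  have d: "((\<lambda>x. L (f x)) has_derivative (\<lambda>w. L (fd f x w))) (at x)" if "x \<in> S" for x
    using Suc.prems that by (intro bounded_linear.has_derivative[OF assms(2)] has_fd) auto
  moreover have "Ck_on k (\<lambda>x. fd (\<lambda>x. L (f x)) x w) S" for w
    by (rule Ck_on_cong[OF assms(1) _ Suc.IH[of "\<lambda>x. fd f x w"]])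
      (use Suc.prems fd_eqI[OF d] in auto)
  ultimately show ?case by (auto simp: differentiable_def)
qed

lemma Ck_on_add:
  assumes "open S" "Ck_on k f S" "Ck_on k g S"
  shows "Ck_on k (\<lambda>x. f x + g x) S"
  using assms(2,3)
proof (induction k arbitrary: f g)
  case 0
  then show ?case by (simp add: continuous_on_add)
next
  case (Suc k)
  have d: "((\<lambda>x. f x + g x) has_derivative (\<lambda>w. fd f x w + fd g x w)) (at x)" if "x \<in> S" for x
    using Suc.prems that by (intro has_derivative_add has_fd) auto
  moreover have "Ck_on k (\<lambda>x. fd (\<lambda>x. f x + g x) x w) S" for w
    by (rule Ck_on_cong[OF assms(1) _ Suc.IH[of "\<lambda>x. fd f x w" "\<lambda>x. fd g x w"]])
      (use Suc.prems fd_eqI[OF d] in auto)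
  ultimately show ?case by (auto simp: differentiable_def)
qed

lemma Ck_on_bilinear:
  assumes "open S" "bounded_bilinear B" "Ck_on k f S" "Ck_on k g S"
  shows "Ck_on k (\<lambda>x. B (f x) (g x)) S"
  using assms(3,4)
proof (induction k arbitrary: f g)
  case 0
  then show ?case using assms(2) by (simp add: bounded_bilinear.continuous_on)
next
  case (Suc k)
  have d: "((\<lambda>x. B (f x) (g x)) has_derivative (\<lambda>w. B (f x) (fd g x w) + B (fd f x w) (g x))) (at x)"
    if "x \<in> S" for x
    using Suc.prems that by (intro bounded_bilinear.FDERIV[OF assms(2)] has_fd) auto
  moreover have "Ck_on k (\<lambda>x. fd (\<lambda>x. B (f x) (g x)) x w) S" for w
  proof (rule Ck_on_cong[OF assms(1)])
    show "Ck_on k (\<lambda>x. B (f x) (fd g x w) + B (fd f x w) (g x)) S"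
      using Suc.prems Suc.prems[THEN Ck_on_SucD] by (intro Ck_on_add assms(1) Suc.IH) auto
  qed (use fd_eqI[OF d] in auto)
  ultimately show ?case by (auto simp: differentiable_def)
qed

lemma Ck_on_sum:
  assumes "open S" "\<And>i. i \<in> I \<Longrightarrow> Ck_on k (f i) S"
  shows "Ck_on k (\<lambda>x. \<Sum>i\<in>I. f i x) S"
  using assms(2)
  by (induction I rule: infinite_finite_induct) (auto intro!: Ck_on_add Ck_on_const assms(1))

text \<open>Expanding the inner derivative in the basis writes the chain rule as a sum of products of functions of
  one order less, and so the induction closes.\<close>
lemma Ck_on_compose:
  fixes f :: "'a::real_normed_vector \<Rightarrow> 'e::euclidean_space" and g :: "'e \<Rightarrow> 'b::real_normed_vector"
  assumes "open S" "open T" "Ck_on k f S" "Ck_on k g T" "f ` S \<subseteq> T"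
  shows "Ck_on k (\<lambda>x. g (f x)) S"
  using assms(3,4)
proof (induction k arbitrary: g)
  case 0
  then show ?case using assms(5) by (auto intro: continuous_on_compose2)
next
  case (Suc k)
  have d: "((\<lambda>x. g (f x)) has_derivative (\<lambda>w. fd g (f x) (fd f x w))) (at x)"
    if "x \<in> S" for x
  proof -
    have "(f has_derivative fd f x) (at x)" "(g has_derivative fd g (f x)) (at (f x))"
      using Suc.prems that assms(5) by (auto intro!: has_fd)
    from diff_chain_at[OF this] show ?thesis by (simp add: o_def)
  qed
  have e: "fd (\<lambda>x. g (f x)) x w = (\<Sum>b\<in>Basis. (fd f x w \<bullet> b) *\<^sub>R fd g (f x) b)" if "x \<in> S" for x w
  proof -
    have "linear (fd g (f x))"
      using Suc.prems that assms(5) by (intro linear_frechet_derivative) auto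
    then have "fd g (f x) (\<Sum>b\<in>Basis. (fd f x w \<bullet> b) *\<^sub>R b) = (\<Sum>b\<in>Basis. (fd f x w \<bullet> b) *\<^sub>R fd g (f x) b)"
      by (simp add: linear_sum linear_cmul)
    then show ?thesis using fd_eqI[OF d[OF that]] by (simp add: euclidean_representation)
  qed
  have "Ck_on k (\<lambda>x. fd (\<lambda>x. g (f x)) x w) S" for w
  proof (rule Ck_on_cong[OF assms(1)])
    show "Ck_on k (\<lambda>x. \<Sum>b\<in>Basis. (fd f x w \<bullet> b) *\<^sub>R fd g (f x) b) S"
    proof (intro Ck_on_sum Ck_on_bilinear[OF _ bounded_bilinear_scaleR] assms(1))
      show "Ck_on k (\<lambda>x. fd f x w \<bullet> b) S" for b
        by (rule Ck_on_linear[OF assms(1) bounded_linear_inner_left]) (use Suc.prems in auto)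
      show "Ck_on k (\<lambda>x. fd g (f x) b) S" for b
        by (rule Suc.IH) (use Suc.prems Ck_on_SucD[OF Suc.prems(1)] in auto)
    qed
  qed (use e in auto)
  with d show ?case by (auto simp: differentiable_def)
qed

lemma Ck_on_id: "Ck_on k (\<lambda>x. x) S"
  by (cases k) (auto simp: Ck_on_const)

lemma Ck_on_inverse: "Ck_on k (inverse :: real \<Rightarrow> real) (- {0})"
proof (induction k)
  case 0
  then show ?case by (auto intro!: continuous_intros)
next
  case (Suc k)
  have o: "open (- {0::real})" by auto
  have d: "(inverse has_derivative (\<lambda>w. - (inverse x * w * inverse x))) (at x)" if "x \<noteq> 0" for x :: real
    using has_derivative_inverse'[OF that] by simp
  have "Ck_on k (\<lambda>x. fd inverse x w) (- {0::real})" for w :: real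
  proof (rule Ck_on_cong[OF o])
    show "Ck_on k (\<lambda>x. (- w) * (inverse x * inverse x)) (- {0})"
      by (intro Ck_on_bilinear[OF o bounded_bilinear_mult] Suc Ck_on_const)
  qed (use fd_eqI[OF d] in auto)
  with d show ?case by (auto simp: differentiable_def)
qed

lemma smooth_on_cong: "open S \<Longrightarrow> (\<And>x. x \<in> S \<Longrightarrow> f x = g x) \<Longrightarrow> smooth_on f S \<Longrightarrow> smooth_on g S"
  unfolding smooth_on_def using Ck_on_cong by metis

lemma smooth_on_subset: "smooth_on f S \<Longrightarrow> T \<subseteq> S \<Longrightarrow> smooth_on f T"
  unfolding smooth_on_def using Ck_on_subset by metis

lemma smooth_on_local:
  "(\<And>x. x \<in> S \<Longrightarrow> \<exists>T. open T \<and> x \<in> T \<and> smooth_on f T) \<Longrightarrow> smooth_on f S"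
  unfolding smooth_on_def using Ck_on_local by metis

lemma smooth_on_const: "smooth_on (\<lambda>x. c) S"
  by (simp add: smooth_on_def Ck_on_const)

lemma smooth_on_id: "smooth_on (\<lambda>x. x) S"
  by (simp add: smooth_on_def Ck_on_id)

lemma smooth_on_linear: "open S \<Longrightarrow> bounded_linear L \<Longrightarrow> smooth_on f S \<Longrightarrow> smooth_on (\<lambda>x. L (f x)) S"
  by (simp add: smooth_on_def Ck_on_linear)

lemma smooth_on_add: "open S \<Longrightarrow> smooth_on f S \<Longrightarrow> smooth_on g S \<Longrightarrow> smooth_on (\<lambda>x. f x + g x) S"
  by (simp add: smooth_on_def Ck_on_add)

lemma smooth_on_minus: "open S \<Longrightarrow> smooth_on f S \<Longrightarrow> smooth_on (\<lambda>x. - f x) S"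
  by (rule smooth_on_linear[OF _ bounded_linear_minus[OF bounded_linear_ident]])

lemma smooth_on_diff: "open S \<Longrightarrow> smooth_on f S \<Longrightarrow> smooth_on g S \<Longrightarrow> smooth_on (\<lambda>x. f x - g x) S"
  using smooth_on_add[OF _ _ smooth_on_minus, of S f g] by simp

lemma smooth_on_sum:
  "open S \<Longrightarrow> (\<And>i. i \<in> I \<Longrightarrow> smooth_on (f i) S) \<Longrightarrow> smooth_on (\<lambda>x. \<Sum>i\<in>I. f i x) S"
  by (simp add: smooth_on_def Ck_on_sum)

lemma smooth_on_bilinear:
  "open S \<Longrightarrow> bounded_bilinear B \<Longrightarrow> smooth_on f S \<Longrightarrow> smooth_on g S \<Longrightarrow> smooth_on (\<lambda>x. B (f x) (g x)) S"
  by (simp add: smooth_on_def Ck_on_bilinear)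

lemmas smooth_on_scaleR = smooth_on_bilinear[OF _ bounded_bilinear_scaleR]
lemmas smooth_on_inner = smooth_on_bilinear[OF _ bounded_bilinear_inner]
lemmas smooth_on_mult = smooth_on_bilinear[OF _ bounded_bilinear_mult]

lemma smooth_on_compose:
  fixes f :: "'a::real_normed_vector \<Rightarrow> 'e::euclidean_space" and g :: "'e \<Rightarrow> 'b::real_normed_vector"
  assumes "open S" "open T" "smooth_on f S" "smooth_on g T" "f ` S \<subseteq> T"
  shows "smooth_on (\<lambda>x. g (f x)) S"
  using assms by (simp add: smooth_on_def Ck_on_compose)

lemma smooth_on_inverse:
  fixes f :: "'a::real_normed_vector \<Rightarrow> real"
  assumes "open S" "smooth_on f S" "\<And>x. x \<in> S \<Longrightarrow> f x \<noteq> 0"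
  shows "smooth_on (\<lambda>x. inverse (f x)) S"
  by (rule smooth_on_compose[OF assms(1) _ assms(2), of "- {0}"])
    (use assms(3) Ck_on_inverse in \<open>auto simp: smooth_on_def\<close>)

lemma smooth_on_Pair:
  assumes "open S" "smooth_on f S" "smooth_on g S"
  shows "smooth_on (\<lambda>x. (f x, g x)) S"
proof -
  have "smooth_on (\<lambda>x. (f x, 0) + (0, g x)) S"
    by (intro smooth_on_add assms smooth_on_linear[where L="\<lambda>x. (x, 0)"] smooth_on_linear[where L="\<lambda>x. (0, x)"])
      (auto intro!: bounded_linear_Pair bounded_linear_ident bounded_linear_zero)
  then show ?thesis by simp
qed

lemma smooth_on_componentwise:
  fixes f :: "'a::real_normed_vector \<Rightarrow> 'e::euclidean_space"
  assumes "open S" "\<And>b. b \<in> Basis \<Longrightarrow> smooth_on (\<lambda>x. f x \<bullet> b) S"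
  shows "smooth_on f S"
proof -
  have "smooth_on (\<lambda>x. \<Sum>b\<in>Basis. (f x \<bullet> b) *\<^sub>R b) S"
    using assms by (intro smooth_on_sum smooth_on_scaleR smooth_on_const)
  then show ?thesis by (simp add: euclidean_representation)
qed

lemma smooth_on_differentiable: "smooth_on f S \<Longrightarrow> x \<in> S \<Longrightarrow> f differentiable (at x)"
  unfolding smooth_on_def using Ck_on.simps(2) by blast

lemma smooth_on_has_fd: "smooth_on f S \<Longrightarrow> x \<in> S \<Longrightarrow> (f has_derivative fd f x) (at x)"
  by (simp add: has_fd smooth_on_differentiable)

lemma smooth_on_continuous: "smooth_on f S \<Longrightarrow> continuous_on S f"
  unfolding smooth_on_def by (metis Ck_on.simps(1))

lemma smooth_on_fd_const: "smooth_on f S \<Longrightarrow> smooth_on (\<lambda>x. fd f x w) S"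
  unfolding smooth_on_def using Ck_on.simps(2) by blast

lemma linear_fd: "smooth_on f S \<Longrightarrow> x \<in> S \<Longrightarrow> linear (fd f x)"
  by (simp add: linear_frechet_derivative smooth_on_differentiable)

lemma fd_euclidean_expand:
  fixes f :: "'a::euclidean_space \<Rightarrow> 'b::real_normed_vector"
  assumes "smooth_on f S" "x \<in> S"
  shows "fd f x w = (\<Sum>b\<in>Basis. (w \<bullet> b) *\<^sub>R fd f x b)"
proof -
  have "fd f x (\<Sum>b\<in>Basis. (w \<bullet> b) *\<^sub>R b) = (\<Sum>b\<in>Basis. (w \<bullet> b) *\<^sub>R fd f x b)"
    using linear_fd[OF assms] by (simp add: linear_sum linear_cmul)
  then show ?thesis by (simp add: euclidean_representation)
qed

lemma smooth_on_fd:
  fixes f :: "'a::euclidean_space \<Rightarrow> 'b::real_normed_vector"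
  assumes "open S" "smooth_on f S" "smooth_on w S"
  shows "smooth_on (\<lambda>x. fd f x (w x)) S"
proof (rule smooth_on_cong[OF assms(1)])
  show "smooth_on (\<lambda>x. \<Sum>b\<in>Basis. (w x \<bullet> b) *\<^sub>R fd f x b) S"
    by (intro smooth_on_sum smooth_on_scaleR smooth_on_inner assms smooth_on_const smooth_on_fd_const)
qed (metis fd_euclidean_expand assms(2))

lemma fd_compose:
  assumes "smooth_on f S" "x \<in> S" "smooth_on g T" "f x \<in> T"
  shows "fd (\<lambda>x. g (f x)) x w = fd g (f x) (fd f x w)"
  using diff_chain_at[OF smooth_on_has_fd[OF assms(1,2)] smooth_on_has_fd[OF assms(3,4)]]
  by (simp add: fd_eqI o_def)

text \<open>The derivative of \<open>f\<close> along a field \<open>w\<close>, differentiated once more: the second derivative of \<open>f\<close> plus a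
  first-order term from the variation of \<open>w\<close>.\<close>
lemma fd_of_fd:
  fixes f :: "'a::euclidean_space \<Rightarrow> real"
  assumes "open S" "smooth_on f S" "smooth_on w S" "x \<in> S"
  shows "fd (\<lambda>z. fd f z (w z)) x v = fd (\<lambda>z. fd f z (w x)) x v + fd f x (fd w x v)"
proof -
  have e: "fd f z u = (\<Sum>b\<in>Basis. (u \<bullet> b) * fd f z b)" if "z \<in> S" for z u
    using fd_euclidean_expand[OF assms(2) that] unfolding real_scaleR_def .
  have db: "((\<lambda>z. fd f z b) has_derivative fd (\<lambda>z. fd f z b) x) (at x)" for b
    by (rule smooth_on_has_fd[OF smooth_on_fd_const[OF assms(2)] assms(4)])
  have dw: "(w has_derivative fd w x) (at x)" by (rule smooth_on_has_fd[OF assms(3,4)])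
  have "fd (\<lambda>z. fd f z (w z)) x = fd (\<lambda>z. \<Sum>b\<in>Basis. (w z \<bullet> b) * fd f z b) x"
    by (rule fd_cong[OF assms(1,4)]) (rule e)
  also have "\<dots> = (\<lambda>v. \<Sum>b\<in>Basis. (w x \<bullet> b) * fd (\<lambda>z. fd f z b) x v + (fd w x v \<bullet> b) * fd f x b)"
  proof (rule fd_eqI, rule has_derivative_sum)
    fix b
    show "((\<lambda>z. (w z \<bullet> b) * fd f z b) has_derivative
        (\<lambda>v. (w x \<bullet> b) * fd (\<lambda>z. fd f z b) x v + (fd w x v \<bullet> b) * fd f x b)) (at x)"
      by (rule has_derivative_mult[OF has_derivative_inner_left[OF dw] db])
  qed
  finally have 1: "fd (\<lambda>z. fd f z (w z)) x v
      = (\<Sum>b\<in>Basis. (w x \<bullet> b) * fd (\<lambda>z. fd f z b) x v) + fd f x (fd w x v)"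
    by (simp only: sum.distrib e[OF assms(4), of "fd w x v", symmetric])
  have "fd (\<lambda>z. fd f z (w x)) x = fd (\<lambda>z. \<Sum>b\<in>Basis. (w x \<bullet> b) * fd f z b) x"
    by (rule fd_cong[OF assms(1,4)]) (rule e)
  also have "\<dots> = (\<lambda>v. \<Sum>b\<in>Basis. (w x \<bullet> b) * fd (\<lambda>z. fd f z b) x v)"
  proof (rule fd_eqI, rule has_derivative_sum)
    fix b
    show "((\<lambda>z. (w x \<bullet> b) * fd f z b) has_derivative
        (\<lambda>v. (w x \<bullet> b) * fd (\<lambda>z. fd f z b) x v)) (at x)"
      by (rule has_derivative_mult_right[OF db])
  qed
  finally show ?thesis using 1 by simp
qed

text \<open>The mean value theorem is applied to the difference in the direction \<open>v\<close> as a function of the \<open>u\<close>-side,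
  and then to the derivative so obtained.\<close>
lemma second_difference:
  fixes f :: "'a::euclidean_space \<Rightarrow> real"
  assumes "smooth_on f (ball x r)" "0 < s" "0 < t" "s * norm u + t * norm v < r"
  shows "\<exists>y\<in>ball x r. f (x + s *\<^sub>R u + t *\<^sub>R v) - f (x + s *\<^sub>R u) - f (x + t *\<^sub>R v) + f x
           = s * t * fd (\<lambda>z. fd f z u) y v"
proof -
  let ?B = "ball x r"
  have inB: "x + a *\<^sub>R u + b *\<^sub>R v \<in> ?B" if "0 \<le> a" "a \<le> s" "0 \<le> b" "b \<le> t" for a b
  proof -
    have "norm (a *\<^sub>R u + b *\<^sub>R v) \<le> a * norm u + b * norm v"
      using that norm_triangle_ineq[of "a *\<^sub>R u" "b *\<^sub>R v"] by simp
    also have "\<dots> \<le> s * norm u + t * norm v"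
      using that by (intro add_mono mult_right_mono) auto
    also have "\<dots> < r" by fact
    finally have "norm (a *\<^sub>R u + b *\<^sub>R v) < r" .
    moreover have "dist x (x + a *\<^sub>R u + b *\<^sub>R v) = norm (a *\<^sub>R u + b *\<^sub>R v)"
      by (metis add.assoc add_diff_cancel_left' dist_commute dist_norm)
    ultimately show ?thesis by simp
  qed
  define \<phi> where "\<phi> a = f (x + a *\<^sub>R u + t *\<^sub>R v) - f (x + a *\<^sub>R u)" for a
  have d1: "((\<lambda>a. f (x + a *\<^sub>R u + b *\<^sub>R v)) has_real_derivative fd f (x + a *\<^sub>R u + b *\<^sub>R v) u) (at a)"
    if "0 \<le> a" "a \<le> s" "0 \<le> b" "b \<le> t" for a b
  proof -
    have "((\<lambda>a. x + a *\<^sub>R u + b *\<^sub>R v) has_derivative (\<lambda>h. h *\<^sub>R u)) (at a)"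
      by (auto intro!: derivative_eq_intros)
    from diff_chain_at[OF this smooth_on_has_fd[OF assms(1) inB[OF that]]]
    show ?thesis
      using linear_cmul[OF linear_fd[OF assms(1) inB[OF that]]]
      by (simp add: o_def has_field_derivative_def mult_commute_abs)
  qed
  have "DERIV \<phi> a :> fd f (x + a *\<^sub>R u + t *\<^sub>R v) u - fd f (x + a *\<^sub>R u) u" if "0 \<le> a" "a \<le> s" for a
    unfolding \<phi>_def using d1[of a t] d1[of a 0] that assms(2,3) by (auto intro!: DERIV_diff)
  from MVT2[OF assms(2) this] obtain a where a: "0 < a" "a < s"
    "\<phi> s - \<phi> 0 = s * (fd f (x + a *\<^sub>R u + t *\<^sub>R v) u - fd f (x + a *\<^sub>R u) u)" by auto
  have d2: "((\<lambda>b. fd f (x + a *\<^sub>R u + b *\<^sub>R v) u) has_real_derivative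
      fd (\<lambda>z. fd f z u) (x + a *\<^sub>R u + b *\<^sub>R v) v) (at b)" if "0 \<le> b" "b \<le> t" for b
  proof -
    have s2: "smooth_on (\<lambda>z. fd f z u) ?B" by (rule smooth_on_fd_const[OF assms(1)])
    have m: "x + a *\<^sub>R u + b *\<^sub>R v \<in> ?B" using inB[of a b] a that by simp
    have "((\<lambda>b. x + a *\<^sub>R u + b *\<^sub>R v) has_derivative (\<lambda>h. h *\<^sub>R v)) (at b)"
      by (auto intro!: derivative_eq_intros)
    from diff_chain_at[OF this smooth_on_has_fd[OF s2 m]]
    show ?thesis
      using linear_cmul[OF linear_fd[OF s2 m]]
      by (simp add: o_def has_field_derivative_def mult_commute_abs)
  qed
  from MVT2[OF assms(3) d2] obtain b where b: "0 < b" "b < t"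
    "fd f (x + a *\<^sub>R u + t *\<^sub>R v) u - fd f (x + a *\<^sub>R u) u
      = t * fd (\<lambda>z. fd f z u) (x + a *\<^sub>R u + b *\<^sub>R v) v" by auto
  have "x + a *\<^sub>R u + b *\<^sub>R v \<in> ?B" using inB[of a b] a b by simp
  moreover have "\<phi> s - \<phi> 0 = s * t * fd (\<lambda>z. fd f z u) (x + a *\<^sub>R u + b *\<^sub>R v) v"
    using a(3) b(3) by simp
  ultimately show ?thesis unfolding \<phi>_def by (intro bexI) auto
qed

text \<open>If the two mixed derivatives differed at \<open>x\<close>, by continuity all their values on a small ball would
  differ; but the second difference over a small square is a value of each of them.\<close>
lemma fd_fd_commute:
  fixes f :: "'a::euclidean_space \<Rightarrow> real"
  assumes "open S" "smooth_on f S" "x \<in> S"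
  shows "fd (\<lambda>z. fd f z u) x v = fd (\<lambda>z. fd f z v) x u"
proof (rule ccontr)
  let ?A = "\<lambda>y. fd (\<lambda>z. fd f z u) y v" and ?B = "\<lambda>y. fd (\<lambda>z. fd f z v) y u"
  assume ne: "?A x \<noteq> ?B x"
  define e where "e = \<bar>?A x - ?B x\<bar> / 2"
  have e: "e > 0" using ne by (simp add: e_def)
  have "isCont ?A x" "isCont ?B x"
    using smooth_on_continuous[OF smooth_on_fd_const[OF smooth_on_fd_const[OF assms(2)]]] assms(3)
    unfolding continuous_on_eq_continuous_at[OF assms(1)] by blast+
  then obtain r1 r2 where r: "r1 > 0" "r2 > 0"
    "\<And>y. dist y x < r1 \<Longrightarrow> dist (?A y) (?A x) < e" "\<And>y. dist y x < r2 \<Longrightarrow> dist (?B y) (?B x) < e"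
    using e unfolding continuous_at_eps_delta by metis
  obtain r3 where r3: "r3 > 0" "ball x r3 \<subseteq> S" using assms openE by blast
  define r where "r = Min {r1, r2, r3}"
  have rr: "r > 0" "r \<le> r1" "r \<le> r2" "r \<le> r3" using r(1,2) r3(1) by (auto simp: r_def)
  define t where "t = r / (2 * (norm u + norm v + 1))"
  have n: "norm u + norm v + 1 > 0" using norm_ge_zero[of u] norm_ge_zero[of v] by linarith
  have t: "t > 0" using rr n by (simp add: t_def)
  have "t * (norm u + norm v) \<le> t * (norm u + norm v + 1)" using t by simp
  also have "\<dots> = r / 2" using n by (simp add: t_def field_simps)
  also have "\<dots> < r" using rr by simp
  finally have tt: "t * norm u + t * norm v < r" "t * norm v + t * norm u < r"
    by (auto simp: algebra_simps)
  have sm: "smooth_on f (ball x r)"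
    by (rule smooth_on_subset[OF assms(2)]) (use r3 rr in \<open>auto simp: ball_def\<close>)
  obtain y where y: "y \<in> ball x r"
    "f (x + t *\<^sub>R u + t *\<^sub>R v) - f (x + t *\<^sub>R u) - f (x + t *\<^sub>R v) + f x = t * t * ?A y"
    using second_difference[OF sm t t tt(1)] by blast
  obtain z where z: "z \<in> ball x r"
    "f (x + t *\<^sub>R v + t *\<^sub>R u) - f (x + t *\<^sub>R v) - f (x + t *\<^sub>R u) + f x = t * t * ?B z"
    using second_difference[OF sm t t tt(2)] by blast
  have swap: "x + t *\<^sub>R v + t *\<^sub>R u = x + t *\<^sub>R u + t *\<^sub>R v" by simp
  have "t * t * ?A y = t * t * ?B z" using y(2) z(2)[unfolded swap] by linarith
  then have yz: "?A y = ?B z" using t by simp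
  have "dist y x < r1" "dist z x < r2"
    using y(1) z(1) rr by (auto simp: dist_commute)
  then have "dist (?A y) (?A x) < e" "dist (?B z) (?B x) < e"
    using r(3)[of y] r(4)[of z] by blast+
  then have "dist (?A x) (?A y) < e" "dist (?B x) (?A y) < e"
    unfolding yz dist_commute[of "?A x"] dist_commute[of "?B x"] .
  then have "dist (?A x) (?B x) < e + e" by (rule dist_triangle_less_add)
  then show False by (simp add: e_def dist_real_def)
qed

section \<open>Tangent vectors and vector fields in charts\<close>

abbreviation local_rep :: "('m, 'e) chart \<Rightarrow> ('m \<Rightarrow> 'b) \<Rightarrow> 'e \<Rightarrow> 'b"
  where "local_rep c a \<equiv> a \<circ> inv_into (fst c) (snd c)"

definition vec_comp :: "('m, 'e::euclidean_space) chart \<Rightarrow> (('m \<Rightarrow> real) \<Rightarrow> real) \<Rightarrow> 'e"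
  where "vec_comp c v = (\<Sum>b\<in>Basis. v (\<lambda>q. snd c q \<bullet> b) *\<^sub>R b)"

definition field_rep :: "('m, 'e::euclidean_space) chart \<Rightarrow> 'm vfield \<Rightarrow> 'e \<Rightarrow> 'e"
  where "field_rep c X x = vec_comp c (X (inv_into (fst c) (snd c) x))"

locale smooth_atlas =
  fixes A :: "('m, 'e::euclidean_space) chart set"
  assumes atlas: "is_atlas A"
begin

lemma chart_inj: "c \<in> A \<Longrightarrow> inj_on (snd c) (fst c)"
  and chart_open: "c \<in> A \<Longrightarrow> open (snd c ` fst c)"
  and overlap_open: "c \<in> A \<Longrightarrow> d \<in> A \<Longrightarrow> open (snd c ` (fst c \<inter> fst d))"
  and transition_smooth: "c \<in> A \<Longrightarrow> d \<in> A \<Longrightarrow> smooth_on (local_rep c (snd d)) (snd c ` (fst c \<inter> fst d))"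
  using atlas unfolding is_atlas_def by fastforce+

lemma inv_chart [simp]: "c \<in> A \<Longrightarrow> p \<in> fst c \<Longrightarrow> inv_into (fst c) (snd c) (snd c p) = p"
  by (simp add: chart_inj inv_into_f_f)

lemma points_chartE: assumes "p \<in> points A" obtains c where "c \<in> A" "p \<in> fst c"
  using assms unfolding points_def by auto

lemma chart_points: "c \<in> A \<Longrightarrow> p \<in> fst c \<Longrightarrow> p \<in> points A"
  unfolding points_def by auto

lemma openin_mtop:
  "openin (mtop A) W \<longleftrightarrow> W \<subseteq> points A \<and> (\<forall>c\<in>A. open (snd c ` (fst c \<inter> W)))"
proof -
  let ?P = "\<lambda>W. W \<subseteq> points A \<and> (\<forall>c\<in>A. open (snd c ` (fst c \<inter> W)))"
  have "istopology ?P"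
    unfolding istopology_def
  proof (intro conjI allI impI)
    fix S T assume ST: "?P S" "?P T"
    have "open (snd c ` (fst c \<inter> (S \<inter> T)))" if c: "c \<in> A" for c
    proof -
      have "snd c ` (fst c \<inter> (S \<inter> T)) = snd c ` (fst c \<inter> S) \<inter> snd c ` (fst c \<inter> T)"
        using inj_on_image_Int[OF chart_inj[OF c], of "fst c \<inter> S" "fst c \<inter> T"]
        by (simp add: Int_assoc Int_left_commute Int_absorb)
      then show ?thesis using ST c by auto
    qed
    then show "S \<inter> T \<subseteq> points A" "\<forall>c\<in>A. open (snd c ` (fst c \<inter> (S \<inter> T)))"
      using ST by auto
  next
    fix K assume K: "\<forall>S\<in>K. ?P S"
    show "\<Union>K \<subseteq> points A" using K by auto
    show "\<forall>c\<in>A. open (snd c ` (fst c \<inter> \<Union>K))"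
    proof
      fix c assume c: "c \<in> A"
      have "snd c ` (fst c \<inter> \<Union>K) = (\<Union>S\<in>K. snd c ` (fst c \<inter> S))" by blast
      then show "open (snd c ` (fst c \<inter> \<Union>K))" using K c by auto
    qed
  qed
  moreover have "mtop A = topology ?P"
    unfolding mtop_def by (rule arg_cong[where f=topology]) (auto simp: fun_eq_iff split: prod.splits)
  ultimately show ?thesis by (simp add: topology_inverse')
qed

lemma openin_chart: "c \<in> A \<Longrightarrow> openin (mtop A) (fst c)"
  unfolding openin_mtop by (auto simp: points_def overlap_open)

lemma topspace_mtop: "topspace (mtop A) = points A"
proof
  show "topspace (mtop A) \<subseteq> points A"
    using openin_topspace openin_mtop by blast
  show "points A \<subseteq> topspace (mtop A)"
    using openin_subset[OF openin_chart] unfolding points_def by auto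
qed

lemma openin_points: "openin (mtop A) (points A)"
  using openin_topspace[of "mtop A"] by (simp add: topspace_mtop)

lemma openin_sub: "openin (mtop A) W \<Longrightarrow> p \<in> W \<Longrightarrow> p \<in> points A"
  using openin_mtop by blast

lemma open_chart_image: "openin (mtop A) W \<Longrightarrow> c \<in> A \<Longrightarrow> open (snd c ` (fst c \<inter> W))"
  by (simp add: openin_mtop)

lemma openin_chart_preimage:
  assumes c: "c \<in> A" and T: "open T"
  shows "openin (mtop A) {q \<in> fst c. snd c q \<in> T}"
  unfolding openin_mtop
proof (intro conjI ballI)
  show "{q \<in> fst c. snd c q \<in> T} \<subseteq> points A" using c by (auto simp: points_def)
  fix d assume d: "d \<in> A"
  have eq: "snd d ` (fst d \<inter> {q \<in> fst c. snd c q \<in> T})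
      = snd d ` (fst d \<inter> fst c) \<inter> local_rep d (snd c) -` T"
    using d by (auto simp: image_iff)
  show "open (snd d ` (fst d \<inter> {q \<in> fst c. snd c q \<in> T}))"
    unfolding eq
    by (rule continuous_open_preimage[OF smooth_on_continuous[OF transition_smooth[OF d c]] overlap_open[OF d c] T])
qed

text \<open>Chart changes are smooth, so smoothness near a point can be tested in any one chart around it.\<close>
lemma smooth_near_iff:
  assumes c: "c \<in> A" and p: "p \<in> fst c"
  shows "smooth_near A p a \<longleftrightarrow>
    (\<exists>T. open T \<and> snd c p \<in> T \<and> T \<subseteq> snd c ` fst c \<and> smooth_on (local_rep c a) T)"
proof
  assume "smooth_near A p a"
  then obtain W where "openin (mtop A) W" "p \<in> W" "smooth_fun_on A W a"
    unfolding smooth_near_def by auto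
  then show "\<exists>T. open T \<and> snd c p \<in> T \<and> T \<subseteq> snd c ` fst c \<and> smooth_on (local_rep c a) T"
    using c p unfolding smooth_fun_on_def
    by (intro exI[of _ "snd c ` (fst c \<inter> W)"]) (auto simp: open_chart_image)
next
  assume "\<exists>T. open T \<and> snd c p \<in> T \<and> T \<subseteq> snd c ` fst c \<and> smooth_on (local_rep c a) T"
  then obtain T where T: "open T" "snd c p \<in> T" "T \<subseteq> snd c ` fst c" "smooth_on (local_rep c a) T" by auto
  let ?W = "{q \<in> fst c. snd c q \<in> T}"
  have "smooth_fun_on A ?W a"
    unfolding smooth_fun_on_def
  proof clarify
    fix U \<psi> assume "(U, \<psi>) \<in> A"
    then have d: "(U, \<psi>) \<in> A" (is "?d \<in> A") .
    have o: "open (\<psi> ` (U \<inter> ?W))"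
      using open_chart_image[OF openin_chart_preimage[OF c T(1)] d] by simp
    show "smooth_on (a \<circ> inv_into U \<psi>) (\<psi> ` (U \<inter> ?W))"
    proof (rule smooth_on_cong[OF o])
      show "smooth_on (\<lambda>x. local_rep c a (local_rep ?d (snd c) x)) (\<psi> ` (U \<inter> ?W))"
      proof (rule smooth_on_compose[OF o T(1) _ T(4)])
        show "smooth_on (local_rep ?d (snd c)) (\<psi> ` (U \<inter> ?W))"
          by (rule smooth_on_subset[OF transition_smooth[OF d c]]) auto
        show "local_rep ?d (snd c) ` (\<psi> ` (U \<inter> ?W)) \<subseteq> T"
          using inv_chart[OF d] by auto
      qed
    qed (use inv_chart[OF d] inv_chart[OF c] in auto)
  qed
  then show "smooth_near A p a"
    unfolding smooth_near_def using T(2) p openin_chart_preimage[OF c T(1)] by blast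
qed

lemma smooth_near_fun_on: "openin (mtop A) W \<Longrightarrow> p \<in> W \<Longrightarrow> smooth_fun_on A W a \<Longrightarrow> smooth_near A p a"
  unfolding smooth_near_def by blast

lemma smooth_near_points: "smooth_near A p a \<Longrightarrow> p \<in> points A"
  unfolding smooth_near_def using openin_sub by blast

lemma smooth_fun_onI:
  assumes "openin (mtop A) W" "\<And>p. p \<in> W \<Longrightarrow> smooth_near A p a"
  shows "smooth_fun_on A W a"
  unfolding smooth_fun_on_def
proof clarify
  fix U \<psi> assume d: "(U, \<psi>) \<in> A"
  show "smooth_on (a \<circ> inv_into U \<psi>) (\<psi> ` (U \<inter> W))"
  proof (rule smooth_on_local)
    fix x assume "x \<in> \<psi> ` (U \<inter> W)"
    then obtain p where "p \<in> U" "p \<in> W" "x = \<psi> p" by auto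
    then show "\<exists>T. open T \<and> x \<in> T \<and> smooth_on (a \<circ> inv_into U \<psi>) T"
      using smooth_near_iff[OF d, of p a] assms(2)[of p] by auto
  qed
qed

lemma smooth_fun_onD:
  "smooth_fun_on A W a \<Longrightarrow> c \<in> A \<Longrightarrow> smooth_on (local_rep c a) (snd c ` (fst c \<inter> W))"
  unfolding smooth_fun_on_def by (cases c) auto

lemma smooth_near_cong:
  assumes W: "openin (mtop A) W" "p \<in> W" and ab: "\<And>q. q \<in> W \<Longrightarrow> a q = b q"
  shows "smooth_near A p a \<longleftrightarrow> smooth_near A p b"
proof -
  obtain c where c: "c \<in> A" "p \<in> fst c" using W openin_sub points_chartE by metis
  have "smooth_near A p b"
    if a: "smooth_near A p a" and ab: "\<And>q. q \<in> W \<Longrightarrow> a q = b q" for a b :: "'m \<Rightarrow> real"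
  proof -
    obtain T where T: "open T" "snd c p \<in> T" "T \<subseteq> snd c ` fst c" "smooth_on (local_rep c a) T"
      using a smooth_near_iff[OF c] by auto
    let ?T = "T \<inter> snd c ` (fst c \<inter> W)"
    have o: "open ?T" using T open_chart_image[OF W(1) c(1)] by auto
    have "smooth_on (local_rep c b) ?T"
      by (rule smooth_on_cong[OF o _ smooth_on_subset[OF T(4)]]) (use c ab in auto)
    then show ?thesis using smooth_near_iff[OF c] o T c W by blast
  qed
  then show ?thesis using ab by metis
qed

lemma local_rep_cong:
  assumes "c \<in> A" "p \<in> fst c" "openin (mtop A) W" "p \<in> W" "\<And>q. q \<in> W \<Longrightarrow> a q = b q"
  shows "fd (local_rep c a) (snd c p) = fd (local_rep c b) (snd c p)"
  by (rule fd_cong[OF open_chart_image[OF assms(3,1)]]) (use assms in auto)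

lemma coord_vec_cong:
  assumes "c \<in> A" "p \<in> fst c" "openin (mtop A) W" "p \<in> W" "\<And>q. q \<in> W \<Longrightarrow> a q = b q"
  shows "coord_vec A c p w a = coord_vec A c p w b"
  using smooth_near_cong[OF assms(3-5)] local_rep_cong[OF assms] by (simp add: coord_vec_def)

lemma coord_vec_smooth: "smooth_near A p a \<Longrightarrow> coord_vec A c p w a = fd (local_rep c a) (snd c p) w"
  by (simp add: coord_vec_def)

lemma coord_vec_not_smooth: "\<not> smooth_near A p a \<Longrightarrow> coord_vec A c p w a = 0"
  by (simp add: coord_vec_def)

lemma smooth_near_rep:
  assumes "c \<in> A" "p \<in> fst c" "smooth_near A p a"
  obtains T where "open T" "snd c p \<in> T" "T \<subseteq> snd c ` fst c" "smooth_on (local_rep c a) T"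
  using smooth_near_iff[OF assms(1,2)] assms(3) by auto

lemma smooth_near_rep2:
  assumes c: "c \<in> A" "p \<in> fst c" and ab: "smooth_near A p a" "smooth_near A p b"
  obtains T where "open T" "snd c p \<in> T" "T \<subseteq> snd c ` fst c" "smooth_on (local_rep c a) T" "smooth_on (local_rep c b) T"
proof -
  obtain T1 T2 where "open T1" "snd c p \<in> T1" "T1 \<subseteq> snd c ` fst c" "smooth_on (local_rep c a) T1"
    "open T2" "snd c p \<in> T2" "T2 \<subseteq> snd c ` fst c" "smooth_on (local_rep c b) T2"
    using smooth_near_rep[OF c] ab by metis
  then show ?thesis by (intro that[of "T1 \<inter> T2"]) (auto elim: smooth_on_subset)
qed

lemma smooth_near_bilinear:
  assumes B: "bounded_bilinear B" and ab: "smooth_near A p a" "smooth_near A p b"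
  shows "smooth_near A p (\<lambda>q. B (a q) (b q))"
proof -
  obtain c where c: "c \<in> A" "p \<in> fst c" using ab smooth_near_points points_chartE by metis
  obtain T where T: "open T" "snd c p \<in> T" "T \<subseteq> snd c ` fst c" "smooth_on (local_rep c a) T" "smooth_on (local_rep c b) T"
    using smooth_near_rep2[OF c ab] .
  show ?thesis unfolding smooth_near_iff[OF c]
    using smooth_on_bilinear[OF T(1) B T(4,5)] T by (intro exI[of _ T]) (simp add: o_def)
qed

lemmas smooth_near_mult = smooth_near_bilinear[OF bounded_bilinear_mult]

lemma smooth_near_add:
  assumes ab: "smooth_near A p a" "smooth_near A p b"
  shows "smooth_near A p (\<lambda>q. a q + b q)"
proof -
  obtain c where c: "c \<in> A" "p \<in> fst c" using ab smooth_near_points points_chartE by metis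
  obtain T where T: "open T" "snd c p \<in> T" "T \<subseteq> snd c ` fst c" "smooth_on (local_rep c a) T" "smooth_on (local_rep c b) T"
    using smooth_near_rep2[OF c ab] .
  show ?thesis unfolding smooth_near_iff[OF c]
    using smooth_on_add[OF T(1) T(4,5)] T by (intro exI[of _ T]) (simp add: o_def)
qed

lemma smooth_near_const: "p \<in> points A \<Longrightarrow> smooth_near A p (\<lambda>q. r)"
  unfolding smooth_near_def smooth_fun_on_def o_def
  by (rule exI[of _ "points A"]) (auto simp: openin_points smooth_on_const)

lemma smooth_near_cmult: "smooth_near A p a \<Longrightarrow> smooth_near A p (\<lambda>q. r * a q)"
  using smooth_near_mult[OF smooth_near_const] smooth_near_points by metis

lemma smooth_near_power2: "smooth_near A p a \<Longrightarrow> smooth_near A p (\<lambda>q. (a q)\<^sup>2)"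
  unfolding power2_eq_square by (rule smooth_near_mult)

lemma coord_vec_linear:
  assumes "c \<in> A" "p \<in> fst c"
  shows "coord_vec A c p (v + w) = coord_vec A c p v + coord_vec A c p w"
    and "coord_vec A c p (r *\<^sub>R w) = r *\<^sub>R coord_vec A c p w"
proof -
  have "linear (fd (local_rep c a) (snd c p))" if a: "smooth_near A p a" for a
    using smooth_near_rep[OF assms a] linear_fd by metis
  then show "coord_vec A c p (v + w) = coord_vec A c p v + coord_vec A c p w"
    "coord_vec A c p (r *\<^sub>R w) = r *\<^sub>R coord_vec A c p w"
    by (auto simp: fun_eq_iff coord_vec_def scaleR_fun_def linear_add linear_cmul)
qed

lemma coord_vec_add:
  assumes "c \<in> A" "p \<in> fst c" "smooth_near A p a" "smooth_near A p b"
  shows "coord_vec A c p w (\<lambda>q. a q + b q) = coord_vec A c p w a + coord_vec A c p w b"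
proof -
  obtain T where T: "open T" "snd c p \<in> T" "T \<subseteq> snd c ` fst c" "smooth_on (local_rep c a) T" "smooth_on (local_rep c b) T"
    using smooth_near_rep2[OF assms] .
  have "fd (\<lambda>x. local_rep c a x + local_rep c b x) (snd c p) =
      (\<lambda>w. fd (local_rep c a) (snd c p) w + fd (local_rep c b) (snd c p) w)"
    by (intro fd_eqI has_derivative_add smooth_on_has_fd[OF _ T(2)] T)
  then show ?thesis
    using assms by (simp add: coord_vec_smooth smooth_near_add o_def)
qed

lemma coord_vec_mult:
  assumes "c \<in> A" "p \<in> fst c" "smooth_near A p a" "smooth_near A p b"
  shows "coord_vec A c p w (\<lambda>q. a q * b q) = a p * coord_vec A c p w b + coord_vec A c p w a * b p"
proof -
  obtain T where T: "open T" "snd c p \<in> T" "T \<subseteq> snd c ` fst c" "smooth_on (local_rep c a) T" "smooth_on (local_rep c b) T"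
    using smooth_near_rep2[OF assms] .
  have "fd (\<lambda>x. local_rep c a x * local_rep c b x) (snd c p) =
      (\<lambda>w. local_rep c a (snd c p) * fd (local_rep c b) (snd c p) w +
        fd (local_rep c a) (snd c p) w * local_rep c b (snd c p))"
    by (intro fd_eqI has_derivative_mult smooth_on_has_fd[OF _ T(2)] T)
  then show ?thesis
    using assms by (simp add: coord_vec_smooth smooth_near_mult o_def)
qed

lemma coord_vec_const: "p \<in> points A \<Longrightarrow> coord_vec A c p w (\<lambda>q. r) = 0"
  by (simp add: coord_vec_smooth smooth_near_const o_def)

lemma smooth_near_coordinate:
  assumes c: "c \<in> A" "p \<in> fst c"
  shows "smooth_near A p (\<lambda>q. snd c q \<bullet> b)"
proof -
  have "smooth_on (\<lambda>x. x \<bullet> b) (snd c ` fst c)"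
    by (rule smooth_on_linear[OF chart_open[OF c(1)] bounded_linear_inner_left smooth_on_id])
  then have "smooth_on (local_rep c (\<lambda>q. snd c q \<bullet> b)) (snd c ` fst c)"
    by (rule smooth_on_cong[OF chart_open[OF c(1)], rotated]) (use c in auto)
  then show ?thesis unfolding smooth_near_iff[OF c]
    using chart_open[OF c(1)] c by (intro exI[of _ "snd c ` fst c"]) auto
qed

lemma coord_vec_coordinate:
  assumes "c \<in> A" "p \<in> fst c"
  shows "coord_vec A c p w (\<lambda>q. snd c q \<bullet> b) = w \<bullet> b"
proof -
  have "fd (local_rep c (\<lambda>q. snd c q \<bullet> b)) (snd c p) = fd (\<lambda>x. x \<bullet> b) (snd c p)"
    by (rule fd_cong[OF chart_open[OF assms(1)]]) (use assms in auto)
  also have "\<dots> = (\<lambda>w. w \<bullet> b)"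
    by (intro fd_eqI has_derivative_inner_left has_derivative_ident)
  finally show ?thesis using assms by (simp add: coord_vec_smooth smooth_near_coordinate)
qed

lemma vec_comp_coord_vec:
  assumes "c \<in> A" "p \<in> fst c"
  shows "vec_comp c (coord_vec A c p w) = w"
  unfolding vec_comp_def coord_vec_coordinate[OF assms] by (rule euclidean_representation)

lemma coord_vec_transition:
  assumes c: "c \<in> A" "p \<in> fst c" and d: "d \<in> A" "p \<in> fst d"
  shows "coord_vec A c p w = coord_vec A d p (fd (local_rep c (snd d)) (snd c p) w)"
proof
  fix a
  show "coord_vec A c p w a = coord_vec A d p (fd (local_rep c (snd d)) (snd c p) w) a"
  proof (cases "smooth_near A p a")
    case True
    obtain T where T: "open T" "snd d p \<in> T" "T \<subseteq> snd d ` fst d" "smooth_on (local_rep d a) T"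
      using smooth_near_rep[OF d True] .
    have 1: "fd (local_rep c a) (snd c p) = fd (\<lambda>x. local_rep d a (local_rep c (snd d) x)) (snd c p)"
      by (rule fd_cong[OF overlap_open[OF c(1) d(1)]]) (use c d in auto)
    have "fd (\<lambda>x. local_rep d a (local_rep c (snd d) x)) (snd c p) w
        = fd (local_rep d a) (local_rep c (snd d) (snd c p)) (fd (local_rep c (snd d)) (snd c p) w)"
      by (rule fd_compose[OF transition_smooth[OF c(1) d(1)] _ T(4)]) (use c d T in auto)
    then show ?thesis using True 1 c by (simp add: coord_vec_smooth)
  qed (simp add: coord_vec_not_smooth)
qed

lemma tangent_space_chart:
  assumes "c \<in> A" "p \<in> fst c"
  shows "tangent_space A p = range (coord_vec A c p)"
  unfolding tangent_space_def using coord_vec_transition assms by fast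

lemma coord_vec_tangent: "c \<in> A \<Longrightarrow> p \<in> fst c \<Longrightarrow> coord_vec A c p w \<in> tangent_space A p"
  by (simp add: tangent_space_chart)

lemma coord_vec_vec_comp:
  assumes "c \<in> A" "p \<in> fst c" "v \<in> tangent_space A p"
  shows "coord_vec A c p (vec_comp c v) = v"
  using assms by (auto simp: tangent_space_chart vec_comp_coord_vec)

lemma tangent_chartE:
  assumes "v \<in> tangent_space A p"
  obtains c w where "c \<in> A" "p \<in> fst c" "v = coord_vec A c p w"
  using assms unfolding tangent_space_def by auto

lemma tangent_add: "v \<in> tangent_space A p \<Longrightarrow> smooth_near A p a \<Longrightarrow> smooth_near A p b \<Longrightarrow>
    v (\<lambda>q. a q + b q) = v a + v b"
  by (auto elim!: tangent_chartE simp: coord_vec_add)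

lemma tangent_mult: "v \<in> tangent_space A p \<Longrightarrow> smooth_near A p a \<Longrightarrow> smooth_near A p b \<Longrightarrow>
    v (\<lambda>q. a q * b q) = a p * v b + v a * b p"
  by (auto elim!: tangent_chartE simp: coord_vec_mult)

lemma tangent_const: "v \<in> tangent_space A p \<Longrightarrow> v (\<lambda>q. r) = 0"
  by (auto elim!: tangent_chartE simp: coord_vec_const chart_points)

lemma tangent_cmult: "v \<in> tangent_space A p \<Longrightarrow> smooth_near A p a \<Longrightarrow> v (\<lambda>q. r * a q) = r * v a"
  using tangent_mult[of v p "\<lambda>q. r" a] by (simp add: tangent_const smooth_near_const smooth_near_points)

lemma tangent_power2: "v \<in> tangent_space A p \<Longrightarrow> smooth_near A p a \<Longrightarrow> v (\<lambda>q. (a q)\<^sup>2) = 2 * a p * v a"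
  using tangent_mult[of v p a a] by (simp add: power2_eq_square)

text \<open>The integrals are linear or diagonal quadratic in three momentum functions; the next two lemmas are
  their differentiation rules.\<close>
lemma combination3:
  assumes "smooth_near A p a" "smooth_near A p b" "smooth_near A p c"
  shows "smooth_near A p (\<lambda>q. r * a q + s * b q + t * c q)"
    and "v \<in> tangent_space A p \<Longrightarrow> v (\<lambda>q. r * a q + s * b q + t * c q) = r * v a + s * v b + t * v c"
proof -
  note m = assms[THEN smooth_near_cmult]
  show "smooth_near A p (\<lambda>q. r * a q + s * b q + t * c q)" by (intro smooth_near_add m)
  assume v: "v \<in> tangent_space A p"
  show "v (\<lambda>q. r * a q + s * b q + t * c q) = r * v a + s * v b + t * v c"
    unfolding tangent_add[OF v smooth_near_add[OF m(1,2)] m(3)] tangent_add[OF v m(1,2)]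
      tangent_cmult[OF v assms(1)] tangent_cmult[OF v assms(2)] tangent_cmult[OF v assms(3)] ..
qed

lemma quadratic3:
  assumes "smooth_near A p a" "smooth_near A p b" "smooth_near A p c"
  shows "smooth_near A p (\<lambda>q. r * (a q)\<^sup>2 + s * (b q)\<^sup>2 + t * (c q)\<^sup>2)"
    and "v \<in> tangent_space A p \<Longrightarrow> v (\<lambda>q. r * (a q)\<^sup>2 + s * (b q)\<^sup>2 + t * (c q)\<^sup>2)
      = 2 * (r * a p * v a + s * b p * v b + t * c p * v c)"
proof -
  note s = combination3[OF assms[THEN smooth_near_power2]]
  show "smooth_near A p (\<lambda>q. r * (a q)\<^sup>2 + s * (b q)\<^sup>2 + t * (c q)\<^sup>2)" by (rule s(1))
  assume v: "v \<in> tangent_space A p"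
  show "v (\<lambda>q. r * (a q)\<^sup>2 + s * (b q)\<^sup>2 + t * (c q)\<^sup>2) = 2 * (r * a p * v a + s * b p * v b + t * c p * v c)"
    unfolding s(2)[OF v] tangent_power2[OF v assms(1)] tangent_power2[OF v assms(2)] tangent_power2[OF v assms(3)]
    by (simp add: algebra_simps)
qed

lemma tangent_cong:
  assumes "v \<in> tangent_space A p" "openin (mtop A) W" "p \<in> W" "\<And>q. q \<in> W \<Longrightarrow> a q = b q"
  shows "v a = v b"
  using assms coord_vec_cong by (metis tangent_chartE)

lemma tangent_not_smooth: "v \<in> tangent_space A p \<Longrightarrow> \<not> smooth_near A p a \<Longrightarrow> v a = 0"
  by (auto elim!: tangent_chartE simp: coord_vec_not_smooth)

text \<open>A tangent vector is \<open>0\<close> by convention on functions that are not smooth near its base point, so these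
  need not be tested.\<close>
lemma tangent_eqI:
  assumes "v \<in> tangent_space A p" "w \<in> tangent_space A p" "\<And>a. smooth_near A p a \<Longrightarrow> v a = w a"
  shows "v = w"
proof
  fix a show "v a = w a"
    using assms tangent_not_smooth[OF assms(1), of a] tangent_not_smooth[OF assms(2), of a]
    by (cases "smooth_near A p a") auto
qed

lemma tangent_closed:
  assumes "p \<in> points A"
  shows "v \<in> tangent_space A p \<Longrightarrow> w \<in> tangent_space A p \<Longrightarrow> v + w \<in> tangent_space A p"
    and "v \<in> tangent_space A p \<Longrightarrow> r *\<^sub>R v \<in> tangent_space A p"
    and "0 \<in> tangent_space A p"
proof -
  obtain c where c: "c \<in> A" "p \<in> fst c" using assms points_chartE by metis
  show "v \<in> tangent_space A p \<Longrightarrow> w \<in> tangent_space A p \<Longrightarrow> v + w \<in> tangent_space A p"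
    "v \<in> tangent_space A p \<Longrightarrow> r *\<^sub>R v \<in> tangent_space A p"
    unfolding tangent_space_chart[OF c] by (auto simp flip: coord_vec_linear[OF c])
  have "0 = coord_vec A c p (0 *\<^sub>R 0)" unfolding coord_vec_linear[OF c] by simp
  then show "0 \<in> tangent_space A p" unfolding tangent_space_chart[OF c] by blast
qed

lemma field_tangent: "vector_field_on A W X \<Longrightarrow> p \<in> W \<Longrightarrow> X p \<in> tangent_space A p"
  by (simp add: vector_field_on_def)

lemma smooth_near_field:
  assumes "openin (mtop A) W" "vector_field_on A W X" "p \<in> W" "smooth_near A p a"
  shows "smooth_near A p (\<lambda>q. X q a)"
proof -
  obtain V where V: "openin (mtop A) V" "p \<in> V" "smooth_fun_on A V a"
    using assms(4) unfolding smooth_near_def by auto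
  have o: "openin (mtop A) (W \<inter> V)" using assms V by auto
  have "smooth_fun_on A (W \<inter> V) a"
    by (rule smooth_fun_onI[OF o]) (use V smooth_near_fun_on in auto)
  then have "smooth_fun_on A (W \<inter> V) (\<lambda>q. X q a)"
    using assms(2) o unfolding vector_field_on_def by auto
  then show ?thesis using smooth_near_fun_on[OF o] assms V by auto
qed

lemma field_rep_coord:
  assumes "vector_field_on A W X" "q \<in> W" "c \<in> A" "q \<in> fst c"
  shows "X q = coord_vec A c q (field_rep c X (snd c q))"
  using assms unfolding field_rep_def by (simp add: coord_vec_vec_comp field_tangent)

lemma field_rep_smooth:
  assumes "openin (mtop A) W" "vector_field_on A W X" "c \<in> A"
  shows "smooth_on (field_rep c X) (snd c ` (fst c \<inter> W))"
proof (rule smooth_on_componentwise[OF open_chart_image[OF assms(1,3)]])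
  fix b :: 'e assume b: "b \<in> Basis"
  have o: "openin (mtop A) (fst c \<inter> W)" using assms openin_chart[OF assms(3)] by auto
  have "smooth_fun_on A (fst c \<inter> W) (\<lambda>q. snd c q \<bullet> b)"
    by (rule smooth_fun_onI[OF o]) (use assms smooth_near_coordinate in auto)
  then have "smooth_fun_on A (fst c \<inter> W) (\<lambda>q. X q (\<lambda>q. snd c q \<bullet> b))"
    using assms(2) o unfolding vector_field_on_def by auto
  from smooth_fun_onD[OF this assms(3)]
  show "smooth_on (\<lambda>x. field_rep c X x \<bullet> b) (snd c ` (fst c \<inter> W))"
    using b by (simp add: field_rep_def vec_comp_def o_def inner_sum_left inner_Basis if_distrib sum.delta
        flip: Int_assoc cong: if_cong)
qed

lemma field_rep_smooth_chart:
  assumes "vector_field A X" "c \<in> A"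
  shows "smooth_on (field_rep c X) (snd c ` fst c)"
proof -
  have "fst c \<inter> points A = fst c" using assms(2) by (auto simp: points_def)
  then show ?thesis using field_rep_smooth[OF openin_points assms] by simp
qed

text \<open>Smoothness of a field is smoothness of its components, which may be read in a different chart around
  each point.\<close>
lemma vector_field_onI:
  assumes W: "openin (mtop A) W"
    and X: "\<And>p. p \<in> W \<Longrightarrow> \<exists>c\<in>A. p \<in> fst c \<and> (\<exists>V \<xi>. openin (mtop A) V \<and> p \<in> V \<and> V \<subseteq> fst c \<and>
      smooth_on \<xi> (snd c ` V) \<and> (\<forall>q\<in>V. X q = coord_vec A c q (\<xi> (snd c q))))"
  shows "vector_field_on A W X"
  unfolding vector_field_on_def
proof (intro conjI ballI allI impI)
  fix p assume "p \<in> W"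
  then show "X p \<in> tangent_space A p" using X[of p] by (auto simp: coord_vec_tangent)
next
  fix W' a assume W': "openin (mtop A) W' \<and> W' \<subseteq> W \<and> smooth_fun_on A W' a"
  show "smooth_fun_on A W' (\<lambda>q. X q a)"
  proof (rule smooth_fun_onI)
    fix p assume p: "p \<in> W'"
    then obtain c V \<xi> where c: "c \<in> A" "p \<in> fst c" and V: "openin (mtop A) V" "p \<in> V" "V \<subseteq> fst c"
      and \<xi>: "smooth_on \<xi> (snd c ` V)" "\<And>q. q \<in> V \<Longrightarrow> X q = coord_vec A c q (\<xi> (snd c q))"
      using X[of p] W' by blast
    let ?T = "snd c ` (fst c \<inter> (V \<inter> W'))"
    have oV: "openin (mtop A) (V \<inter> W')" using V W' by auto
    have o: "open ?T" by (rule open_chart_image[OF oV c(1)])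
    have a: "smooth_on (local_rep c a) ?T"
      by (rule smooth_on_subset[OF smooth_fun_onD[OF _ c(1)]]) (use W' in auto)
    have "smooth_on (local_rep c (\<lambda>q. X q a)) ?T"
    proof (rule smooth_on_cong[OF o])
      show "smooth_on (\<lambda>x. fd (local_rep c a) x (\<xi> x)) ?T"
        by (rule smooth_on_fd[OF o a smooth_on_subset[OF \<xi>(1)]]) auto
      show "fd (local_rep c a) x (\<xi> x) = local_rep c (\<lambda>q. X q a) x" if "x \<in> ?T" for x
      proof -
        obtain q where q: "q \<in> fst c" "q \<in> V" "q \<in> W'" "x = snd c q" using \<open>x \<in> ?T\<close> by auto
        then have "smooth_near A q a" using smooth_near_fun_on W' by blast
        then show ?thesis using q \<xi>(2)[OF q(2)] c by (simp add: coord_vec_smooth)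
      qed
    qed
    then show "smooth_near A p (\<lambda>q. X q a)"
      unfolding smooth_near_iff[OF c] using o c V p by (intro exI[of _ ?T]) auto
  qed (use W' in auto)
qed

lemma coord_field: "c \<in> A \<Longrightarrow> vector_field_on A (fst c) (\<lambda>q. coord_vec A c q w)"
  by (rule vector_field_onI[OF openin_chart])
    (auto intro!: bexI[of _ c] exI[of _ "fst c"] exI[of _ "\<lambda>_. w"] simp: openin_chart smooth_on_const)

text \<open>The second derivatives of the test function cancel by symmetry, and only derivatives of components are
  left.\<close>
lemma lie_bracket_coord:
  assumes W: "openin (mtop A) W" "p \<in> W" and X: "vector_field_on A W X" and Y: "vector_field_on A W Y"
    and c: "c \<in> A" "p \<in> fst c"
  shows "lie_bracket A X Y p = coord_vec A c p
    (fd (field_rep c Y) (snd c p) (field_rep c X (snd c p)) - fd (field_rep c X) (snd c p) (field_rep c Y (snd c p)))"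
    (is "_ = coord_vec A c p (?dY - ?dX)")
proof
  fix a
  let ?x = "snd c p"
  show "lie_bracket A X Y p a = coord_vec A c p (?dY - ?dX) a"
  proof (cases "smooth_near A p a")
    case True
    obtain V where V: "openin (mtop A) V" "p \<in> V" "smooth_fun_on A V a"
      using True unfolding smooth_near_def by auto
    let ?T = "snd c ` (fst c \<inter> (W \<inter> V))"
    let ?a = "local_rep c a"
    have o: "open ?T" by (rule open_chart_image) (use W V c in auto)
    have x: "?x \<in> ?T" using W V c by auto
    have a: "smooth_on ?a ?T"
      by (rule smooth_on_subset[OF smooth_fun_onD[OF V(3) c(1)]]) auto
    have *: "Z p (\<lambda>q. Z' q a) = fd (\<lambda>z. fd ?a z (field_rep c Z' ?x)) ?x (field_rep c Z ?x) +
          fd ?a ?x (fd (field_rep c Z') ?x (field_rep c Z ?x))"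
      if Z: "vector_field_on A W Z" "vector_field_on A W Z'" for Z Z'
    proof -
      have e: "local_rep c (\<lambda>q. Z' q a) z = fd ?a z (field_rep c Z' z)" if z: "z \<in> ?T" for z
      proof -
        obtain q where q: "q \<in> fst c" "q \<in> W" "q \<in> V" "z = snd c q" using z by auto
        then have "smooth_near A q a" using smooth_near_fun_on V by blast
        then show ?thesis using field_rep_coord[OF Z(2) q(2) c(1) q(1)] q c by (simp add: coord_vec_smooth)
      qed
      have "Z p (\<lambda>q. Z' q a) = fd (local_rep c (\<lambda>q. Z' q a)) ?x (field_rep c Z ?x)"
        using field_rep_coord[OF Z(1) W(2) c] smooth_near_field[OF W(1) Z(2) W(2) True]
        by (simp add: coord_vec_smooth)
      also have "\<dots> = fd (\<lambda>z. fd ?a z (field_rep c Z' z)) ?x (field_rep c Z ?x)"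
        by (simp only: fd_cong[OF o x e])
      also have "\<dots> = fd (\<lambda>z. fd ?a z (field_rep c Z' ?x)) ?x (field_rep c Z ?x) +
          fd ?a ?x (fd (field_rep c Z') ?x (field_rep c Z ?x))"
        by (rule fd_of_fd[OF o a smooth_on_subset[OF field_rep_smooth[OF W(1) Z(2) c(1)]] x]) auto
      finally show ?thesis .
    qed
    have "lie_bracket A X Y p a = fd ?a ?x ?dY - fd ?a ?x ?dX"
      unfolding lie_bracket_def using True *[OF X Y] *[OF Y X] fd_fd_commute[OF o a x] by simp
    also have "\<dots> = fd ?a ?x (?dY - ?dX)"
      by (simp add: linear_diff[OF linear_fd[OF a x]])
    finally show ?thesis using True by (simp add: coord_vec_smooth)
  qed (simp add: lie_bracket_def coord_vec_not_smooth)
qed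

lemma lie_bracket_tangent:
  assumes "openin (mtop A) W" "p \<in> W" "vector_field_on A W X" "vector_field_on A W Y"
  shows "lie_bracket A X Y p \<in> tangent_space A p"
  using lie_bracket_coord[OF assms] assms openin_sub points_chartE coord_vec_tangent by metis

lemma openin_nonzero:
  assumes "\<And>p. p \<in> points A \<Longrightarrow> smooth_near A p a"
  shows "openin (mtop A) {p \<in> points A. a p \<noteq> 0}"
  unfolding openin_mtop
proof (intro conjI ballI)
  fix c assume c: "c \<in> A"
  have "snd c ` (fst c \<inter> {p \<in> points A. a p \<noteq> 0}) = snd c ` (fst c \<inter> points A) \<inter> local_rep c a -` (- {0})"
    using c by (auto simp: points_def image_iff)
  moreover have "continuous_on (snd c ` (fst c \<inter> points A)) (local_rep c a)"
    by (rule smooth_on_continuous[OF smooth_fun_onD[OF smooth_fun_onI[OF openin_points assms] c]])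
  ultimately show "open (snd c ` (fst c \<inter> {p \<in> points A. a p \<noteq> 0}))"
    using continuous_open_preimage open_chart_image[OF openin_points c] by (metis open_delete open_UNIV Compl_eq_Diff_UNIV)
qed auto

text \<open>In a chart the differential of \<open>u\<close> vanishes, so \<open>u\<close> is locally constant and each of its level sets is
  both open and closed.\<close>
lemma constant_if_derivatives_vanish:
  assumes conn: "connected_space (mtop A)"
    and u: "\<And>p. p \<in> points A \<Longrightarrow> smooth_near A p u"
    and z: "\<And>p v. p \<in> points A \<Longrightarrow> v \<in> tangent_space A p \<Longrightarrow> v u = 0"
    and pq: "p \<in> points A" "q \<in> points A"
  shows "u p = u q"
proof -
  have loc: "\<exists>V. openin (mtop A) V \<and> p \<in> V \<and> (\<forall>q\<in>V. u q = u p)" if p: "p \<in> points A" for p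
  proof -
    obtain c where c: "c \<in> A" "p \<in> fst c" using p points_chartE by metis
    obtain r where r: "r > 0" "ball (snd c p) r \<subseteq> snd c ` fst c"
      using chart_open[OF c(1)] c openE by blast
    have d: "(local_rep c u has_derivative (\<lambda>h. 0)) (at x)" if x: "x \<in> snd c ` fst c" for x
    proof -
      obtain q where q: "q \<in> fst c" "x = snd c q" using x by auto
      have s: "smooth_near A q u" using u q c chart_points by blast
      obtain T where T: "open T" "x \<in> T" "smooth_on (local_rep c u) T"
        using smooth_near_rep[OF c(1) q(1) s] q(2) by metis
      have "coord_vec A c q w u = 0" for w
        using z[OF chart_points coord_vec_tangent] c(1) q by blast
      then have "fd (local_rep c u) x = (\<lambda>h. 0)" using s q(2) by (auto simp: coord_vec_smooth)
      then show ?thesis using smooth_on_has_fd[OF T(3,2)] by simp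
    qed
    let ?V = "{q \<in> fst c. snd c q \<in> ball (snd c p) r}"
    have "u q = u p" if "q \<in> ?V" for q
    proof -
      obtain k where k: "\<And>x. x \<in> ball (snd c p) r \<Longrightarrow> local_rep c u x = k"
        using has_derivative_zero_constant[of "ball (snd c p) r" "local_rep c u"] d r(2)
        by (meson convex_ball has_derivative_at_withinI subsetD)
      from k[of "snd c q"] k[of "snd c p"] show ?thesis using that c r by auto
    qed
    then have "\<forall>q\<in>?V. u q = u p" by blast
    moreover have "p \<in> ?V" using c r by simp
    ultimately show ?thesis using openin_chart_preimage[OF c(1) open_ball, of "snd c p" r] by blast
  qed
  let ?S = "{q \<in> points A. u q = u p}"
  have *: "openin (mtop A) {q \<in> points A. P (u q)}" for P
  proof (subst openin_subopen, intro ballI)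
    fix x assume x: "x \<in> {q \<in> points A. P (u q)}"
    obtain V where V: "openin (mtop A) V" "x \<in> V" "\<forall>q\<in>V. u q = u x" using loc[of x] x by blast
    have "V \<subseteq> {q \<in> points A. P (u q)}"
    proof
      fix q assume "q \<in> V"
      then have "u q = u x" "q \<in> points A" using V openin_sub by blast+
      then show "q \<in> {q \<in> points A. P (u q)}" using x by simp
    qed
    then show "\<exists>T. openin (mtop A) T \<and> x \<in> T \<and> T \<subseteq> {q \<in> points A. P (u q)}" using V by blast
  qed
  have "openin (mtop A) ?S" by (rule *)
  moreover have "points A - ?S = {q \<in> points A. u q \<noteq> u p}" by blast
  then have "closedin (mtop A) ?S"
    unfolding closedin_def topspace_mtop using *[of "\<lambda>x. x \<noteq> u p"] by auto
  ultimately have "?S = {} \<or> ?S = points A"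
    using conn unfolding connected_space_clopen_in topspace_mtop by blast
  moreover have "p \<in> ?S" using pq(1) by simp
  ultimately have "q \<in> ?S" using pq(2) by blast
  then show ?thesis by simp
qed

end

lemma (in smooth_atlas) smooth_map_chart:
  assumes "smooth_map A B F" "c \<in> A" "d \<in> B"
  shows "open (snd c ` (fst c \<inter> F -` fst d))"
    and "smooth_on (\<lambda>x. snd d (F (inv_into (fst c) (snd c) x))) (snd c ` (fst c \<inter> F -` fst d))"
  using assms unfolding smooth_map_def o_def case_prod_beta by blast+

context
  fixes A :: "('m, 'e::euclidean_space) chart set" and B :: "('n, 'f::euclidean_space) chart set" and F
  assumes A: "smooth_atlas A" and B: "smooth_atlas B" and F: "smooth_map A B F"
begin

interpretation A: smooth_atlas A by (rule A)
interpretation B: smooth_atlas B by (rule B)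

lemma smooth_map_openin: "openin (mtop B) W \<Longrightarrow> openin (mtop A) (points A \<inter> F -` W)"
  unfolding A.openin_mtop
proof (intro conjI ballI)
  fix c assume W: "openin (mtop B) W" and c: "c \<in> A"
  show "open (snd c ` (fst c \<inter> (points A \<inter> F -` W)))"
  proof (subst open_subopen, intro ballI)
    fix x assume "x \<in> snd c ` (fst c \<inter> (points A \<inter> F -` W))"
    then obtain p where p: "p \<in> fst c" "F p \<in> W" "x = snd c p" by auto
    obtain d where d: "d \<in> B" "F p \<in> fst d" using p(2) W B.openin_sub B.points_chartE by metis
    let ?T = "snd c ` (fst c \<inter> F -` fst d) \<inter> (\<lambda>x. snd d (F (inv_into (fst c) (snd c) x))) -` (snd d ` (fst d \<inter> W))"
    have "open ?T"
      by (rule continuous_open_preimage[OF smooth_on_continuous A.smooth_map_chart(1) B.open_chart_image])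
        (use F c d W A.smooth_map_chart[OF F c d(1)] in auto)
    moreover have "?T \<subseteq> snd c ` (fst c \<inter> (points A \<inter> F -` W))"
    proof
      fix x assume "x \<in> ?T"
      then obtain q q' where "q \<in> fst c" "F q \<in> fst d" "x = snd c q" "q' \<in> fst d" "q' \<in> W"
        "snd d (F q) = snd d q'" using c by auto
      moreover from this have "F q = q'" using B.chart_inj[OF d(1)] by (auto dest: inj_onD)
      ultimately show "x \<in> snd c ` (fst c \<inter> (points A \<inter> F -` W))"
        using A.chart_points[OF c, of q] by blast
    qed
    moreover have "x \<in> ?T" using p c d by auto
    ultimately show "\<exists>T. open T \<and> x \<in> T \<and> T \<subseteq> snd c ` (fst c \<inter> (points A \<inter> F -` W))" by blast
  qed
qed auto

lemma smooth_near_compose_map: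
  assumes p: "p \<in> points A" and a: "smooth_near B (F p) a"
  shows "smooth_near A p (a \<circ> F)"
proof -
  obtain c where c: "c \<in> A" "p \<in> fst c" using p A.points_chartE by metis
  obtain d where d: "d \<in> B" "F p \<in> fst d" using a B.smooth_near_points B.points_chartE by metis
  obtain T where T: "open T" "snd d (F p) \<in> T" "smooth_on (local_rep d a) T"
    using B.smooth_near_rep[OF d a] by metis
  let ?f = "\<lambda>x. snd d (F (inv_into (fst c) (snd c) x))"
  let ?S = "snd c ` (fst c \<inter> F -` fst d) \<inter> ?f -` T"
  note fs = A.smooth_map_chart[OF F c(1) d(1)]
  have o: "open ?S" by (rule continuous_open_preimage[OF smooth_on_continuous[OF fs(2)] fs(1) T(1)])
  have "smooth_on (local_rep c (a \<circ> F)) ?S"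
  proof (rule smooth_on_cong[OF o])
    show "smooth_on (\<lambda>x. local_rep d a (?f x)) ?S"
      by (rule smooth_on_compose[OF o T(1) smooth_on_subset[OF fs(2)] T(3)]) auto
  qed (use c d in auto)
  then show ?thesis unfolding A.smooth_near_iff[OF c]
    using o c d T by (intro exI[of _ ?S]) auto
qed

text \<open>The differential of a smooth map is the Jacobian of its local representative.\<close>
lemma push_coord_vec:
  assumes c: "c \<in> A" "p \<in> fst c" and d: "d \<in> B" "F p \<in> fst d"
  shows "push B F p (coord_vec A c p w)
    = coord_vec B d (F p) (fd (\<lambda>x. snd d (F (inv_into (fst c) (snd c) x))) (snd c p) w)"
proof
  fix a
  let ?f = "\<lambda>x. snd d (F (inv_into (fst c) (snd c) x))"
  show "push B F p (coord_vec A c p w) a = coord_vec B d (F p) (fd ?f (snd c p) w) a"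
  proof (cases "smooth_near B (F p) a")
    case True
    obtain T where T: "open T" "snd d (F p) \<in> T" "smooth_on (local_rep d a) T"
      using B.smooth_near_rep[OF d True] by metis
    note fs = A.smooth_map_chart[OF F c(1) d(1)]
    have "smooth_near A p (a \<circ> F)"
      using smooth_near_compose_map[OF _ True] c A.chart_points by blast
    then have "coord_vec A c p w (a \<circ> F) = fd (local_rep c (a \<circ> F)) (snd c p) w"
      by (rule A.coord_vec_smooth)
    also have "\<dots> = fd (\<lambda>x. local_rep d a (?f x)) (snd c p) w"
      by (rule fun_cong[OF fd_cong[OF fs(1)]]) (use c d in auto)
    also have "\<dots> = fd (local_rep d a) (?f (snd c p)) (fd ?f (snd c p) w)"
      by (rule fd_compose[OF fs(2) _ T(3)]) (use c d T in auto)
    finally show ?thesis using True c by (simp add: push_def B.coord_vec_smooth)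
  qed (simp add: push_def B.coord_vec_not_smooth)
qed

lemma push_tangent:
  assumes p: "p \<in> points A" and v: "v \<in> tangent_space A p"
  shows "push B F p v \<in> tangent_space B (F p)"
proof -
  obtain c w where c: "c \<in> A" "p \<in> fst c" "v = coord_vec A c p w" using A.tangent_chartE[OF v] .
  have "F p \<in> points B" using F p unfolding smooth_map_def by auto
  then obtain d where d: "d \<in> B" "F p \<in> fst d" using B.points_chartE by metis
  show ?thesis using push_coord_vec[OF c(1,2) d] B.coord_vec_tangent[OF d] c(3) by simp
qed

end

context smooth_atlas
begin

lemmas smooth_map_openin_self = smooth_map_openin[OF smooth_atlas_axioms smooth_atlas_axioms]
lemmas smooth_near_compose_self = smooth_near_compose_map[OF smooth_atlas_axioms smooth_atlas_axioms]
lemmas push_tangent_self = push_tangent[OF smooth_atlas_axioms smooth_atlas_axioms]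

end

section \<open>The cotangent bundle and its symplectic form\<close>

definition cot_chart ::
  "('m, 'e::euclidean_space) chart set \<Rightarrow> ('m, 'e) chart \<Rightarrow> ('m covec, 'e \<times> 'e) chart" where
  "cot_chart A c = ({l \<in> cotangent_bundle A. fst l \<in> fst c},
      \<lambda>l. (snd c (fst l), \<Sum>b\<in>Basis. snd l (coord_vec A c (fst l) b) *\<^sub>R b))"

text \<open>The inverse of the canonical chart: the covector at \<open>q\<close> with momentum components \<open>y\<close>.\<close>
definition coord_covec ::
  "('m, 'e::euclidean_space) chart set \<Rightarrow> ('m, 'e) chart \<Rightarrow> 'm \<Rightarrow> 'e \<Rightarrow> 'm covec" where
  "coord_covec A c q y = (q, restrict (\<lambda>v. y \<bullet> vec_comp c v) (tangent_space A q))"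

text \<open>Hamilton's equations: the components of the Hamiltonian field of \<open>a\<close> in canonical coordinates.\<close>
definition ham_comp ::
  "('m covec, 'e::euclidean_space \<times> 'e) chart \<Rightarrow> ('m covec \<Rightarrow> real) \<Rightarrow> 'm covec \<Rightarrow> 'e \<times> 'e" where
  "ham_comp C a l = (\<Sum>b\<in>Basis. fd (local_rep C a) (snd C l) (0, b) *\<^sub>R b,
     - (\<Sum>b\<in>Basis. fd (local_rep C a) (snd C l) (b, 0) *\<^sub>R b))"

lemma riesz_sum:
  fixes g :: "'e::euclidean_space \<Rightarrow> real"
  assumes "linear g"
  shows "(\<Sum>b\<in>Basis. g b *\<^sub>R b) \<bullet> w = g w"
proof -
  have "g w = g (\<Sum>b\<in>Basis. (w \<bullet> b) *\<^sub>R b)" by (simp add: euclidean_representation)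
  also have "\<dots> = (\<Sum>b\<in>Basis. (w \<bullet> b) * g b)" using assms by (simp add: linear_sum linear_cmul)
  finally show ?thesis by (simp only: inner_sum_left inner_scaleR_left inner_commute[of w] mult.commute)
qed

lemma vec_comp_linear:
  "vec_comp c (v + w) = vec_comp c v + vec_comp c w" "vec_comp c (r *\<^sub>R v) = r *\<^sub>R vec_comp c v"
  by (simp_all add: vec_comp_def scaleR_add_left sum.distrib scaleR_fun_def scaleR_sum_right)

context smooth_atlas
begin

abbreviation "TA \<equiv> cotangent_atlas A"
abbreviation "\<omega> \<equiv> symplectic_form A"

lemma cotangent_atlas_eq: "TA = cot_chart A ` A"
  by (simp add: cotangent_atlas_def cot_chart_def image_def)

lemma fst_cot_chart [simp]: "fst (cot_chart A c) = {l \<in> cotangent_bundle A. fst l \<in> fst c}"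
  by (simp add: cot_chart_def)

lemma points_cot: "points TA = cotangent_bundle A"
  unfolding points_def cotangent_atlas_eq by (auto simp: cotangent_bundle_def points_def)

lemma bundle_covector: "l \<in> cotangent_bundle A \<longleftrightarrow> fst l \<in> points A \<and> snd l \<in> cotangent_space A (fst l)"
  by (cases l) (auto simp: cotangent_bundle_def)

lemma covector_add: "\<mu> \<in> cotangent_space A q \<Longrightarrow> v \<in> tangent_space A q \<Longrightarrow> w \<in> tangent_space A q \<Longrightarrow> \<mu> (v + w) = \<mu> v + \<mu> w"
  and covector_scaleR: "\<mu> \<in> cotangent_space A q \<Longrightarrow> v \<in> tangent_space A q \<Longrightarrow> \<mu> (r *\<^sub>R v) = r * \<mu> v"
  by (auto simp: cotangent_space_def)

lemma covector_combination:
  assumes "q \<in> points A" "\<mu> \<in> cotangent_space A q" "x \<in> tangent_space A q" "y \<in> tangent_space A q" "z \<in> tangent_space A q"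
  shows "\<mu> (r *\<^sub>R x + s *\<^sub>R y + t *\<^sub>R z) = r * \<mu> x + s * \<mu> y + t * \<mu> z"
  using assms by (simp add: covector_add covector_scaleR tangent_closed)

lemma covector_coord:
  assumes "c \<in> A" "fst l \<in> fst c" "l \<in> cotangent_bundle A"
  shows "snd l (coord_vec A c (fst l) w) = snd (snd (cot_chart A c) l) \<bullet> w"
proof -
  have "linear (\<lambda>w. snd l (coord_vec A c (fst l) w))"
    using assms(3) unfolding bundle_covector
    by (intro linearI)
      (auto simp: coord_vec_linear[OF assms(1,2)] covector_add covector_scaleR coord_vec_tangent[OF assms(1,2)])
  from riesz_sum[OF this] show ?thesis by (simp add: cot_chart_def)
qed

lemma coord_covec_bundle: "c \<in> A \<Longrightarrow> q \<in> fst c \<Longrightarrow> coord_covec A c q y \<in> cotangent_bundle A"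
  using chart_points[of c q] tangent_closed[of q] unfolding bundle_covector
  by (auto simp: coord_covec_def cotangent_space_def vec_comp_linear inner_add_right)

lemma fst_coord_covec [simp]: "fst (coord_covec A c q y) = q"
  by (simp add: coord_covec_def)

lemma cot_chart_coord_covec:
  assumes "c \<in> A" "q \<in> fst c"
  shows "snd (cot_chart A c) (coord_covec A c q y) = (snd c q, y)"
  using coord_vec_tangent[OF assms]
  by (simp add: cot_chart_def coord_covec_def vec_comp_coord_vec[OF assms] euclidean_representation)

lemma coord_covec_cot_chart:
  assumes "c \<in> A" "l \<in> cotangent_bundle A" "fst l \<in> fst c"
  shows "coord_covec A c (fst l) (snd (snd (cot_chart A c) l)) = l"
proof -
  have "snd l = restrict (\<lambda>v. snd (snd (cot_chart A c) l) \<bullet> vec_comp c v) (tangent_space A (fst l))"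
  proof (rule extensionalityI[where A="tangent_space A (fst l)"])
    show "snd l \<in> extensional (tangent_space A (fst l))"
      using assms(2) unfolding bundle_covector cotangent_space_def by auto
    fix v assume "v \<in> tangent_space A (fst l)"
    then show "snd l v = restrict (\<lambda>v. snd (snd (cot_chart A c) l) \<bullet> vec_comp c v) (tangent_space A (fst l)) v"
      using covector_coord[OF assms(1,3,2), of "vec_comp c v"] coord_vec_vec_comp[OF assms(1,3)] by simp
  qed simp
  then show ?thesis by (simp add: coord_covec_def prod_eq_iff)
qed

lemma cot_chart_inj: "c \<in> A \<Longrightarrow> inj_on (snd (cot_chart A c)) (fst (cot_chart A c))"
proof (rule inj_onI)
  fix l l' assume c: "c \<in> A" and l: "l \<in> fst (cot_chart A c)" "l' \<in> fst (cot_chart A c)"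
    and e: "snd (cot_chart A c) l = snd (cot_chart A c) l'"
  have "snd c (fst l) = snd c (fst l')" using e by (simp add: cot_chart_def)
  then have "fst l = fst l'" using l chart_inj[OF c] by (auto dest: inj_onD)
  then show "l = l'" using coord_covec_cot_chart[OF c] l e by (metis (mono_tags, lifting) fst_cot_chart mem_Collect_eq)
qed

lemma cot_chart_image:
  assumes "c \<in> A"
  shows "snd (cot_chart A c) ` {l \<in> cotangent_bundle A. fst l \<in> fst c \<and> fst l \<in> V} = snd c ` (fst c \<inter> V) \<times> UNIV"
proof (intro Set.set_eqI iffI)
  fix z assume "z \<in> snd (cot_chart A c) ` {l \<in> cotangent_bundle A. fst l \<in> fst c \<and> fst l \<in> V}"
  then show "z \<in> snd c ` (fst c \<inter> V) \<times> UNIV" by (auto simp: cot_chart_def)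
next
  fix z assume "z \<in> snd c ` (fst c \<inter> V) \<times> (UNIV :: 'e set)"
  then obtain q y where q: "q \<in> fst c" "q \<in> V" "z = (snd c q, y)" by auto
  then have "z = snd (cot_chart A c) (coord_covec A c q y)" by (simp add: cot_chart_coord_covec assms)
  then show "z \<in> snd (cot_chart A c) ` {l \<in> cotangent_bundle A. fst l \<in> fst c \<and> fst l \<in> V}"
    using q coord_covec_bundle[OF assms] by auto
qed

lemma cot_chart_inv:
  assumes "c \<in> A" "x \<in> snd c ` fst c"
  shows "inv_into (fst (cot_chart A c)) (snd (cot_chart A c)) (x, y) = coord_covec A c (inv_into (fst c) (snd c) x) y"
proof -
  obtain q where q: "q \<in> fst c" "x = snd c q" using assms by auto
  have "coord_covec A c q y \<in> fst (cot_chart A c)" using q coord_covec_bundle[OF assms(1)] by simp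
  from inv_into_f_f[OF cot_chart_inj[OF assms(1)] this]
  show ?thesis using q assms by (simp add: cot_chart_coord_covec)
qed

text \<open>Under a change of charts the momenta transform by the transposed Jacobian of the inverse change.\<close>
lemma cot_transition:
  assumes c: "c \<in> A" and d: "d \<in> A" and x: "x \<in> snd c ` (fst c \<inter> fst d)"
  shows "local_rep (cot_chart A c) (snd (cot_chart A d)) (x, y) =
    (local_rep c (snd d) x, \<Sum>b\<in>Basis. (y \<bullet> fd (local_rep d (snd c)) (local_rep c (snd d) x) b) *\<^sub>R b)"
proof -
  obtain q where q: "q \<in> fst c" "q \<in> fst d" "x = snd c q" using x by auto
  let ?l = "coord_covec A c q y"
  have l: "?l \<in> cotangent_bundle A" by (rule coord_covec_bundle[OF c q(1)])
  have "snd ?l (coord_vec A d q b) = y \<bullet> fd (local_rep d (snd c)) (snd d q) b" for b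
    unfolding coord_vec_transition[OF d q(2) c q(1)]
    using covector_coord[OF c _ l] q c by (simp add: cot_chart_coord_covec)
  then show ?thesis
    using cot_chart_inv[OF c, of x y] q c d by (simp add: cot_chart_def[of A d])
qed

lemma cot_overlap:
  assumes "c \<in> A"
  shows "snd (cot_chart A c) ` (fst (cot_chart A c) \<inter> fst (cot_chart A d)) = snd c ` (fst c \<inter> fst d) \<times> UNIV"
proof -
  have "fst (cot_chart A c) \<inter> fst (cot_chart A d) = {l \<in> cotangent_bundle A. fst l \<in> fst c \<and> fst l \<in> fst d}" by auto
  then show ?thesis using cot_chart_image[OF assms] by simp
qed

lemma smooth_on_fst_compose:
  fixes g :: "'e \<Rightarrow> 'b::real_normed_vector"
  assumes "open S" "smooth_on g S"
  shows "smooth_on (\<lambda>z :: 'e \<times> 'e. g (fst z)) (S \<times> UNIV)"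
  by (rule smooth_on_compose[OF _ assms(1) smooth_on_linear[OF _ bounded_linear_fst smooth_on_id] assms(2)])
    (auto intro!: open_Times assms)

lemma cot_smooth_atlas: "smooth_atlas TA"
proof
  show "is_atlas TA"
    unfolding is_atlas_def
  proof (intro conjI ballI, goal_cases)
    case (1 C)
    then obtain c where c: "c \<in> A" "C = cot_chart A c" by (auto simp: cotangent_atlas_eq)
    have "snd C ` fst C = snd c ` fst c \<times> UNIV" using cot_overlap[OF c(1), of c] c by simp
    then show ?case using cot_chart_inj[OF c(1)] c chart_open[OF c(1)] by (auto simp: case_prod_beta open_Times)
  next
    case (2 C)
    then obtain c where c: "c \<in> A" "C = cot_chart A c" by (auto simp: cotangent_atlas_eq)
    have "open (snd C ` (fst C \<inter> fst D)) \<and> smooth_on (local_rep C (snd D)) (snd C ` (fst C \<inter> fst D))"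
      if D: "D \<in> TA" for D
    proof -
      obtain d where d: "d \<in> A" "D = cot_chart A d" using D by (auto simp: cotangent_atlas_eq)
      let ?S = "snd c ` (fst c \<inter> fst d)"
      have oS: "open ?S" by (rule overlap_open[OF c(1) d(1)])
      have o: "open (?S \<times> (UNIV :: 'e set))" by (auto intro!: open_Times oS)
      have dS: "smooth_on (\<lambda>x. fd (local_rep d (snd c)) (local_rep c (snd d) x) b) ?S" for b
        by (rule smooth_on_compose[OF oS overlap_open[OF d(1) c(1)] transition_smooth[OF c(1) d(1)]
              smooth_on_fd_const[OF transition_smooth[OF d(1) c(1)]]]) (use c d in auto)
      have "smooth_on (\<lambda>z. (local_rep c (snd d) (fst z),
          \<Sum>b\<in>Basis. (snd z \<bullet> fd (local_rep d (snd c)) (local_rep c (snd d) (fst z)) b) *\<^sub>R b)) (?S \<times> (UNIV :: 'e set))"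
        by (intro smooth_on_Pair o smooth_on_fst_compose[OF oS transition_smooth[OF c(1) d(1)]]
            smooth_on_sum smooth_on_scaleR smooth_on_inner smooth_on_const
            smooth_on_fst_compose[OF oS dS] smooth_on_linear[OF _ bounded_linear_snd smooth_on_id])
      then have "smooth_on (local_rep C (snd D)) (?S \<times> UNIV)"
        by (rule smooth_on_cong[OF o, rotated]) (use cot_transition[OF c(1) d(1)] c(2) d(2) in \<open>auto simp del: o_apply\<close>)
      then show ?thesis using o cot_overlap[OF c(1), of d] c(2) d(2) by simp
    qed
    then show ?case by (auto simp: case_prod_beta)
  qed
qed

interpretation T: smooth_atlas TA
  by (rule cot_smooth_atlas)

lemma cot_chart_TA: "c \<in> A \<Longrightarrow> cot_chart A c \<in> TA"
  by (simp add: cotangent_atlas_eq)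

lemma bundle_chartE:
  assumes "l \<in> cotangent_bundle A"
  obtains c where "c \<in> A" "fst l \<in> fst c" "cot_chart A c \<in> TA" "l \<in> fst (cot_chart A c)"
  using assms cot_chart_TA points_chartE unfolding bundle_covector fst_cot_chart mem_Collect_eq by metis

lemma cot_image_open: "c \<in> A \<Longrightarrow> open (snd (cot_chart A c) ` fst (cot_chart A c))"
  by (rule T.chart_open[OF cot_chart_TA])

lemma projection_smooth: "smooth_map TA A fst"
  unfolding smooth_map_def
proof (intro conjI ballI)
  show "fst ` points TA \<subseteq> points A" by (auto simp: points_cot bundle_covector)
  fix C assume "C \<in> TA"
  then obtain c where c: "c \<in> A" "C = cot_chart A c" by (auto simp: cotangent_atlas_eq)
  have "open (snd C ` (fst C \<inter> fst -` fst d)) \<and> smooth_on (snd d \<circ> fst \<circ> inv_into (fst C) (snd C)) (snd C ` (fst C \<inter> fst -` fst d))"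
    if d: "d \<in> A" for d
  proof -
    let ?S = "snd c ` (fst c \<inter> fst d)"
    have oS: "open ?S" by (rule overlap_open[OF c(1) d])
    have o: "open (?S \<times> (UNIV :: 'e set))" by (auto intro!: open_Times oS)
    have "fst C \<inter> fst -` fst d = {l \<in> cotangent_bundle A. fst l \<in> fst c \<and> fst l \<in> fst d}" using c by auto
    then have im: "snd C ` (fst C \<inter> fst -` fst d) = ?S \<times> UNIV" using cot_chart_image[OF c(1), of "fst d"] c(2) by simp
    have "smooth_on (snd d \<circ> fst \<circ> inv_into (fst C) (snd C)) (?S \<times> UNIV)"
      by (rule smooth_on_cong[OF o _ smooth_on_fst_compose[OF oS transition_smooth[OF c(1) d]]])
        (use c cot_chart_inv[OF c(1)] in \<open>auto simp del: fst_cot_chart\<close>)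
    then show ?thesis using im o by simp
  qed
  then show "case C of (U, \<phi>) \<Rightarrow> \<forall>(V, \<psi>)\<in>A. open (\<phi> ` (U \<inter> fst -` V)) \<and> smooth_on (\<psi> \<circ> fst \<circ> inv_into U \<phi>) (\<phi> ` (U \<inter> fst -` V))"
    by (auto simp: case_prod_beta)
qed

lemma push_projection:
  assumes c: "c \<in> A" "l \<in> fst (cot_chart A c)"
  shows "push A fst l (coord_vec TA (cot_chart A c) l w) = coord_vec A c (fst l) (fst w)"
proof -
  let ?C = "cot_chart A c"
  have l: "fst l \<in> fst c" using c by simp
  have "fd (\<lambda>x. snd c (fst (inv_into (fst ?C) (snd ?C) x))) (snd ?C l) = fd fst (snd ?C l)"
  proof (rule fd_cong[OF cot_image_open[OF c(1)]])
    show "snd c (fst (inv_into (fst ?C) (snd ?C) y)) = fst y" if y: "y \<in> snd ?C ` fst ?C" for y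
    proof -
      obtain l' where l': "l' \<in> fst ?C" "y = snd ?C l'" using y by blast
      have "inv_into (fst ?C) (snd ?C) y = l'" using T.inv_chart[OF cot_chart_TA[OF c(1)] l'(1)] l'(2) by simp
      then show ?thesis using l' by (simp add: cot_chart_def)
    qed
  qed (use c in auto)
  also have "\<dots> = fst" by (rule fd_eqI[OF bounded_linear.has_derivative[OF bounded_linear_fst has_derivative_ident]])
  finally show ?thesis
    using push_coord_vec[OF T.smooth_atlas_axioms smooth_atlas_axioms projection_smooth cot_chart_TA[OF c(1)] c(2) c(1) l] by simp
qed

lemma liouville_coord:
  assumes c: "c \<in> A" "l \<in> fst (cot_chart A c)"
  shows "liouville_form A l (coord_vec TA (cot_chart A c) l w) = snd (snd (cot_chart A c) l) \<bullet> fst w"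
  unfolding liouville_form_def push_projection[OF c] by (rule covector_coord) (use c in auto)

text \<open>In canonical coordinates the invariant formula for the exterior derivative reduces to the standard
  form: all derivatives of the extending fields cancel.\<close>
lemma ext_deriv_liouville:
  assumes W: "openin (mtop TA) W" "l \<in> W" and X: "vector_field_on TA W X" and Y: "vector_field_on TA W Y"
    and c: "c \<in> A" "l \<in> fst (cot_chart A c)"
  shows "X l (\<lambda>k. liouville_form A k (Y k)) - Y l (\<lambda>k. liouville_form A k (X k)) - liouville_form A l (lie_bracket TA X Y l)
    = snd (field_rep (cot_chart A c) X (snd (cot_chart A c) l)) \<bullet> fst (field_rep (cot_chart A c) Y (snd (cot_chart A c) l))
    - snd (field_rep (cot_chart A c) Y (snd (cot_chart A c) l)) \<bullet> fst (field_rep (cot_chart A c) X (snd (cot_chart A c) l))"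
proof -
  let ?C = "cot_chart A c"
  let ?x = "snd ?C l"
  let ?S = "snd ?C ` (fst ?C \<inter> W)"
  note C = cot_chart_TA[OF c(1)]
  have o: "open ?S" by (rule T.open_chart_image[OF W(1) C])
  have x: "?x \<in> ?S" using c W by auto
  have *: "Z l (\<lambda>k. liouville_form A k (Z' k)) =
      snd (field_rep ?C Z ?x) \<bullet> fst (field_rep ?C Z' ?x) + snd ?x \<bullet> fst (fd (field_rep ?C Z') ?x (field_rep ?C Z ?x))"
    if Z: "vector_field_on TA W Z" "vector_field_on TA W Z'" for Z Z'
  proof -
    let ?u = "\<lambda>k. liouville_form A k (Z' k)"
    have e: "snd z \<bullet> fst (field_rep ?C Z' z) = local_rep ?C ?u z" if "z \<in> ?S" for z
    proof -
      obtain k where k: "k \<in> fst ?C" "k \<in> W" "z = snd ?C k" using \<open>z \<in> ?S\<close> by blast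
      have "?u k = snd z \<bullet> fst (field_rep ?C Z' z)"
        using T.field_rep_coord[OF Z(2) k(2) C k(1)] liouville_coord[OF c(1) k(1)] k(3) by simp
      then show ?thesis using T.inv_chart[OF C k(1)] k(3) by simp
    qed
    have sZ: "smooth_on (field_rep ?C Z') ?S" by (rule T.field_rep_smooth[OF W(1) Z(2) C])
    have s: "smooth_on (\<lambda>z. snd z \<bullet> fst (field_rep ?C Z' z)) ?S"
      by (intro smooth_on_inner o smooth_on_linear[OF o bounded_linear_snd smooth_on_id]
          smooth_on_linear[OF o bounded_linear_fst] sZ)
    have "smooth_on (local_rep ?C ?u) ?S" by (rule smooth_on_cong[OF o e s])
    then have n: "smooth_near TA l ?u"
      unfolding T.smooth_near_iff[OF C c(2)] using o x by (intro exI[of _ ?S]) auto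
    have d: "((\<lambda>z. snd z \<bullet> fst (field_rep ?C Z' z)) has_derivative
        (\<lambda>w. snd ?x \<bullet> fst (fd (field_rep ?C Z') ?x w) + snd w \<bullet> fst (field_rep ?C Z' ?x))) (at ?x)"
      by (rule bounded_bilinear.FDERIV[OF bounded_bilinear_inner
            bounded_linear.has_derivative[OF bounded_linear_snd has_derivative_ident]
            bounded_linear.has_derivative[OF bounded_linear_fst smooth_on_has_fd[OF sZ x]]])
    have "Z l ?u = fd (local_rep ?C ?u) ?x (field_rep ?C Z ?x)"
      using T.field_rep_coord[OF Z(1) W(2) C c(2)] n by (simp add: T.coord_vec_smooth)
    also have "fd (local_rep ?C ?u) ?x = fd (\<lambda>z. snd z \<bullet> fst (field_rep ?C Z' z)) ?x"
      by (rule fd_cong[OF o x]) (rule e[symmetric])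
    finally show ?thesis unfolding fd_eqI[OF d] by simp
  qed
  show ?thesis
    unfolding T.lie_bracket_coord[OF W X Y C c(2)] liouville_coord[OF c] *[OF X Y] *[OF Y X]
    by (simp add: inner_diff_right)
qed

text \<open>The definite description in the exterior derivative denotes this value: all extensions of the two
  vectors give it, and the fields with constant components are extensions.\<close>
lemma symplectic_coord:
  assumes c: "c \<in> A" "l \<in> fst (cot_chart A c)"
  shows "\<omega> l (coord_vec TA (cot_chart A c) l v) (coord_vec TA (cot_chart A c) l w) = snd v \<bullet> fst w - snd w \<bullet> fst v"
proof -
  let ?C = "cot_chart A c"
  note C = cot_chart_TA[OF c(1)]
  let ?P = "\<lambda>W X Y. openin (mtop TA) W \<and> l \<in> W \<and> vector_field_on TA W X \<and> vector_field_on TA W Y \<and>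
     X l = coord_vec TA ?C l v \<and> Y l = coord_vec TA ?C l w"
  let ?r = "\<lambda>X Y. X l (\<lambda>q. liouville_form A q (Y q)) - Y l (\<lambda>q. liouville_form A q (X q)) -
     liouville_form A l (lie_bracket TA X Y l)"
  have rep: "field_rep ?C X (snd ?C l) = u" if "X l = coord_vec TA ?C l u" for X u
    using that T.inv_chart[OF C c(2)] T.vec_comp_coord_vec[OF C c(2)] by (simp add: field_rep_def)
  have val: "?r X Y = snd v \<bullet> fst w - snd w \<bullet> fst v" if "?P W X Y" for W X Y
    using ext_deriv_liouville[of W l X Y c] that c rep[of X v] rep[of Y w] by simp
  have ex: "?P (fst ?C) (\<lambda>k. coord_vec TA ?C k v) (\<lambda>k. coord_vec TA ?C k w)"
    using T.openin_chart[OF C] T.coord_field[OF C] c by simp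
  show ?thesis
    unfolding symplectic_form_def ext_deriv_def
  proof (rule the_equality)
    show "\<forall>W X Y. ?P W X Y \<longrightarrow> snd v \<bullet> fst w - snd w \<bullet> fst v = ?r X Y"
    proof (intro allI impI)
      fix W X Y assume "?P W X Y"
      then show "snd v \<bullet> fst w - snd w \<bullet> fst v = ?r X Y" by (rule val[symmetric])
    qed
    fix r assume "\<forall>W X Y. ?P W X Y \<longrightarrow> r = ?r X Y"
    then have "?P (fst ?C) (\<lambda>k. coord_vec TA ?C k v) (\<lambda>k. coord_vec TA ?C k w) \<longrightarrow>
        r = ?r (\<lambda>k. coord_vec TA ?C k v) (\<lambda>k. coord_vec TA ?C k w)" by (elim allE)
    from this[rule_format, OF ex] val[OF ex] show "r = snd v \<bullet> fst w - snd w \<bullet> fst v" by (rule trans)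
  qed
qed

text \<open>The form is nondegenerate, so the Hamiltonian field is determined by the values of the form on all
  tangent vectors.\<close>
lemma ham_field_coord:
  assumes c: "c \<in> A" "l \<in> fst (cot_chart A c)" and a: "smooth_near TA l a"
  shows "ham_field TA \<omega> a l = coord_vec TA (cot_chart A c) l (ham_comp (cot_chart A c) a l)"
    and "\<eta> \<in> tangent_space TA l \<Longrightarrow>
      \<omega> l \<eta> (coord_vec TA (cot_chart A c) l (ham_comp (cot_chart A c) a l)) = \<eta> a"
proof -
  note C = cot_chart_TA[OF c(1)]
  let ?C = "cot_chart A c"
  let ?\<xi> = "ham_comp ?C a l"
  let ?da = "fd (local_rep ?C a) (snd ?C l)"
  have lin: "linear ?da" using T.smooth_near_rep[OF C c(2) a] linear_fd by metis
  have lin2: "linear (\<lambda>b. ?da (0, b))" "linear (\<lambda>b. ?da (b, 0))"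
    using linear_compose[OF _ lin, of "\<lambda>b. (0, b)"] linear_compose[OF _ lin, of "\<lambda>b. (b, 0)"]
    by (auto simp: o_def linear_iff)
  have split: "?da w = ?da (0, snd w) + ?da (fst w, 0)" for w
    using linear_add[OF lin, of "(0, snd w)" "(fst w, 0)"] by simp
  have sol: "\<omega> l \<eta> (coord_vec TA ?C l ?\<xi>) = \<eta> a" if \<eta>: "\<eta> \<in> tangent_space TA l" for \<eta>
  proof -
    obtain w where w: "\<eta> = coord_vec TA ?C l w" using \<eta> T.tangent_space_chart[OF C c(2)] by auto
    have "\<eta> a = ?da w" using w a by (simp add: T.coord_vec_smooth)
    also have "\<dots> = snd w \<bullet> fst ?\<xi> - snd ?\<xi> \<bullet> fst w"
      unfolding split[of w] by (simp del: fst_cot_chart add: ham_comp_def riesz_sum[OF lin2(1)] riesz_sum[OF lin2(2)] inner_commute[of "snd w"])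
    finally show ?thesis unfolding w symplectic_coord[OF c] by simp
  qed
  show "\<eta> \<in> tangent_space TA l \<Longrightarrow> \<omega> l \<eta> (coord_vec TA ?C l ?\<xi>) = \<eta> a" by (rule sol)
  show "ham_field TA \<omega> a l = coord_vec TA ?C l ?\<xi>"
    unfolding ham_field_def
  proof (rule the_equality)
    show "coord_vec TA ?C l ?\<xi> \<in> tangent_space TA l \<and> (\<forall>\<eta>\<in>tangent_space TA l. \<omega> l \<eta> (coord_vec TA ?C l ?\<xi>) = \<eta> a)"
      using sol T.coord_vec_tangent[OF C c(2)] by blast
    fix \<zeta> assume z: "\<zeta> \<in> tangent_space TA l \<and> (\<forall>\<eta>\<in>tangent_space TA l. \<omega> l \<eta> \<zeta> = \<eta> a)"
    then obtain u where u: "\<zeta> = coord_vec TA ?C l u" using T.tangent_space_chart[OF C c(2)] by auto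
    have eq: "snd w \<bullet> fst u - snd u \<bullet> fst w = snd w \<bullet> fst ?\<xi> - snd ?\<xi> \<bullet> fst w" for w
      using z sol[of "coord_vec TA ?C l w"] T.coord_vec_tangent[OF C c(2), of w]
      unfolding u symplectic_coord[OF c, symmetric] by metis
    have "\<forall>y. y \<bullet> fst u = y \<bullet> fst ?\<xi>" using eq[of "(0, _)"] by simp
    from iffD1[OF vector_eq_ldot this] have 1: "fst u = fst ?\<xi>" .
    have "\<forall>y. snd u \<bullet> y = snd ?\<xi> \<bullet> y" using eq[of "(_, 0)"] by simp
    from iffD1[OF vector_eq_rdot this] have "snd u = snd ?\<xi>" .
    with 1 have "u = ?\<xi>" by (simp add: prod_eq_iff)
    then show "\<zeta> = coord_vec TA ?C l ?\<xi>" using u by simp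
  qed
qed

lemma ham_field_tangent:
  assumes "l \<in> cotangent_bundle A" "smooth_near TA l a"
  shows "ham_field TA \<omega> a l \<in> tangent_space TA l"
  using assms ham_field_coord(1) T.coord_vec_tangent bundle_chartE by metis

lemma ham_field_symplectic:
  assumes l: "l \<in> cotangent_bundle A" and a: "smooth_near TA l a" and \<eta>: "\<eta> \<in> tangent_space TA l"
  shows "\<omega> l \<eta> (ham_field TA \<omega> a l) = \<eta> a"
proof -
  obtain c where c: "c \<in> A" "l \<in> fst (cot_chart A c)" using bundle_chartE[OF l] by metis
  show ?thesis unfolding ham_field_coord(1)[OF c a] by (rule ham_field_coord(2)[OF c a \<eta>])
qed

lemma symplectic_antisym:
  assumes l: "l \<in> cotangent_bundle A" and v: "v \<in> tangent_space TA l" "w \<in> tangent_space TA l"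
  shows "\<omega> l v w = - \<omega> l w v"
proof -
  obtain c where c: "c \<in> A" "cot_chart A c \<in> TA" "l \<in> fst (cot_chart A c)" using bundle_chartE[OF l] by metis
  obtain x y where "v = coord_vec TA (cot_chart A c) l x" "w = coord_vec TA (cot_chart A c) l y"
    using v T.tangent_space_chart[OF c(2,3)] by auto
  then show ?thesis by (simp add: symplectic_coord[OF c(1,3)])
qed

lemma poisson_antisym:
  assumes l: "l \<in> cotangent_bundle A" and ab: "smooth_near TA l a" "smooth_near TA l b"
  shows "poisson TA \<omega> a b l = - poisson TA \<omega> b a l"
  unfolding poisson_def
  using ham_field_symplectic[OF l ab(1) ham_field_tangent[OF l ab(2)]]
    ham_field_symplectic[OF l ab(2) ham_field_tangent[OF l ab(1)]]
    symplectic_antisym[OF l ham_field_tangent[OF l ab(1)] ham_field_tangent[OF l ab(2)]] by simp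

lemma pairing_rep:
  assumes X: "vector_field A X" and c: "c \<in> A"
  shows "smooth_on (local_rep (cot_chart A c) (pairing X)) (snd (cot_chart A c) ` fst (cot_chart A c))"
    and "z \<in> snd (cot_chart A c) ` fst (cot_chart A c) \<Longrightarrow> fd (local_rep (cot_chart A c) (pairing X)) z w =
      snd w \<bullet> field_rep c X (fst z) + snd z \<bullet> fd (field_rep c X) (fst z) (fst w)"
proof -
  let ?C = "cot_chart A c"
  let ?S = "snd ?C ` fst ?C"
  have im: "?S = snd c ` fst c \<times> UNIV" using cot_overlap[OF c, of c] by simp
  have o: "open ?S" by (rule cot_image_open[OF c])
  have e: "snd z \<bullet> field_rep c X (fst z) = local_rep ?C (pairing X) z" if z: "z \<in> ?S" for z
  proof -
    obtain l where l: "l \<in> fst ?C" "z = snd ?C l" using z by blast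
    then have l': "fst l \<in> fst c" "l \<in> cotangent_bundle A" "fst l \<in> points A" by (auto simp: bundle_covector)
    have "pairing X l = snd z \<bullet> field_rep c X (snd c (fst l))"
      unfolding pairing_def using field_rep_coord[OF X l'(3) c l'(1)] covector_coord[OF c l'(1,2)] l(2) by simp
    moreover have "fst z = snd c (fst l)" using l by (simp add: cot_chart_def)
    ultimately show ?thesis using T.inv_chart[OF cot_chart_TA[OF c] l(1)] l(2) by simp
  qed
  have sX: "smooth_on (field_rep c X) (snd c ` fst c)" by (rule field_rep_smooth_chart[OF X c])
  show "smooth_on (local_rep ?C (pairing X)) ?S"
  proof (rule smooth_on_cong[OF o e])
    show "smooth_on (\<lambda>z. snd z \<bullet> field_rep c X (fst z)) ?S"
      unfolding im
      by (intro smooth_on_inner smooth_on_linear[OF _ bounded_linear_snd smooth_on_id]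
          smooth_on_fst_compose[OF chart_open[OF c] sX] open_Times chart_open c open_UNIV)
  qed
  assume z: "z \<in> ?S"
  have fz: "fst z \<in> snd c ` fst c" using z unfolding im by auto
  have "((\<lambda>z. snd z \<bullet> field_rep c X (fst z)) has_derivative
      (\<lambda>w. snd z \<bullet> fd (field_rep c X) (fst z) (fst w) + snd w \<bullet> field_rep c X (fst z))) (at z)"
    using bounded_bilinear.FDERIV[OF bounded_bilinear_inner
        bounded_linear.has_derivative[OF bounded_linear_snd has_derivative_ident]
        diff_chain_at[OF bounded_linear.has_derivative[OF bounded_linear_fst has_derivative_ident] smooth_on_has_fd[OF sX fz]]]
    by (simp add: o_def)
  moreover have "fd (local_rep ?C (pairing X)) z = fd (\<lambda>z. snd z \<bullet> field_rep c X (fst z)) z"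
    by (rule fd_cong[OF o z]) (rule e[symmetric])
  ultimately show "fd (local_rep ?C (pairing X)) z w =
      snd w \<bullet> field_rep c X (fst z) + snd z \<bullet> fd (field_rep c X) (fst z) (fst w)" by (simp add: fd_eqI)
qed

lemma pairing_smooth:
  assumes "vector_field A X" "l \<in> cotangent_bundle A"
  shows "smooth_near TA l (pairing X)"
proof -
  obtain c where c: "c \<in> A" "l \<in> fst (cot_chart A c)" using bundle_chartE[OF assms(2)] by metis
  show ?thesis
    unfolding T.smooth_near_iff[OF cot_chart_TA[OF c(1)] c(2)]
    using pairing_rep(1)[OF assms(1) c(1)] cot_image_open[OF c(1)] c by blast
qed

text \<open>In canonical coordinates \<open>pairing X\<close> is \<open>y \<bullet> X(x)\<close>, and Hamilton's equations give
  \<open>y \<bullet> (DY(X) - DX(Y))\<close>.\<close>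
lemma poisson_pairing:
  assumes X: "vector_field A X" and Y: "vector_field A Y" and l: "l \<in> cotangent_bundle A"
  shows "poisson TA \<omega> (pairing X) (pairing Y) l = snd l (lie_bracket A X Y (fst l))"
proof -
  obtain c where c: "c \<in> A" "fst l \<in> fst c" "l \<in> fst (cot_chart A c)" using bundle_chartE[OF l] by metis
  let ?C = "cot_chart A c"
  let ?z = "snd ?C l"
  have z: "?z \<in> snd ?C ` fst ?C" using c by blast
  have fz: "fst ?z = snd c (fst l)" by (simp add: cot_chart_def)
  have q: "fst l \<in> points A" using l by (simp add: bundle_covector)
  have sX: "smooth_on (field_rep c X) (snd c ` fst c)" by (rule field_rep_smooth_chart[OF X c(1)])
  have lin: "linear (\<lambda>b. snd ?z \<bullet> fd (field_rep c X) (fst ?z) b)"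
    using linear_fd[OF sX, of "fst ?z"] c fz by (auto simp: linear_iff inner_add_right)
  have hc: "ham_comp ?C (pairing X) l = (field_rep c X (fst ?z), - (\<Sum>b\<in>Basis. (snd ?z \<bullet> fd (field_rep c X) (fst ?z) b) *\<^sub>R b))"
    unfolding ham_comp_def pairing_rep(2)[OF X c(1) z]
    using linear_0[OF linear_fd[OF sX, of "fst ?z"]] c(2) fz
    by (simp add: inner_commute[of _ "field_rep c X _"] euclidean_representation)
  have "poisson TA \<omega> (pairing X) (pairing Y) l = snd ?z \<bullet>
    (fd (field_rep c Y) (fst ?z) (field_rep c X (fst ?z)) - fd (field_rep c X) (fst ?z) (field_rep c Y (fst ?z)))"
    unfolding poisson_def ham_field_coord(1)[OF c(1,3) pairing_smooth[OF X l]]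
      T.coord_vec_smooth[OF pairing_smooth[OF Y l]] pairing_rep(2)[OF Y c(1) z] hc
    by (simp add: riesz_sum[OF lin] inner_diff_right)
  also have "\<dots> = snd l (lie_bracket A X Y (fst l))"
    unfolding lie_bracket_coord[OF openin_points q X Y c(1,2)] covector_coord[OF c(1,2) l] fz ..
  finally show ?thesis .
qed

text \<open>The vector differentiates along the fibre in the direction of \<open>\<mu>\<close>, where momenta are linear.\<close>
lemma vertical_vector:
  assumes l: "l \<in> cotangent_bundle A" and \<mu>: "\<mu> \<in> cotangent_space A (fst l)"
  obtains \<eta> where "\<eta> \<in> tangent_space TA l" "\<And>X. vector_field A X \<Longrightarrow> \<eta> (pairing X) = \<mu> (X (fst l))"
proof -
  obtain c where c: "c \<in> A" "fst l \<in> fst c" "l \<in> fst (cot_chart A c)" using bundle_chartE[OF l] by metis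
  let ?C = "cot_chart A c"
  let ?m = "(fst l, \<mu>)"
  let ?y = "snd (snd ?C ?m)"
  have m: "?m \<in> cotangent_bundle A" using l \<mu> by (simp add: bundle_covector)
  have z: "snd ?C l \<in> snd ?C ` fst ?C" using c by blast
  have fz: "fst (snd ?C l) = snd c (fst l)" by (simp add: cot_chart_def)
  have "coord_vec TA ?C l (0, ?y) (pairing X) = \<mu> (X (fst l))" if X: "vector_field A X" for X
  proof -
    have sX: "smooth_on (field_rep c X) (snd c ` fst c)" by (rule field_rep_smooth_chart[OF X c(1)])
    have "\<mu> (X (fst l)) = ?y \<bullet> field_rep c X (snd c (fst l))"
      using field_rep_coord[OF X _ c(1,2)] l covector_coord[OF c(1) _ m] c(2) by (simp add: bundle_covector)
    then show ?thesis
      using linear_0[OF linear_fd[OF sX, of "snd c (fst l)"]] c(2)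
      unfolding T.coord_vec_smooth[OF pairing_smooth[OF X l]] pairing_rep(2)[OF X c(1) z] fz by simp
  qed
  then show ?thesis using that[of "coord_vec TA ?C l (0, ?y)"] T.coord_vec_tangent[OF cot_chart_TA[OF c(1)] c(3)] by blast
qed

text \<open>On a fibre the momentum of \<open>X\<close> is a nonzero linear form. A zero of it is left by an arbitrarily short
  step whose momentum components are those of \<open>X\<close> itself.\<close>
lemma dense_pairing_nonzero:
  assumes X: "vector_field A X" and nz: "\<And>q. q \<in> points A \<Longrightarrow> X q \<noteq> 0"
  shows "openin (mtop TA) {l \<in> cotangent_bundle A. pairing X l \<noteq> 0}"
    and "mtop TA closure_of {l \<in> cotangent_bundle A. pairing X l \<noteq> 0} = cotangent_bundle A"
proof -
  let ?S = "{l \<in> cotangent_bundle A. pairing X l \<noteq> 0}"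
  show "openin (mtop TA) ?S"
    using T.openin_nonzero[of "pairing X"] pairing_smooth[OF X] by (simp add: points_cot)
  have "l \<in> mtop TA closure_of ?S" if l: "l \<in> cotangent_bundle A" for l
    unfolding in_closure_of T.topspace_mtop points_cot
  proof (intro conjI l allI impI)
    fix V assume V: "l \<in> V \<and> openin (mtop TA) V"
    obtain c where c: "c \<in> A" "fst l \<in> fst c" "l \<in> fst (cot_chart A c)" using bundle_chartE[OF l] by metis
    let ?C = "cot_chart A c"
    let ?q = "fst l"
    define x y where "x = snd c ?q" and "y = snd (snd ?C l)"
    define u where "u = field_rep c X x"
    have q: "?q \<in> points A" using l by (simp add: bundle_covector)
    have Xq: "X ?q = coord_vec A c ?q u" unfolding u_def x_def by (rule field_rep_coord[OF X q c(1,2)])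
    have "coord_vec A c ?q 0 = 0" using coord_vec_linear(2)[OF c(1,2), of 0 0] by simp
    then have u: "u \<noteq> 0" using Xq nz[OF q] by auto
    have val: "pairing X (coord_covec A c ?q y') = y' \<bullet> u" for y'
      unfolding pairing_def using covector_coord[OF c(1) _ coord_covec_bundle[OF c(1,2)], of y' u] c(2) Xq
      by (simp add: cot_chart_coord_covec[OF c(1,2)])
    have o: "open (snd ?C ` (fst ?C \<inter> V))" using V T.open_chart_image[OF _ cot_chart_TA[OF c(1)]] by blast
    have xy: "snd ?C l = (x, y)" by (simp add: x_def y_def cot_chart_def)
    then have "(x, y) \<in> snd ?C ` (fst ?C \<inter> V)" using c V by (metis IntI imageI)
    then obtain r where r: "r > 0" "ball (x, y) r \<subseteq> snd ?C ` (fst ?C \<inter> V)" using o openE by blast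
    \<comment> \<open>half the radius; no step is taken if the momentum is already nonzero\<close>
    define t where "t = (if y \<bullet> u = 0 then r / (2 * norm u) else 0)"
    have "(x, y + t *\<^sub>R u) \<in> ball (x, y) r"
      using r u by (auto simp: t_def dist_Pair_Pair dist_norm)
    then have "(x, y + t *\<^sub>R u) \<in> snd ?C ` (fst ?C \<inter> V)" using r by blast
    then obtain k where k: "k \<in> fst ?C" "k \<in> V" "snd ?C k = (x, y + t *\<^sub>R u)" by auto
    have "snd ?C k = snd ?C (coord_covec A c ?q (y + t *\<^sub>R u))"
      using k(3) cot_chart_coord_covec[OF c(1,2)] x_def by simp
    then have kk: "k = coord_covec A c ?q (y + t *\<^sub>R u)"
      using cot_chart_inj[OF c(1)] k(1) coord_covec_bundle[OF c(1,2)] c(2) by (auto dest: inj_onD)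
    have "pairing X k = y \<bullet> u + t * (u \<bullet> u)" unfolding kk val by (simp add: inner_add_left)
    moreover have "\<dots> \<noteq> 0" using u r by (auto simp: t_def)
    ultimately have "k \<in> ?S" using k(1) by simp
    then show "\<exists>k. k \<in> ?S \<and> k \<in> V" using k(2) by blast
  qed
  then show "mtop TA closure_of ?S = cotangent_bundle A"
    using closure_of_subset_topspace[of "mtop TA" ?S] by (auto simp: T.topspace_mtop points_cot)
qed

end

section \<open>Functions of two points\<close>

definition prod_chart :: "('m, 'e) chart \<Rightarrow> ('n, 'f) chart \<Rightarrow> ('m \<times> 'n, 'e \<times> 'f) chart"
  where "prod_chart c d = (fst c \<times> fst d, map_prod (snd c) (snd d))"

lemma prod_chart_simps [simp]:
  "fst (prod_chart c d) = fst c \<times> fst d" "snd (prod_chart c d) = map_prod (snd c) (snd d)"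
  by (simp_all add: prod_chart_def)

lemma prod_atlas_mem: "C \<in> prod_atlas A B \<longleftrightarrow> (\<exists>c\<in>A. \<exists>d\<in>B. C = prod_chart c d)"
proof
  assume "C \<in> prod_atlas A B"
  then obtain U \<phi> V \<psi> where "C = (U \<times> V, map_prod \<phi> \<psi>)" "(U, \<phi>) \<in> A" "(V, \<psi>) \<in> B"
    unfolding prod_atlas_def by blast
  then show "\<exists>c\<in>A. \<exists>d\<in>B. C = prod_chart c d"
    by (intro bexI[of _ "(U, \<phi>)"] bexI[of _ "(V, \<psi>)"]) (auto simp: prod_chart_def)
next
  assume "\<exists>c\<in>A. \<exists>d\<in>B. C = prod_chart c d"
  then show "C \<in> prod_atlas A B" unfolding prod_atlas_def prod_chart_def by force
qed

lemma points_prod_atlas: "points (prod_atlas A B) = points A \<times> points B"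
proof -
  have "z \<in> points (prod_atlas A B) \<longleftrightarrow> z \<in> points A \<times> points B" for z
    unfolding points_def UN_iff Bex_def prod_atlas_mem by (cases z) fastforce
  then show ?thesis by blast
qed

lemma smooth_on_parallel:
  fixes f :: "'a::euclidean_space \<Rightarrow> 'c::real_normed_vector" and g :: "'b::euclidean_space \<Rightarrow> 'd::real_normed_vector"
  assumes S: "open S" "open T" and f: "smooth_on f S" and g: "smooth_on g T"
  shows "smooth_on (\<lambda>z. (f (fst z), g (snd z))) (S \<times> T)"
  by (intro smooth_on_Pair open_Times S
      smooth_on_compose[OF open_Times[OF S] S(1) smooth_on_linear[OF open_Times[OF S] bounded_linear_fst smooth_on_id] f]
      smooth_on_compose[OF open_Times[OF S] S(2) smooth_on_linear[OF open_Times[OF S] bounded_linear_snd smooth_on_id] g]) auto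

lemma inv_into_map_prod:
  assumes "inj_on \<phi> U" "inj_on \<psi> V" "s \<in> \<phi> ` U" "t \<in> \<psi> ` V"
  shows "inv_into (U \<times> V) (map_prod \<phi> \<psi>) (s, t) = (inv_into U \<phi> s, inv_into V \<psi> t)"
proof (rule inv_into_f_eq)
  show "inj_on (map_prod \<phi> \<psi>) (U \<times> V)" using assms map_prod_inj_on by blast
qed (use assms in \<open>auto simp: f_inv_into_f inv_into_into\<close>)

context
  fixes A :: "('m, 'e::euclidean_space) chart set" and B :: "('n, 'f::euclidean_space) chart set"
  assumes A: "smooth_atlas A" and B: "smooth_atlas B"
begin

interpretation A: smooth_atlas A by (rule A)
interpretation B: smooth_atlas B by (rule B)

lemma prod_chart_inv:
  "c \<in> A \<Longrightarrow> d \<in> B \<Longrightarrow> s \<in> snd c ` fst c \<Longrightarrow> t \<in> snd d ` fst d \<Longrightarrow>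
    inv_into (fst c \<times> fst d) (map_prod (snd c) (snd d)) (s, t) = (inv_into (fst c) (snd c) s, inv_into (fst d) (snd d) t)"
  by (rule inv_into_map_prod[OF A.chart_inj B.chart_inj])

lemma prod_smooth_atlas: "smooth_atlas (prod_atlas A B)"
proof
  show "is_atlas (prod_atlas A B)"
    unfolding is_atlas_def
  proof (intro conjI ballI, goal_cases)
    case (1 C)
    then obtain c d where c: "c \<in> A" "d \<in> B" "C = prod_chart c d" by (auto simp: prod_atlas_mem)
    then show ?case
      using map_prod_inj_on[OF A.chart_inj B.chart_inj, of c d] A.chart_open[of c] B.chart_open[of d]
      by (auto simp: case_prod_beta open_Times map_prod_surj_on[OF refl refl])
  next
    case (2 C)
    then obtain c d where c: "c \<in> A" "d \<in> B" "C = prod_chart c d" by (auto simp: prod_atlas_mem)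
    have "open (snd C ` (fst C \<inter> fst D)) \<and> smooth_on (local_rep C (snd D)) (snd C ` (fst C \<inter> fst D))"
      if D: "D \<in> prod_atlas A B" for D
    proof -
      obtain c' d' where c': "c' \<in> A" "d' \<in> B" "D = prod_chart c' d'" using D by (auto simp: prod_atlas_mem)
      have im: "snd C ` (fst C \<inter> fst D) = (snd c ` (fst c \<inter> fst c')) \<times> (snd d ` (fst d \<inter> fst d'))"
        unfolding c(3) c'(3) prod_chart_simps Times_Int_Times by (rule map_prod_surj_on[OF refl refl])
      have o: "open (snd C ` (fst C \<inter> fst D))"
        unfolding im by (intro open_Times A.overlap_open B.overlap_open c c')
      have "smooth_on (local_rep C (snd D)) (snd C ` (fst C \<inter> fst D))"
      proof (rule smooth_on_cong[OF o])
        show "smooth_on (\<lambda>z. (local_rep c (snd c') (fst z), local_rep d (snd d') (snd z))) (snd C ` (fst C \<inter> fst D))"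
          unfolding im
          by (intro smooth_on_parallel A.overlap_open B.overlap_open A.transition_smooth B.transition_smooth c c')
        show "(local_rep c (snd c') (fst z), local_rep d (snd d') (snd z)) = local_rep C (snd D) z"
          if "z \<in> snd C ` (fst C \<inter> fst D)" for z
          using that prod_chart_inv[OF c(1,2), of "fst z" "snd z"] unfolding im c(3) c'(3) by auto
      qed
      with o show ?thesis by blast
    qed
    then show ?case by (auto simp: case_prod_beta)
  qed
qed

end

lemma slice_open: "open T \<Longrightarrow> open {t. (s, t) \<in> T}" "open T \<Longrightarrow> open {s. (s, t) \<in> T}"
  using open_vimage[of T "\<lambda>t. (s, t)"] open_vimage[of T "\<lambda>s. (s, t)"]
  by (simp_all add: vimage_def continuous_on_Pair)

lemma slice_smooth:
  fixes g :: "'e::euclidean_space \<times> 'f::euclidean_space \<Rightarrow> 'b::real_normed_vector"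
  assumes T: "open T" and g: "smooth_on g T"
  shows "smooth_on (\<lambda>t. g (s, t)) {t. (s, t) \<in> T}" "smooth_on (\<lambda>s. g (s, t)) {s. (s, t) \<in> T}"
proof -
  have 1: "smooth_on (\<lambda>t. (s, t)) {t. (s, t) \<in> T}"
    by (rule smooth_on_Pair[OF slice_open(1)[OF T] smooth_on_const smooth_on_id])
  have 2: "smooth_on (\<lambda>s. (s, t)) {s. (s, t) \<in> T}"
    by (rule smooth_on_Pair[OF slice_open(2)[OF T] smooth_on_id smooth_on_const])
  show "smooth_on (\<lambda>t. g (s, t)) {t. (s, t) \<in> T}" by (rule smooth_on_compose[OF slice_open(1)[OF T] T 1 g]) auto
  show "smooth_on (\<lambda>s. g (s, t)) {s. (s, t) \<in> T}" by (rule smooth_on_compose[OF slice_open(2)[OF T] T 2 g]) auto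
qed

lemma slice_fd:
  assumes "smooth_on g T" "(s, t) \<in> T"
  shows "fd (\<lambda>t. g (s, t)) t h = fd g (s, t) (0, h)" "fd (\<lambda>s. g (s, t)) s k = fd g (s, t) (k, 0)"
proof -
  have "((\<lambda>t. (s, t)) has_derivative (\<lambda>h. (0, h))) (at t)" "((\<lambda>s. (s, t)) has_derivative (\<lambda>h. (h, 0))) (at s)"
    by (auto intro!: derivative_eq_intros)
  from diff_chain_at[OF this(1) smooth_on_has_fd[OF assms]] diff_chain_at[OF this(2) smooth_on_has_fd[OF assms]]
  show "fd (\<lambda>t. g (s, t)) t h = fd g (s, t) (0, h)" "fd (\<lambda>s. g (s, t)) s k = fd g (s, t) (k, 0)"
    by (simp_all add: o_def fd_eqI)
qed

lemma (in smooth_atlas) coord_vec_rep: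
  assumes c: "c \<in> A" "p \<in> fst c" and S: "open S" "snd c p \<in> S" and G: "smooth_on G S"
    and g: "\<And>q. q \<in> fst c \<Longrightarrow> snd c q \<in> S \<Longrightarrow> g q = G (snd c q)"
  shows "smooth_near A p g" and "coord_vec A c p w g = fd G (snd c p) w"
proof -
  let ?T = "S \<inter> snd c ` fst c"
  have o: "open ?T" using S chart_open[OF c(1)] by blast
  have e: "G x = local_rep c g x" if "x \<in> ?T" for x
    using that c(1) g by auto
  have "smooth_on (local_rep c g) ?T"
    by (rule smooth_on_cong[OF o e smooth_on_subset[OF G]]) auto
  then show n: "smooth_near A p g" unfolding smooth_near_iff[OF c] using o S c by blast
  have "fd G (snd c p) = fd (local_rep c g) (snd c p)"
    by (rule fd_cong[OF o _ e]) (use S c in auto)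
  then show "coord_vec A c p w g = fd G (snd c p) w" using n by (simp add: coord_vec_smooth)
qed

context smooth_atlas
begin

lemmas prod_chart_inv_self = prod_chart_inv[OF smooth_atlas_axioms smooth_atlas_axioms]

context
  fixes \<beta> :: "'m \<times> 'm \<Rightarrow> real" and p u v
  assumes \<beta>: "smooth_near (prod_atlas A A) (p, p) \<beta>" and p: "p \<in> points A"
    and u: "u \<in> tangent_space A p" and v: "v \<in> tangent_space A p"
begin

lemma two_point_rep:
  obtains c T a b where "c \<in> A" "p \<in> fst c" "open T" "(snd c p, snd c p) \<in> T"
    "T \<subseteq> snd c ` fst c \<times> snd c ` fst c"
    "smooth_on (\<lambda>z. \<beta> (inv_into (fst c) (snd c) (fst z), inv_into (fst c) (snd c) (snd z))) T"
    "u = coord_vec A c p a" "v = coord_vec A c p b"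
proof -
  interpret P: smooth_atlas "prod_atlas A A" by (rule prod_smooth_atlas[OF smooth_atlas_axioms smooth_atlas_axioms])
  obtain c where c: "c \<in> A" "p \<in> fst c" using p points_chartE by metis
  have C: "prod_chart c c \<in> prod_atlas A A" "(p, p) \<in> fst (prod_chart c c)" using c by (auto simp: prod_atlas_mem)
  obtain T where T: "open T" "snd (prod_chart c c) (p, p) \<in> T" "T \<subseteq> snd (prod_chart c c) ` fst (prod_chart c c)"
    "smooth_on (local_rep (prod_chart c c) \<beta>) T" using P.smooth_near_rep[OF C \<beta>] .
  have T3: "T \<subseteq> snd c ` fst c \<times> snd c ` fst c" using T(3) by auto
  have "smooth_on (\<lambda>z. \<beta> (inv_into (fst c) (snd c) (fst z), inv_into (fst c) (snd c) (snd z))) T"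
  proof (rule smooth_on_cong[OF T(1) _ T(4)])
    fix z assume "z \<in> T"
    then have "fst z \<in> snd c ` fst c" "snd z \<in> snd c ` fst c" using T3 by auto
    then show "local_rep (prod_chart c c) \<beta> z = \<beta> (inv_into (fst c) (snd c) (fst z), inv_into (fst c) (snd c) (snd z))"
      using prod_chart_inv_self[OF c(1) c(1), of "fst z" "snd z"] by simp
  qed
  then show ?thesis
    using that[OF c T(1) _ T3] T(2) u v unfolding tangent_space_chart[OF c] by auto
qed

text \<open>In a chart both sides are mixed second derivatives of one smooth function of two variables.\<close>
lemma mixed_derivatives_commute: "u (\<lambda>x. v (\<lambda>y. \<beta> (x, y))) = v (\<lambda>y. u (\<lambda>x. \<beta> (x, y)))"
proof -
  obtain c T a b where c: "c \<in> A" "p \<in> fst c" and T: "open T" "(snd c p, snd c p) \<in> T"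
      "T \<subseteq> snd c ` fst c \<times> snd c ` fst c"
    and sm: "smooth_on (\<lambda>z. \<beta> (inv_into (fst c) (snd c) (fst z), inv_into (fst c) (snd c) (snd z))) T"
    and ab: "u = coord_vec A c p a" "v = coord_vec A c p b" by (rule two_point_rep)
  let ?b = "\<lambda>z. \<beta> (inv_into (fst c) (snd c) (fst z), inv_into (fst c) (snd c) (snd z))"
  let ?x = "snd c p"
  have inner1: "v (\<lambda>y. \<beta> (x, y)) = fd ?b (snd c x, ?x) (0, b)" if "x \<in> fst c" "snd c x \<in> {s. (s, ?x) \<in> T}" for x
    unfolding ab(2)
    by (subst coord_vec_rep(2)[OF c slice_open(1)[OF T(1), of "snd c x"] _ slice_smooth(1)[OF T(1) sm]])
      (use that c slice_fd(1)[OF sm, of "snd c x" ?x b] in auto)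
  have inner2: "u (\<lambda>x. \<beta> (x, y)) = fd ?b (?x, snd c y) (a, 0)" if "y \<in> fst c" "snd c y \<in> {t. (?x, t) \<in> T}" for y
    unfolding ab(1)
    by (subst coord_vec_rep(2)[OF c slice_open(2)[OF T(1), of "snd c y"] _ slice_smooth(2)[OF T(1) sm]])
      (use that c slice_fd(2)[OF sm, of ?x "snd c y" a] in auto)
  have "u (\<lambda>x. v (\<lambda>y. \<beta> (x, y))) = fd (\<lambda>s. fd ?b (s, ?x) (0, b)) ?x a"
    unfolding ab(1)
    by (rule coord_vec_rep(2)[OF c slice_open(2)[OF T(1), of ?x] _
          slice_smooth(2)[OF T(1) smooth_on_fd_const[OF sm]] inner1]) (use T in auto)
  also have "\<dots> = fd (\<lambda>z. fd ?b z (0, b)) (?x, ?x) (a, 0)"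
    by (rule slice_fd(2)[OF smooth_on_fd_const[OF sm] T(2)])
  also have "\<dots> = fd (\<lambda>z. fd ?b z (a, 0)) (?x, ?x) (0, b)"
    by (rule fd_fd_commute[OF T(1) sm T(2)])
  also have "\<dots> = fd (\<lambda>t. fd ?b (?x, t) (a, 0)) ?x b"
    by (rule slice_fd(1)[OF smooth_on_fd_const[OF sm] T(2), symmetric])
  also have "\<dots> = v (\<lambda>y. u (\<lambda>x. \<beta> (x, y)))"
    unfolding ab(2)
    by (rule coord_vec_rep(2)[OF c slice_open(1)[OF T(1), of ?x] _
          slice_smooth(1)[OF T(1) smooth_on_fd_const[OF sm]] inner2, symmetric]) (use T in auto)
  finally show ?thesis .
qed

lemma diagonal_derivative: "u (\<lambda>x. \<beta> (x, x)) = u (\<lambda>x. \<beta> (x, p)) + u (\<lambda>y. \<beta> (p, y))"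
proof -
  obtain c T a b where c: "c \<in> A" "p \<in> fst c" and T: "open T" "(snd c p, snd c p) \<in> T"
      "T \<subseteq> snd c ` fst c \<times> snd c ` fst c"
    and sm: "smooth_on (\<lambda>z. \<beta> (inv_into (fst c) (snd c) (fst z), inv_into (fst c) (snd c) (snd z))) T"
    and ab: "u = coord_vec A c p a" "v = coord_vec A c p b" by (rule two_point_rep)
  let ?b = "\<lambda>z. \<beta> (inv_into (fst c) (snd c) (fst z), inv_into (fst c) (snd c) (snd z))"
  let ?x = "snd c p"
  have o: "open {s. (s, s) \<in> T}"
    using open_vimage[OF T(1), of "\<lambda>s. (s, s)"] by (simp add: vimage_def continuous_on_Pair)
  have d: "((\<lambda>s. (s, s)) has_derivative (\<lambda>h. (h, h))) (at ?x)" by (auto intro!: derivative_eq_intros)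
  have smd: "smooth_on (\<lambda>s. ?b (s, s)) {s. (s, s) \<in> T}"
    by (rule smooth_on_compose[OF o T(1) smooth_on_Pair[OF o smooth_on_id smooth_on_id] sm]) auto
  have "u (\<lambda>x. \<beta> (x, x)) = fd (\<lambda>s. ?b (s, s)) ?x a"
    unfolding ab(1) by (rule coord_vec_rep(2)[OF c o _ smd]) (use T c in auto)
  also have "\<dots> = fd ?b (?x, ?x) (a, a)"
    using fd_eqI[OF diff_chain_at[OF d smooth_on_has_fd[OF sm T(2)]]] by (simp add: o_def)
  also have "\<dots> = fd ?b (?x, ?x) (a, 0) + fd ?b (?x, ?x) (0, a)"
    using linear_add[OF linear_fd[OF sm T(2)], of "(a, 0)" "(0, a)"] by simp
  also have "fd ?b (?x, ?x) (a, 0) = fd (\<lambda>s. ?b (s, ?x)) ?x a" by (rule slice_fd(2)[OF sm T(2), symmetric])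
  also have "\<dots> = u (\<lambda>x. \<beta> (x, p))"
    unfolding ab(1)
    by (rule coord_vec_rep(2)[OF c slice_open(2)[OF T(1), of ?x] _ slice_smooth(2)[OF T(1) sm], symmetric]) (use T c in auto)
  also have "fd ?b (?x, ?x) (0, a) = fd (\<lambda>s. ?b (?x, s)) ?x a" by (rule slice_fd(1)[OF sm T(2), symmetric])
  also have "\<dots> = u (\<lambda>y. \<beta> (p, y))"
    unfolding ab(1)
    by (rule coord_vec_rep(2)[OF c slice_open(1)[OF T(1), of ?x] _ slice_smooth(1)[OF T(1) sm], symmetric]) (use T c in auto)
  finally show ?thesis .
qed

end

end

section \<open>Left-invariant and right-invariant vector fields\<close>

lemma push_linear:
  "push B F p (v + w) = push B F p v + push B F p w" "push B F p (r *\<^sub>R v) = r *\<^sub>R push B F p v"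
  by (auto simp: push_def fun_eq_iff scaleR_fun_def)

locale smooth_group =
  fixes G :: "('g, 'x) monoid_scheme" (structure) and A :: "('g, 'e::euclidean_space) chart set"
  assumes lie: "lie_group G A"

sublocale smooth_group \<subseteq> group G
  using lie by (simp add: lie_group_def)

sublocale smooth_group \<subseteq> smooth_atlas A
  using lie by unfold_locales (simp add: lie_group_def smooth_manifold_def)

context smooth_group
begin

lemma carrier_points: "carrier G = points A"
  and mult_smooth: "smooth_map (prod_atlas A A) A (\<lambda>(a, b). a \<otimes> b)"
  and inv_smooth: "smooth_map A A (m_inv G)"
  using lie by (auto simp: lie_group_def)

lemma prod_atlas_smooth: "smooth_atlas (prod_atlas A A)"
  by (rule prod_smooth_atlas[OF smooth_atlas_axioms smooth_atlas_axioms])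

text \<open>Left translation by \<open>q\<close> is the multiplication restricted to a slice.\<close>
lemma left_mult_chart:
  assumes q: "q \<in> carrier G" and c: "c \<in> A" "d \<in> A"
  shows "open (snd c ` (fst c \<inter> (\<lambda>x. q \<otimes> x) -` fst d))"
    and "smooth_on (\<lambda>x. snd d (q \<otimes> inv_into (fst c) (snd c) x)) (snd c ` (fst c \<inter> (\<lambda>x. q \<otimes> x) -` fst d))"
proof -
  obtain e where e: "e \<in> A" "q \<in> fst e" using q carrier_points points_chartE by metis
  let ?m = "\<lambda>(a, b). a \<otimes> b"
  let ?C = "prod_chart e c"
  let ?S = "snd ?C ` (fst ?C \<inter> ?m -` fst d)"
  let ?s = "snd e q"
  interpret P: smooth_atlas "prod_atlas A A" by (rule prod_atlas_smooth)
  have C: "?C \<in> prod_atlas A A" using e c by (auto simp: prod_atlas_mem)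
  note S = P.smooth_map_chart[OF mult_smooth C c(2)]
  have eq: "snd c ` (fst c \<inter> (\<lambda>x. q \<otimes> x) -` fst d) = {t. (?s, t) \<in> ?S}"
  proof (intro Set.set_eqI iffI)
    fix t assume "t \<in> snd c ` (fst c \<inter> (\<lambda>x. q \<otimes> x) -` fst d)"
    then obtain x where "x \<in> fst c" "q \<otimes> x \<in> fst d" "t = snd c x" by auto
    then show "t \<in> {t. (?s, t) \<in> ?S}" using e by (auto intro!: image_eqI[of _ _ "(q, x)"])
  next
    fix t assume "t \<in> {t. (?s, t) \<in> ?S}"
    then obtain q' x where x: "q' \<in> fst e" "x \<in> fst c" "q' \<otimes> x \<in> fst d" "snd e q' = ?s" "t = snd c x" by auto
    then have "q' = q" using chart_inj[OF e(1)] e(2) by (auto dest: inj_onD)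
    with x show "t \<in> snd c ` (fst c \<inter> (\<lambda>x. q \<otimes> x) -` fst d)" by auto
  qed
  show o: "open (snd c ` (fst c \<inter> (\<lambda>x. q \<otimes> x) -` fst d))" unfolding eq by (rule slice_open(1)[OF S(1)])
  have "smooth_on (\<lambda>t. snd d (?m (inv_into (fst ?C) (snd ?C) (?s, t)))) {t. (?s, t) \<in> ?S}"
    by (rule slice_smooth(1)[OF S])
  then show "smooth_on (\<lambda>x. snd d (q \<otimes> inv_into (fst c) (snd c) x)) (snd c ` (fst c \<inter> (\<lambda>x. q \<otimes> x) -` fst d))"
    unfolding eq[symmetric]
    by (rule smooth_on_cong[OF o, rotated])
      (use e prod_chart_inv_self[OF e(1) c(1), of ?s] in auto)
qed

lemma smooth_mapI:
  assumes "F ` points A' \<subseteq> points B"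
    "\<And>c d. c \<in> A' \<Longrightarrow> d \<in> B \<Longrightarrow> open (snd c ` (fst c \<inter> F -` fst d))"
    "\<And>c d. c \<in> A' \<Longrightarrow> d \<in> B \<Longrightarrow> smooth_on (\<lambda>x. snd d (F (inv_into (fst c) (snd c) x))) (snd c ` (fst c \<inter> F -` fst d))"
  shows "smooth_map A' B F"
  using assms unfolding smooth_map_def o_def case_prod_beta by blast

lemma left_mult_smooth: "q \<in> carrier G \<Longrightarrow> smooth_map A A (\<lambda>x. q \<otimes> x)"
  by (rule smooth_mapI) (auto simp: left_mult_chart carrier_points[symmetric])

lemma two_sided_smooth:
  assumes q: "q \<in> carrier G"
  shows "smooth_map (prod_atlas A A) (prod_atlas A A) (\<lambda>z. (inv (snd z), q \<otimes> fst z))" (is "smooth_map _ _ ?K")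
proof (rule smooth_mapI)
  show "?K ` points (prod_atlas A A) \<subseteq> points (prod_atlas A A)"
    using q by (auto simp: points_prod_atlas carrier_points[symmetric])
  fix C D assume "C \<in> prod_atlas A A" "D \<in> prod_atlas A A"
  then obtain c d c' d' where c: "c \<in> A" "d \<in> A" "C = prod_chart c d" "c' \<in> A" "d' \<in> A" "D = prod_chart c' d'"
    by (auto simp: prod_atlas_mem)
  let ?X = "fst c \<inter> (\<lambda>x. q \<otimes> x) -` fst d'" and ?Y = "fst d \<inter> m_inv G -` fst c'"
  have "fst C \<inter> ?K -` fst D = ?X \<times> ?Y" using c by auto
  then have im: "snd C ` (fst C \<inter> ?K -` fst D) = (snd c ` ?X) \<times> (snd d ` ?Y)"
    unfolding c(3) prod_chart_simps by (simp add: map_prod_surj_on[OF refl refl])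
  have oX: "open (snd c ` ?X)" by (rule left_mult_chart(1)[OF q c(1,5)])
  have oY: "open (snd d ` ?Y)" by (rule smooth_map_chart(1)[OF inv_smooth c(2,4)])
  show o: "open (snd C ` (fst C \<inter> ?K -` fst D))" unfolding im by (intro open_Times oX oY)
  have sX: "smooth_on (\<lambda>z :: 'e \<times> 'e. snd d' (q \<otimes> inv_into (fst c) (snd c) (fst z))) (snd c ` ?X \<times> snd d ` ?Y)"
    by (rule smooth_on_compose[OF open_Times[OF oX oY] oX smooth_on_linear[OF open_Times[OF oX oY] bounded_linear_fst smooth_on_id] left_mult_chart(2)[OF q c(1,5)]]) auto
  have sY: "smooth_on (\<lambda>z :: 'e \<times> 'e. snd c' (inv (inv_into (fst d) (snd d) (snd z)))) (snd c ` ?X \<times> snd d ` ?Y)"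
    by (rule smooth_on_compose[OF open_Times[OF oX oY] oY smooth_on_linear[OF open_Times[OF oX oY] bounded_linear_snd smooth_on_id] smooth_map_chart(2)[OF inv_smooth c(2,4)]]) auto
  show "smooth_on (\<lambda>x. snd D (?K (inv_into (fst C) (snd C) x))) (snd C ` (fst C \<inter> ?K -` fst D))"
  proof (rule smooth_on_cong[OF o])
    show "smooth_on (\<lambda>z. (snd c' (inv (inv_into (fst d) (snd d) (snd z))), snd d' (q \<otimes> inv_into (fst c) (snd c) (fst z))))
        (snd C ` (fst C \<inter> ?K -` fst D))"
      unfolding im by (rule smooth_on_Pair[OF open_Times[OF oX oY] sY sX])
    fix z assume "z \<in> snd C ` (fst C \<inter> ?K -` fst D)"
    then have "fst z \<in> snd c ` fst c" "snd z \<in> snd d ` fst d" unfolding im by auto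
    then show "(snd c' (inv (inv_into (fst d) (snd d) (snd z))), snd d' (q \<otimes> inv_into (fst c) (snd c) (fst z)))
        = snd D (?K (inv_into (fst C) (snd C) z))"
      using prod_chart_inv_self[OF c(1,2), of "fst z" "snd z"] c(3,6) by simp
  qed
qed

text \<open>Right factors generate left-invariant fields and left factors right-invariant ones; this function of
  two group elements near the unit sees both.\<close>
lemma smooth_near_two_sided:
  assumes q: "q \<in> carrier G" and a: "smooth_near A q a"
  shows "smooth_near (prod_atlas A A) (\<one>, \<one>) (\<lambda>z. a (inv (snd z) \<otimes> (q \<otimes> fst z)))"
proof -
  have o: "\<one> \<in> points A" by (simp add: carrier_points[symmetric])
  let ?m = "\<lambda>(a, b). a \<otimes> b"
  have "smooth_near (prod_atlas A A) (\<one>, q) (a \<circ> ?m)"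
    by (rule smooth_near_compose_map[OF prod_atlas_smooth smooth_atlas_axioms mult_smooth])
      (use q a o carrier_points in \<open>auto simp: points_prod_atlas\<close>)
  then have "smooth_near (prod_atlas A A) (\<one>, \<one>) (a \<circ> ?m \<circ> (\<lambda>z. (inv (snd z), q \<otimes> fst z)))"
    by (intro smooth_near_compose_map[OF prod_atlas_smooth prod_atlas_smooth two_sided_smooth[OF q]])
      (use q o in \<open>auto simp: points_prod_atlas\<close>)
  then show ?thesis by (simp add: o_def)
qed

abbreviation i_push :: "'g vfield \<Rightarrow> 'g vfield" where "i_push \<equiv> inversion_push G A"

lemma inv_points [simp]: "q \<in> points A \<Longrightarrow> inv q \<in> points A" "q \<in> points A \<Longrightarrow> inv (inv q) = q"
  by (simp_all add: carrier_points[symmetric])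

lemma smooth_near_inv: "q \<in> points A \<Longrightarrow> smooth_near A q a \<Longrightarrow> smooth_near A (inv q) (a \<circ> m_inv G)"
  by (rule smooth_near_compose_self[OF inv_smooth]) simp_all

lemma i_push_apply: "q \<in> points A \<Longrightarrow> smooth_near A q a \<Longrightarrow> i_push X q a = X (inv q) (a \<circ> m_inv G)"
  by (simp add: inversion_push_def push_def)

lemma i_push_tangent: "vector_field A X \<Longrightarrow> q \<in> points A \<Longrightarrow> i_push X q \<in> tangent_space A q"
  using push_tangent_self[OF inv_smooth, of "inv q" "X (inv q)"]
  by (simp add: inversion_push_def field_tangent)

lemma i_push_field:
  assumes X: "vector_field A X"
  shows "vector_field A (i_push X)"
  unfolding vector_field_on_def
proof (intro conjI ballI allI impI)
  show "q \<in> points A \<Longrightarrow> i_push X q \<in> tangent_space A q" for q by (rule i_push_tangent[OF X])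
  fix W a assume W: "openin (mtop A) W \<and> W \<subseteq> points A \<and> smooth_fun_on A W a"
  show "smooth_fun_on A W (\<lambda>q. i_push X q a)"
  proof (rule smooth_fun_onI)
    fix q assume q: "q \<in> W"
    have qA: "q \<in> points A" using q W by blast
    have a: "smooth_near A q' a" if "q' \<in> W" for q' using that W smooth_near_fun_on by blast
    have "smooth_near A (inv q) (\<lambda>p. X p (a \<circ> m_inv G))"
      by (rule smooth_near_field[OF openin_points X]) (use qA smooth_near_inv[OF qA a[OF q]] in auto)
    then have "smooth_near A q ((\<lambda>p. X p (a \<circ> m_inv G)) \<circ> m_inv G)"
      using smooth_near_inv[of "inv q"] qA by simp
    moreover have "((\<lambda>p. X p (a \<circ> m_inv G)) \<circ> m_inv G) q' = i_push X q' a" if "q' \<in> W" for q'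
      using i_push_apply[OF _ a[OF that]] that W by auto
    ultimately show "smooth_near A q (\<lambda>q. i_push X q a)"
      using smooth_near_cong[OF conjunct1[OF W] q, of "(\<lambda>p. X p (a \<circ> m_inv G)) \<circ> m_inv G" "\<lambda>q. i_push X q a"] by simp
  qed (use W in blast)
qed

lemma i_push_i_push:
  assumes v: "v \<in> tangent_space A q" and q: "q \<in> points A"
  shows "push A (m_inv G) (inv q) (push A (m_inv G) q v) = v"
proof (rule tangent_eqI[OF _ v])
  have "push A (m_inv G) q v \<in> tangent_space A (inv q)"
    by (rule push_tangent_self[OF inv_smooth q v])
  then show "push A (m_inv G) (inv q) (push A (m_inv G) q v) \<in> tangent_space A q"
    using push_tangent_self[OF inv_smooth, of "inv q"] q by simp
  fix a assume a: "smooth_near A q a"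
  have "v (a \<circ> m_inv G \<circ> m_inv G) = v a"
    by (rule tangent_cong[OF v openin_points q]) simp
  then show "push A (m_inv G) (inv q) (push A (m_inv G) q v) a = v a"
    using q a smooth_near_inv[OF q a] by (simp add: push_def)
qed

lemma lie_bracket_i_push:
  assumes X: "vector_field A X" and Y: "vector_field A Y" and q: "q \<in> points A"
  shows "lie_bracket A (i_push X) (i_push Y) q = i_push (lie_bracket A X Y) q"
proof (rule tangent_eqI)
  show "lie_bracket A (i_push X) (i_push Y) q \<in> tangent_space A q"
    by (rule lie_bracket_tangent[OF openin_points q i_push_field[OF X] i_push_field[OF Y]])
  show "i_push (lie_bracket A X Y) q \<in> tangent_space A q"
    using push_tangent_self[OF inv_smooth, of "inv q"]
      lie_bracket_tangent[OF openin_points _ X Y, of "inv q"] q by (simp add: inversion_push_def)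
  fix a assume a: "smooth_near A q a"
  then obtain W where W: "openin (mtop A) W" "q \<in> W" "smooth_fun_on A W a" unfolding smooth_near_def by blast
  let ?V = "points A \<inter> m_inv G -` W"
  have V: "openin (mtop A) ?V" "inv q \<in> ?V"
    using smooth_map_openin_self[OF inv_smooth W(1)] W q by auto
  have *: "i_push X q (\<lambda>q'. i_push Y q' a) = X (inv q) (\<lambda>p. Y p (a \<circ> m_inv G))"
    if X: "vector_field A X" and Y: "vector_field A Y" for X Y
  proof -
    have "smooth_near A q (\<lambda>q'. i_push Y q' a)"
      by (rule smooth_near_field[OF openin_points i_push_field[OF Y] q a])
    then have "i_push X q (\<lambda>q'. i_push Y q' a) = X (inv q) ((\<lambda>q'. i_push Y q' a) \<circ> m_inv G)"
      by (rule i_push_apply[OF q])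
    also have "\<dots> = X (inv q) (\<lambda>p. Y p (a \<circ> m_inv G))"
    proof (rule tangent_cong[OF field_tangent[OF X] V])
      fix p assume p: "p \<in> ?V"
      then have "smooth_near A (inv p) a" using W smooth_near_fun_on by auto
      then show "((\<lambda>q'. i_push Y q' a) \<circ> m_inv G) p = Y p (a \<circ> m_inv G)"
        using i_push_apply[of "inv p" a Y] p by simp
    qed (use q in simp)
    finally show ?thesis .
  qed
  show "lie_bracket A (i_push X) (i_push Y) q a = i_push (lie_bracket A X Y) q a"
    unfolding i_push_apply[OF q a] using a smooth_near_inv[OF q a] *[OF X Y] *[OF Y X]
    by (simp add: lie_bracket_def)
qed

lemma left_invariant_apply:
  assumes X: "left_invariant_field G A X" and q: "q \<in> points A" and a: "smooth_near A q a"
  shows "X q a = X \<one> (\<lambda>x. a (q \<otimes> x))"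
proof -
  have "left_push G A q \<one> (X \<one>) = X (q \<otimes> \<one>)"
    using X q unfolding left_invariant_field_def carrier_points[symmetric] by blast
  then have "X q = push A (\<lambda>x. q \<otimes> x) \<one> (X \<one>)" using q by (simp add: left_push_def carrier_points)
  then show ?thesis using a q by (simp add: push_def o_def carrier_points)
qed

lemma left_invariant_field_field: "left_invariant_field G A X \<Longrightarrow> vector_field A X"
  by (simp add: left_invariant_field_def)

lemma one_points: "\<one> \<in> points A"
  by (simp add: carrier_points[symmetric])

lemma i_push_left_invariant_apply:
  assumes X: "left_invariant_field G A X" and q: "q \<in> points A" and a: "smooth_near A q a"
  shows "i_push X q a = X \<one> (\<lambda>y. a (inv y \<otimes> q))"
proof -
  have "i_push X q a = X \<one> (\<lambda>y. (a \<circ> m_inv G) (inv q \<otimes> y))"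
    unfolding i_push_apply[OF q a] by (rule left_invariant_apply[OF X _ smooth_near_inv[OF q a]]) (use q in simp)
  also have "\<dots> = X \<one> (\<lambda>y. a (inv y \<otimes> q))"
    by (rule tangent_cong[OF field_tangent[OF left_invariant_field_field[OF X] one_points] openin_points one_points])
      (use q in \<open>simp add: carrier_points[symmetric] inv_mult_group\<close>)
  finally show ?thesis .
qed

text \<open>Left translations commute with right translations, so both iterated derivatives of \<open>a\<close> at \<open>q\<close> are
  mixed derivatives at the unit of the one function \<open>(x, y) \<mapsto> a (inv y \<otimes> (q \<otimes> x))\<close>.\<close>
lemma lie_bracket_left_right:
  assumes X: "left_invariant_field G A X" and Y: "left_invariant_field G A Y" and q: "q \<in> points A"
  shows "lie_bracket A X (i_push Y) q = 0"
proof (rule tangent_eqI)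
  note XF = left_invariant_field_field[OF X] and YF = left_invariant_field_field[OF Y]
  show "lie_bracket A X (i_push Y) q \<in> tangent_space A q"
    by (rule lie_bracket_tangent[OF openin_points q XF i_push_field[OF YF]])
  show "0 \<in> tangent_space A q" by (rule tangent_closed(3)[OF q])
  fix a assume a: "smooth_near A q a"
  then obtain W where W: "openin (mtop A) W" "q \<in> W" "smooth_fun_on A W a" unfolding smooth_near_def by blast
  have qc: "q \<in> carrier G" using q carrier_points by simp
  have aW: "smooth_near A p a" if "p \<in> W" for p using that W smooth_near_fun_on by blast
  have WA: "p \<in> points A" if "p \<in> W" for p using that W openin_sub by blast
  note tX = field_tangent[OF XF one_points] and tY = field_tangent[OF YF one_points]
  have *: "X q (\<lambda>p. i_push Y p a) = X \<one> (\<lambda>x. Y \<one> (\<lambda>y. a (inv y \<otimes> (q \<otimes> x))))"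
  proof -
    let ?V = "points A \<inter> (\<lambda>x. q \<otimes> x) -` W"
    have V: "openin (mtop A) ?V" "\<one> \<in> ?V"
      using smooth_map_openin_self[OF left_mult_smooth[OF qc] W(1)] W qc one_points by auto
    have "X q (\<lambda>p. i_push Y p a) = X \<one> (\<lambda>x. i_push Y (q \<otimes> x) a)"
      by (rule left_invariant_apply[OF X q smooth_near_field[OF openin_points i_push_field[OF YF] q a]])
    also have "\<dots> = X \<one> (\<lambda>x. Y \<one> (\<lambda>y. a (inv y \<otimes> (q \<otimes> x))))"
      by (rule tangent_cong[OF tX V]) (use i_push_left_invariant_apply[OF Y] aW WA in auto)
    finally show ?thesis .
  qed
  have **: "i_push Y q (\<lambda>p. X p a) = Y \<one> (\<lambda>y. X \<one> (\<lambda>x. a (inv y \<otimes> (q \<otimes> x))))"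
  proof -
    let ?V = "points A \<inter> (\<lambda>y. inv q \<otimes> y) -` (points A \<inter> m_inv G -` W)"
    have V: "openin (mtop A) ?V" "\<one> \<in> ?V"
      using smooth_map_openin_self[OF left_mult_smooth[OF inv_closed[OF qc]]
          smooth_map_openin_self[OF inv_smooth W(1)]] W qc one_points q
      by auto
    have "i_push Y q (\<lambda>p. X p a) = Y \<one> (\<lambda>y. X (inv y \<otimes> q) a)"
      by (rule i_push_left_invariant_apply[OF Y q smooth_near_field[OF openin_points XF q a]])
    also have "\<dots> = Y \<one> (\<lambda>y. X \<one> (\<lambda>x. a (inv y \<otimes> (q \<otimes> x))))"
    proof (rule tangent_cong[OF tY V])
      fix y assume y: "y \<in> ?V"
      then have yc: "y \<in> carrier G" by (simp add: carrier_points)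
      have "inv y \<otimes> q \<in> W" using y yc qc by (auto simp: inv_mult_group)
      then have "X (inv y \<otimes> q) a = X \<one> (\<lambda>x. a ((inv y \<otimes> q) \<otimes> x))"
        using left_invariant_apply[OF X] aW WA by blast
      also have "\<dots> = X \<one> (\<lambda>x. a (inv y \<otimes> (q \<otimes> x)))"
        by (rule tangent_cong[OF tX openin_points one_points])
          (use yc qc in \<open>simp add: carrier_points[symmetric] m_assoc\<close>)
      finally show "X (inv y \<otimes> q) a = X \<one> (\<lambda>x. a (inv y \<otimes> (q \<otimes> x)))" .
    qed
    finally show ?thesis .
  qed
  show "lie_bracket A X (i_push Y) q a = 0 a"
    using mixed_derivatives_commute[OF smooth_near_two_sided[OF qc a] one_points tX tY] a * **
    by (simp add: lie_bracket_def)
qed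

text \<open>The function \<open>inv x \<otimes> x\<close> is constant, so the two partial derivatives of \<open>a (inv y \<otimes> x)\<close> at the unit cancel.\<close>
lemma i_push_one:
  assumes X: "left_invariant_field G A X"
  shows "i_push X \<one> = (-1) *\<^sub>R X \<one>"
proof (rule tangent_eqI)
  note XF = left_invariant_field_field[OF X]
  note tX = field_tangent[OF XF one_points]
  show "i_push X \<one> \<in> tangent_space A \<one>" by (rule i_push_tangent[OF XF one_points])
  show "(-1) *\<^sub>R X \<one> \<in> tangent_space A \<one>" by (rule tangent_closed(2)[OF one_points tX])
  fix a assume a: "smooth_near A \<one> a"
  have "X \<one> (\<lambda>x. a (inv x \<otimes> (\<one> \<otimes> x))) = X \<one> (\<lambda>x. a (inv \<one> \<otimes> (\<one> \<otimes> x))) + X \<one> (\<lambda>y. a (inv y \<otimes> (\<one> \<otimes> \<one>)))"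
    using diagonal_derivative[OF smooth_near_two_sided[OF one_closed a] one_points tX tX] by simp
  moreover have "X \<one> (\<lambda>x. a (inv x \<otimes> (\<one> \<otimes> x))) = X \<one> (\<lambda>x. a \<one>)"
    by (rule tangent_cong[OF tX openin_points one_points]) (simp add: carrier_points[symmetric])
  moreover have "X \<one> (\<lambda>x. a (inv \<one> \<otimes> (\<one> \<otimes> x))) = X \<one> a"
    by (rule tangent_cong[OF tX openin_points one_points]) (simp add: carrier_points[symmetric])
  ultimately show "i_push X \<one> a = ((-1) *\<^sub>R X \<one>) a"
    using i_push_left_invariant_apply[OF X one_points a] tangent_const[OF tX] by (simp add: scaleR_fun_def)
qed

end

section \<open>Frames on three-dimensional manifolds\<close>

definition det3 :: "real ^ 3 \<Rightarrow> real ^ 3 \<Rightarrow> real ^ 3 \<Rightarrow> real" where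
  "det3 x y z = x $ 1 * (y $ 2 * z $ 3 - y $ 3 * z $ 2) - x $ 2 * (y $ 1 * z $ 3 - y $ 3 * z $ 1)
     + x $ 3 * (y $ 1 * z $ 2 - y $ 2 * z $ 1)"

text \<open>Cramer's rule: the coefficients of a combination are quotients of determinants.\<close>
lemma det3_comb:
  "det3 (r *\<^sub>R x + s *\<^sub>R y + t *\<^sub>R z) y z = r * det3 x y z"
  "det3 x (r *\<^sub>R x + s *\<^sub>R y + t *\<^sub>R z) z = s * det3 x y z"
  "det3 x y (r *\<^sub>R x + s *\<^sub>R y + t *\<^sub>R z) = t * det3 x y z"
  by (simp_all add: det3_def algebra_simps)

lemma det3_nonzero:
  assumes "\<And>v. \<exists>r s t. v = r *\<^sub>R x + s *\<^sub>R y + t *\<^sub>R z"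
  shows "det3 x y z \<noteq> 0"
proof -
  let ?M = "vector [x, y, z] :: real ^ 3 ^ 3"
  have "\<forall>i. \<exists>w :: real ^ 3. axis i (1::real) = w $ 1 *\<^sub>R x + w $ 2 *\<^sub>R y + w $ 3 *\<^sub>R z"
  proof
    fix i :: 3
    obtain r s t where "axis i (1::real) = r *\<^sub>R x + s *\<^sub>R y + t *\<^sub>R z" using assms by blast
    then show "\<exists>w :: real ^ 3. axis i (1::real) = w $ 1 *\<^sub>R x + w $ 2 *\<^sub>R y + w $ 3 *\<^sub>R z"
      by (intro exI[of _ "vector [r, s, t]"]) simp
  qed
  then obtain w :: "3 \<Rightarrow> real ^ 3" where w: "\<And>i. axis i (1::real) = w i $ 1 *\<^sub>R x + w i $ 2 *\<^sub>R y + w i $ 3 *\<^sub>R z" by metis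
  have "((\<chi> i. w i) ** ?M) $ i $ j = mat 1 $ i $ j" for i j
  proof -
    have "(axis i (1::real)) $ j = (w i $ 1 *\<^sub>R x + w i $ 2 *\<^sub>R y + w i $ 3 *\<^sub>R z) $ j" using w[of i] by simp
    then show ?thesis
      by (cases "i = j") (auto simp: matrix_matrix_mult_def sum_3 mat_def axis_def)
  qed
  then have "(\<chi> i. w i) ** ?M = mat 1" by (simp add: vec_eq_iff)
  then have "det (\<chi> i. w i) * det ?M = 1" by (metis det_mul det_I)
  then have "det ?M \<noteq> 0" by auto
  then show ?thesis by (simp add: det_3 det3_def algebra_simps)
qed

lemma smooth_on_det3:
  assumes "open S" "smooth_on x S" "smooth_on y S" "smooth_on z S"
  shows "smooth_on (\<lambda>p. det3 (x p) (y p) (z p)) S"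
  unfolding det3_def
  by (intro smooth_on_add smooth_on_diff smooth_on_mult assms(1)
      smooth_on_linear[OF assms(1) bounded_linear_vec_nth] assms)

definition spanning_fields :: "('m, 'e::euclidean_space) chart set \<Rightarrow> (nat \<Rightarrow> 'm vfield) \<Rightarrow> bool" where
  "spanning_fields A X \<longleftrightarrow> (\<forall>i\<in>{0,1,2}. vector_field A (X i)) \<and>
     (\<forall>q\<in>points A. \<forall>v\<in>tangent_space A q. \<exists>r s t. v = r *\<^sub>R X 0 q + s *\<^sub>R X 1 q + t *\<^sub>R X 2 q)"

lemma frame_spanning:
  assumes "is_frame A {0, 1, 2} X"
  shows "spanning_fields A X"
proof -
  have "\<exists>r s t. v = r *\<^sub>R X 0 q + s *\<^sub>R X 1 q + t *\<^sub>R X 2 q" if q: "q \<in> points A" and v: "v \<in> tangent_space A q" for q v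
  proof -
    have "v \<in> span {X 0 q, X 1 q, X 2 q}" using assms q v unfolding is_frame_def by auto
    then obtain r s t where "v - r *\<^sub>R X 0 q - s *\<^sub>R X 1 q - t *\<^sub>R X 2 q = 0"
      by (auto simp: span_breakdown_eq)
    then have "v = r *\<^sub>R X 0 q + s *\<^sub>R X 1 q + t *\<^sub>R X 2 q" by (simp add: algebra_simps)
    then show ?thesis by blast
  qed
  then show ?thesis using assms unfolding spanning_fields_def is_frame_def by blast
qed

text \<open>When \<open>X\<close> commutes with the \<open>Z i\<close>, the Leibniz rule leaves only the derivatives of the coefficients.\<close>
lemma (in smooth_atlas) bracket_of_combination:
  assumes q: "q \<in> points A" and X: "vector_field A X"
    and Z: "\<And>i. i \<in> {0,1,2::nat} \<Longrightarrow> vector_field A (Z i)" "\<And>i. i \<in> {0,1,2::nat} \<Longrightarrow> lie_bracket A X (Z i) q = 0"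
    and c: "\<And>i. i \<in> {0,1,2::nat} \<Longrightarrow> smooth_near A q (c i)"
    and Y: "vector_field A Y" "\<And>p. p \<in> points A \<Longrightarrow> Y p = c 0 p *\<^sub>R Z 0 p + c 1 p *\<^sub>R Z 1 p + c 2 p *\<^sub>R Z 2 p"
  shows "lie_bracket A X Y q = X q (c 0) *\<^sub>R Z 0 q + X q (c 1) *\<^sub>R Z 1 q + X q (c 2) *\<^sub>R Z 2 q"
proof (rule tangent_eqI)
  have tX: "X q \<in> tangent_space A q" by (rule field_tangent[OF X q])
  have tZ: "Z i q \<in> tangent_space A q" if "i \<in> {0,1,2::nat}" for i :: nat by (rule field_tangent[OF Z(1)[OF that] q])
  show "lie_bracket A X Y q \<in> tangent_space A q" by (rule lie_bracket_tangent[OF openin_points q X Y(1)])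
  show "X q (c 0) *\<^sub>R Z 0 q + X q (c 1) *\<^sub>R Z 1 q + X q (c 2) *\<^sub>R Z 2 q \<in> tangent_space A q"
    by (intro tangent_closed q tZ) auto
  fix a assume a: "smooth_near A q a"
  have sZ: "smooth_near A q (\<lambda>p. Z i p a)" if "i \<in> {0,1,2::nat}" for i :: nat
    by (rule smooth_near_field[OF openin_points Z(1)[OF that] q a])
  have com: "X q (\<lambda>p. Z i p a) = Z i q (\<lambda>p. X p a)" if "i \<in> {0,1,2::nat}" for i :: nat
    using fun_cong[OF Z(2)[OF that], of a] a by (simp add: lie_bracket_def)
  have prod: "X q (\<lambda>p. c i p * Z i p a) = c i q * Z i q (\<lambda>p. X p a) + X q (c i) * Z i q a" if "i \<in> {0,1,2::nat}" for i :: nat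
    using tangent_mult[OF tX c[OF that] sZ[OF that]] com[OF that] by simp
  have sp: "smooth_near A q (\<lambda>p. c i p * Z i p a)" if "i \<in> {0,1,2::nat}" for i :: nat
    by (rule smooth_near_mult[OF c[OF that] sZ[OF that]])
  have "X q (\<lambda>p. Y p a) = X q (\<lambda>p. c 0 p * Z 0 p a + c 1 p * Z 1 p a + c 2 p * Z 2 p a)"
    by (rule tangent_cong[OF tX openin_points q]) (use Y(2) in \<open>simp add: scaleR_fun_def\<close>)
  also have "\<dots> = X q (\<lambda>p. c 0 p * Z 0 p a) + X q (\<lambda>p. c 1 p * Z 1 p a) + X q (\<lambda>p. c 2 p * Z 2 p a)"
    by (subst tangent_add[OF tX smooth_near_add] tangent_add[OF tX], auto intro: sp)+
  finally show "lie_bracket A X Y q a = (X q (c 0) *\<^sub>R Z 0 q + X q (c 1) *\<^sub>R Z 1 q + X q (c 2) *\<^sub>R Z 2 q) a"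
    using Y(2)[OF q] a prod[of 0] prod[of 1] prod[of 2] by (simp add: lie_bracket_def scaleR_fun_def)
qed

locale smooth_atlas3 = smooth_atlas A for A :: "('m, real ^ 3) chart set"
begin

lemma vec_comp_comb: "vec_comp c (r *\<^sub>R x + s *\<^sub>R y + t *\<^sub>R z) = r *\<^sub>R vec_comp c x + s *\<^sub>R vec_comp c y + t *\<^sub>R vec_comp c z"
  by (simp add: vec_comp_linear)

context
  fixes X assumes X: "spanning_fields A X"
begin

lemma spanning_field: "i \<in> {0,1,2} \<Longrightarrow> vector_field A (X i)"
  using X unfolding spanning_fields_def by blast

lemma spanning_det:
  assumes c: "c \<in> A" "q \<in> fst c"
  shows "det3 (vec_comp c (X 0 q)) (vec_comp c (X 1 q)) (vec_comp c (X 2 q)) \<noteq> 0"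
proof (rule det3_nonzero)
  fix v
  obtain r s t where "coord_vec A c q v = r *\<^sub>R X 0 q + s *\<^sub>R X 1 q + t *\<^sub>R X 2 q"
    using X coord_vec_tangent[OF c] chart_points[OF c] unfolding spanning_fields_def by blast
  then have "v = r *\<^sub>R vec_comp c (X 0 q) + s *\<^sub>R vec_comp c (X 1 q) + t *\<^sub>R vec_comp c (X 2 q)"
    using vec_comp_coord_vec[OF c, of v] by (simp add: vec_comp_comb)
  then show "\<exists>r s t. v = r *\<^sub>R vec_comp c (X 0 q) + s *\<^sub>R vec_comp c (X 1 q) + t *\<^sub>R vec_comp c (X 2 q)" by blast
qed

lemma spanning_coefficients_det:
  assumes c: "c \<in> A" "q \<in> fst c" and v: "v = r *\<^sub>R X 0 q + s *\<^sub>R X 1 q + t *\<^sub>R X 2 q"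
  defines "D \<equiv> det3 (vec_comp c (X 0 q)) (vec_comp c (X 1 q)) (vec_comp c (X 2 q))"
  shows "r = det3 (vec_comp c v) (vec_comp c (X 1 q)) (vec_comp c (X 2 q)) * inverse D"
    and "s = det3 (vec_comp c (X 0 q)) (vec_comp c v) (vec_comp c (X 2 q)) * inverse D"
    and "t = det3 (vec_comp c (X 0 q)) (vec_comp c (X 1 q)) (vec_comp c v) * inverse D"
  using spanning_det[OF c] by (simp_all add: v vec_comp_comb det3_comb D_def)

lemma spanning_unique:
  assumes q: "q \<in> points A"
    and e: "r *\<^sub>R X 0 q + s *\<^sub>R X 1 q + t *\<^sub>R X 2 q = r' *\<^sub>R X 0 q + s' *\<^sub>R X 1 q + t' *\<^sub>R X 2 q"
  shows "r = r' \<and> s = s' \<and> t = t'"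
proof -
  obtain c where c: "c \<in> A" "q \<in> fst c" using q points_chartE by metis
  note 1 = spanning_coefficients_det[OF c refl, where r=r and s=s and t=t] and 2 = spanning_coefficients_det[OF c e, symmetric]
  show ?thesis using trans[OF 1(1) 2(1)] trans[OF 1(2) 2(2)] trans[OF 1(3) 2(3)] by blast
qed

text \<open>Smoothness of the coefficients is Cramer's rule in a chart.\<close>
lemma spanning_coefficients:
  assumes Y: "vector_field A Y"
  shows "\<exists>c. (\<forall>i\<in>{0,1,2::nat}. \<forall>q\<in>points A. smooth_near A q (c i)) \<and>
    (\<forall>q\<in>points A. Y q = c 0 q *\<^sub>R X 0 q + c 1 q *\<^sub>R X 1 q + c 2 q *\<^sub>R X 2 q)"
proof -
  have "\<forall>q\<in>points A. \<exists>r s t. Y q = r *\<^sub>R X 0 q + s *\<^sub>R X 1 q + t *\<^sub>R X 2 q"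
    using X field_tangent[OF Y] unfolding spanning_fields_def by blast
  then obtain c0 c1 c2 where c: "\<And>q. q \<in> points A \<Longrightarrow> Y q = c0 q *\<^sub>R X 0 q + c1 q *\<^sub>R X 1 q + c2 q *\<^sub>R X 2 q"
    by metis
  have sm: "smooth_near A q c0 \<and> smooth_near A q c1 \<and> smooth_near A q c2" if q: "q \<in> points A" for q
  proof -
    obtain d where d: "d \<in> A" "q \<in> fst d" using q points_chartE by metis
    let ?S = "snd d ` fst d"
    let ?r = "field_rep d"
    have o: "open ?S" by (rule chart_open[OF d(1)])
    note r = field_rep_smooth_chart[OF _ d(1)]
    have rX: "smooth_on (?r (X 0)) ?S" "smooth_on (?r (X 1)) ?S" "smooth_on (?r (X 2)) ?S"
      by (auto intro!: r spanning_field)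
    have rq: "?r Z (snd d p) = vec_comp d (Z p)" if "p \<in> fst d" for Z p
      using d(1) that by (simp add: field_rep_def)
    have D: "smooth_on (\<lambda>x. inverse (det3 (?r (X 0) x) (?r (X 1) x) (?r (X 2) x))) ?S"
    proof (rule smooth_on_inverse[OF o smooth_on_det3[OF o rX]])
      fix x assume "x \<in> ?S"
      then obtain p where "p \<in> fst d" "x = snd d p" by auto
      then show "det3 (?r (X 0) x) (?r (X 1) x) (?r (X 2) x) \<noteq> 0" using spanning_det[OF d(1), of p] rq by simp
    qed
    note cr = spanning_coefficients_det[OF d(1) _ c[OF chart_points[OF d(1)]]]
    have "smooth_near A q c0"
      by (rule coord_vec_rep(1)[OF d o _ smooth_on_mult[OF o smooth_on_det3[OF o r[OF Y] rX(2,3)] D]])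
        (use d rq cr(1) in auto)
    moreover have "smooth_near A q c1"
      by (rule coord_vec_rep(1)[OF d o _ smooth_on_mult[OF o smooth_on_det3[OF o rX(1) r[OF Y] rX(3)] D]])
        (use d rq cr(2) in auto)
    moreover have "smooth_near A q c2"
      by (rule coord_vec_rep(1)[OF d o _ smooth_on_mult[OF o smooth_on_det3[OF o rX(1,2) r[OF Y]] D]])
        (use d rq cr(3) in auto)
    ultimately show ?thesis by blast
  qed
  show ?thesis
    by (rule exI[of _ "\<lambda>i. if i = 0 then c0 else if i = 1 then c1 else c2"]) (use sm c in auto)
qed

lemma dual_covector:
  assumes q: "q \<in> points A"
  shows "\<exists>\<mu>\<in>cotangent_space A q. \<mu> (X 0 q) = t0 \<and> \<mu> (X 1 q) = t1 \<and> \<mu> (X 2 q) = t2"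
proof -
  obtain c where c: "c \<in> A" "q \<in> fst c" using q points_chartE by metis
  let ?x = "\<lambda>i. vec_comp c (X i q)"
  let ?D = "det3 (?x 0) (?x 1) (?x 2)"
  let ?g = "\<lambda>w. (t0 * det3 w (?x 1) (?x 2) + t1 * det3 (?x 0) w (?x 2) + t2 * det3 (?x 0) (?x 1) w) / ?D"
  have lin: "linear ?g" by (rule linearI) (simp_all add: det3_def algebra_simps add_divide_distrib diff_divide_distrib)
  let ?y = "\<Sum>b\<in>Basis. ?g b *\<^sub>R b"
  let ?l = "coord_covec A c q ?y"
  have l: "?l \<in> cotangent_bundle A" by (rule coord_covec_bundle[OF c])
  have tX: "X i q \<in> tangent_space A q" if "i \<in> {0,1,2}" for i by (rule field_tangent[OF spanning_field[OF that] q])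
  have val: "snd ?l (X i q) = ?g (?x i)" if "i \<in> {0,1,2}" for i
    using tX[OF that] riesz_sum[OF lin, of "?x i"] by (simp add: coord_covec_def)
  have d0: "det3 x x z = 0" "det3 x y x = 0" "det3 y x x = 0" for x y z
    by (simp_all add: det3_def algebra_simps)
  have "snd ?l (X 0 q) = t0" "snd ?l (X 1 q) = t1" "snd ?l (X 2 q) = t2"
    using spanning_det[OF c] val[of 0] val[of 1] val[of 2] by (simp_all del: One_nat_def add: d0)
  then show ?thesis using l unfolding bundle_covector by auto
qed

end

end

section \<open>The Poisson algebra of the integrals\<close>

lemma three_indices: "0 \<in> {0, 1, 2 :: nat}" "1 \<in> {0, 1, 2 :: nat}" "2 \<in> {0, 1, 2 :: nat}"
  by auto

locale unimodular_frame = smooth_group G A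
  for G :: "('g, 'x) monoid_scheme" (structure) and A :: "('g, real ^ 3) chart set" +
  fixes f :: "nat \<Rightarrow> 'g vfield" and chi \<kappa> :: real
  assumes connected: "connected_space (mtop A)"
    and frame: "is_frame A {0, 1, 2} f"
    and left_invariant: "\<forall>i\<in>{0, 1, 2}. left_invariant_field G A (f i)"
    and bracket21: "\<forall>q\<in>carrier G. lie_bracket A (f 2) (f 1) q = f 0 q"
    and bracket10: "\<forall>q\<in>carrier G. lie_bracket A (f 1) (f 0) q = (chi + \<kappa>) *\<^sub>R f 2 q"
    and bracket20: "\<forall>q\<in>carrier G. lie_bracket A (f 2) (f 0) q = (chi - \<kappa>) *\<^sub>R f 1 q"

sublocale unimodular_frame \<subseteq> smooth_atlas3 A
  by unfold_locales

context unimodular_frame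
begin

interpretation T: smooth_atlas TA
  by (rule cot_smooth_atlas)

abbreviation e :: "nat \<Rightarrow> 'g vfield" where "e \<equiv> (\<lambda>i. i_push (f i))"
abbreviation h :: "nat \<Rightarrow> 'g covec \<Rightarrow> real" where "h \<equiv> (\<lambda>i. pairing (f i))"
abbreviation g :: "nat \<Rightarrow> 'g covec \<Rightarrow> real" where "g \<equiv> (\<lambda>i. pairing (e i))"
abbreviation PB where "PB \<equiv> poisson TA \<omega>"

text \<open>The quadratic Casimir polynomial of the Lie algebra, evaluated on left momenta (\<open>k = h\<close>) or on right
  momenta (\<open>k = g\<close>).\<close>
definition casimir :: "(nat \<Rightarrow> 'g covec \<Rightarrow> real) \<Rightarrow> 'g covec \<Rightarrow> real" where
  "casimir k = (\<lambda>l. 2 * ((k 0 l)\<^sup>2 + (\<kappa> - chi) * (k 1 l)\<^sup>2 + (\<kappa> + chi) * (k 2 l)\<^sup>2))"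

definition energy :: "'g covec \<Rightarrow> real" where
  "energy = (\<lambda>l. 1 / 2 * ((h 1 l)\<^sup>2 + (h 2 l)\<^sup>2))"

definition second_integral :: "'g covec \<Rightarrow> real" where
  "second_integral = (\<lambda>l. 2 * (h 0 l)\<^sup>2 - 2 * chi * ((h 1 l)\<^sup>2 - (h 2 l)\<^sup>2))"

lemma f_left: "i \<in> {0,1,2} \<Longrightarrow> left_invariant_field G A (f i)"
  using left_invariant by blast

lemma f_field: "i \<in> {0,1,2} \<Longrightarrow> vector_field A (f i)"
  by (rule left_invariant_field_field[OF f_left])

lemma e_field: "i \<in> {0,1,2} \<Longrightarrow> vector_field A (e i)"
  by (rule i_push_field[OF f_field])

lemma f_spanning: "spanning_fields A f"
  by (rule frame_spanning[OF frame])

text \<open>The inversion is an involution, so a tangent vector at \<open>q\<close> is the image of one at \<open>inv q\<close>, which the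
  \<open>f i\<close> span.\<close>
lemma e_spanning: "spanning_fields A e"
  unfolding spanning_fields_def
proof (intro conjI ballI)
  show "i \<in> {0,1,2} \<Longrightarrow> vector_field A (e i)" for i by (rule e_field)
  fix q v assume q: "q \<in> points A" and v: "v \<in> tangent_space A q"
  have "push A (m_inv G) q v \<in> tangent_space A (inv q)"
    by (rule push_tangent[OF smooth_atlas_axioms smooth_atlas_axioms inv_smooth q v])
  then obtain r s t where "push A (m_inv G) q v = r *\<^sub>R f 0 (inv q) + s *\<^sub>R f 1 (inv q) + t *\<^sub>R f 2 (inv q)"
    using f_spanning q unfolding spanning_fields_def by (meson inv_points(1))
  then have "push A (m_inv G) (inv q) (push A (m_inv G) q v) = r *\<^sub>R e 0 q + s *\<^sub>R e 1 q + t *\<^sub>R e 2 q"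
    by (simp only: push_linear inversion_push_def)
  then show "\<exists>r s t. v = r *\<^sub>R e 0 q + s *\<^sub>R e 1 q + t *\<^sub>R e 2 q"
    using i_push_i_push[OF v q] by auto
qed

lemma lie_bracket_antisym: "lie_bracket A X Y q = (-1) *\<^sub>R lie_bracket A Y X q"
  by (auto simp: lie_bracket_def fun_eq_iff scaleR_fun_def)

text \<open>All nine brackets are written as a multiple of one field, also where they vanish, so that each fits
  the hypothesis of \<open>pairing_bracket\<close>.\<close>
lemma f_brackets:
  assumes "q \<in> points A"
  shows "lie_bracket A (f 0) (f 0) q = 0 *\<^sub>R f 0 q" "lie_bracket A (f 1) (f 1) q = 0 *\<^sub>R f 0 q"
    "lie_bracket A (f 2) (f 2) q = 0 *\<^sub>R f 0 q"
    "lie_bracket A (f 2) (f 1) q = 1 *\<^sub>R f 0 q" "lie_bracket A (f 1) (f 2) q = (-1) *\<^sub>R f 0 q"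
    "lie_bracket A (f 1) (f 0) q = (chi + \<kappa>) *\<^sub>R f 2 q" "lie_bracket A (f 0) (f 1) q = (- (chi + \<kappa>)) *\<^sub>R f 2 q"
    "lie_bracket A (f 2) (f 0) q = (chi - \<kappa>) *\<^sub>R f 1 q" "lie_bracket A (f 0) (f 2) q = (- (chi - \<kappa>)) *\<^sub>R f 1 q"
proof -
  have diag: "lie_bracket A X X q = 0 *\<^sub>R Y" for X Y
    by (auto simp: lie_bracket_def fun_eq_iff scaleR_fun_def)
  show "lie_bracket A (f 0) (f 0) q = 0 *\<^sub>R f 0 q" "lie_bracket A (f 1) (f 1) q = 0 *\<^sub>R f 0 q"
    "lie_bracket A (f 2) (f 2) q = 0 *\<^sub>R f 0 q" by (rule diag)+
  have q: "q \<in> carrier G" using assms carrier_points by simp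
  show 1: "lie_bracket A (f 2) (f 1) q = 1 *\<^sub>R f 0 q" using bracket21 q by simp
  show 2: "lie_bracket A (f 1) (f 0) q = (chi + \<kappa>) *\<^sub>R f 2 q" using bracket10 q by simp
  show 3: "lie_bracket A (f 2) (f 0) q = (chi - \<kappa>) *\<^sub>R f 1 q" using bracket20 q by simp
  show "lie_bracket A (f 1) (f 2) q = (-1) *\<^sub>R f 0 q" unfolding lie_bracket_antisym[of "f 1"] 1 by simp
  show "lie_bracket A (f 0) (f 1) q = (- (chi + \<kappa>)) *\<^sub>R f 2 q"
    unfolding lie_bracket_antisym[of "f 0" "f 1"] 2 by (simp only: scaleR_scaleR mult_minus1)
  show "lie_bracket A (f 0) (f 2) q = (- (chi - \<kappa>)) *\<^sub>R f 1 q"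
    unfolding lie_bracket_antisym[of "f 0" "f 2"] 3 by (simp only: scaleR_scaleR mult_minus1)
qed

lemma f_e_bracket: "i \<in> {0,1,2} \<Longrightarrow> j \<in> {0,1,2} \<Longrightarrow> q \<in> points A \<Longrightarrow> lie_bracket A (f i) (e j) q = 0"
  by (rule lie_bracket_left_right[OF f_left f_left])

lemma pairing_bracket:
  assumes l: "l \<in> cotangent_bundle A" and X: "vector_field A X" "vector_field A Y" "vector_field A Z"
    and b: "\<And>q. q \<in> points A \<Longrightarrow> lie_bracket A X Y q = r *\<^sub>R Z q"
  shows "PB (pairing X) (pairing Y) l = r * pairing Z l"
proof -
  have q: "fst l \<in> points A" and m: "snd l \<in> cotangent_space A (fst l)" using l by (auto simp: bundle_covector)
  show ?thesis
    unfolding poisson_pairing[OF X(1,2) l] b[OF q] pairing_def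
    by (rule covector_scaleR[OF m field_tangent[OF X(3) q]])
qed

text \<open>The fields \<open>X i\<close> satisfy every bracket relation \<open>[f i, f j] = r f k\<close> that the frame \<open>f\<close> satisfies.\<close>
definition structure_fields :: "(nat \<Rightarrow> 'g vfield) \<Rightarrow> bool" where
  "structure_fields X \<longleftrightarrow> (\<forall>i\<in>{0,1,2}. vector_field A (X i)) \<and>
     (\<forall>i\<in>{0,1,2}. \<forall>j\<in>{0,1,2}. \<forall>k\<in>{0,1,2}. \<forall>r. (\<forall>q\<in>points A. lie_bracket A (f i) (f j) q = r *\<^sub>R f k q) \<longrightarrow>
        (\<forall>q\<in>points A. lie_bracket A (X i) (X j) q = r *\<^sub>R X k q))"

lemma f_structure: "structure_fields f"
  unfolding structure_fields_def using f_field by blast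

text \<open>Push-forward by the inversion preserves brackets.\<close>
lemma e_structure: "structure_fields e"
  unfolding structure_fields_def
proof (intro conjI ballI allI impI)
  show "i \<in> {0,1,2} \<Longrightarrow> vector_field A (e i)" for i by (rule e_field)
  fix i j k r q assume ijk: "i \<in> {0,1,2}" "j \<in> {0,1,2}" "k \<in> {0,1,2}"
    and b: "\<forall>q\<in>points A. lie_bracket A (f i) (f j) q = r *\<^sub>R f k q" and q: "q \<in> points A"
  show "lie_bracket A (e i) (e j) q = r *\<^sub>R e k q"
    unfolding lie_bracket_i_push[OF f_field[OF ijk(1)] f_field[OF ijk(2)] q] inversion_push_def
    using b q by (simp add: push_linear)
qed

context
  fixes l assumes l: "l \<in> cotangent_bundle A"
begin

lemma h_smooth: "i \<in> {0,1,2} \<Longrightarrow> smooth_near TA l (h i)"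
  by (rule pairing_smooth[OF f_field l])

lemma g_smooth: "i \<in> {0,1,2} \<Longrightarrow> smooth_near TA l (g i)"
  by (rule pairing_smooth[OF e_field l])

lemma PB_h_g: "i \<in> {0,1,2} \<Longrightarrow> j \<in> {0,1,2} \<Longrightarrow> PB (h i) (g j) l = 0"
  using pairing_bracket[OF l f_field e_field f_field, of i j 0 0] f_e_bracket by simp

lemma PB_g_h: "i \<in> {0,1,2} \<Longrightarrow> j \<in> {0,1,2} \<Longrightarrow> PB (g i) (h j) l = 0"
  using poisson_antisym[OF l g_smooth h_smooth] PB_h_g by simp

lemma structure_brackets:
  assumes X: "structure_fields X"
  shows "PB (pairing (X 0)) (pairing (X 0)) l = 0" "PB (pairing (X 1)) (pairing (X 1)) l = 0" "PB (pairing (X 2)) (pairing (X 2)) l = 0"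
    "PB (pairing (X 2)) (pairing (X 1)) l = pairing (X 0) l" "PB (pairing (X 1)) (pairing (X 2)) l = - pairing (X 0) l"
    "PB (pairing (X 1)) (pairing (X 0)) l = (chi + \<kappa>) * pairing (X 2) l" "PB (pairing (X 0)) (pairing (X 1)) l = - (chi + \<kappa>) * pairing (X 2) l"
    "PB (pairing (X 2)) (pairing (X 0)) l = (chi - \<kappa>) * pairing (X 1) l" "PB (pairing (X 0)) (pairing (X 2)) l = - (chi - \<kappa>) * pairing (X 1) l"
proof -
  note i = three_indices
  have pb: "PB (pairing (X i)) (pairing (X j)) l = r * pairing (X n) l"
    if ijn: "i \<in> {0,1,2}" "j \<in> {0,1,2}" "n \<in> {0,1,2}"
      and b: "\<And>q. q \<in> points A \<Longrightarrow> lie_bracket A (f i) (f j) q = r *\<^sub>R f n q" for i j n r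
  proof (rule pairing_bracket[OF l])
    show "vector_field A (X i)" "vector_field A (X j)" "vector_field A (X n)"
      using X ijn unfolding structure_fields_def by blast+
    have "\<forall>q\<in>points A. lie_bracket A (X i) (X j) q = r *\<^sub>R X n q"
      using X ijn ballI[OF b] unfolding structure_fields_def by meson
    then show "q \<in> points A \<Longrightarrow> lie_bracket A (X i) (X j) q = r *\<^sub>R X n q" for q by blast
  qed
  show "PB (pairing (X 0)) (pairing (X 0)) l = 0" using pb[OF i(1) i(1) i(1) f_brackets(1)] by simp
  show "PB (pairing (X 1)) (pairing (X 1)) l = 0" using pb[OF i(2) i(2) i(1) f_brackets(2)] by simp
  show "PB (pairing (X 2)) (pairing (X 2)) l = 0" using pb[OF i(3) i(3) i(1) f_brackets(3)] by simp
  show "PB (pairing (X 2)) (pairing (X 1)) l = pairing (X 0) l" using pb[OF i(3) i(2) i(1) f_brackets(4)] by simp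
  show "PB (pairing (X 1)) (pairing (X 2)) l = - pairing (X 0) l" using pb[OF i(2) i(3) i(1) f_brackets(5)] by simp
  show "PB (pairing (X 1)) (pairing (X 0)) l = (chi + \<kappa>) * pairing (X 2) l" by (rule pb[OF i(2) i(1) i(3) f_brackets(6)])
  show "PB (pairing (X 0)) (pairing (X 1)) l = - (chi + \<kappa>) * pairing (X 2) l" by (rule pb[OF i(1) i(2) i(3) f_brackets(7)])
  show "PB (pairing (X 2)) (pairing (X 0)) l = (chi - \<kappa>) * pairing (X 1) l" by (rule pb[OF i(3) i(1) i(2) f_brackets(8)])
  show "PB (pairing (X 0)) (pairing (X 2)) l = - (chi - \<kappa>) * pairing (X 1) l" by (rule pb[OF i(1) i(3) i(2) f_brackets(9)])
qed

lemmas PB_h = structure_brackets[OF f_structure]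
lemmas PB_g = structure_brackets[OF e_structure]

lemma energy_quadratic: "energy = (\<lambda>l. 0 * (h 0 l)\<^sup>2 + 1 / 2 * (h 1 l)\<^sup>2 + 1 / 2 * (h 2 l)\<^sup>2)"
  by (simp add: energy_def algebra_simps)

lemma second_integral_quadratic: "second_integral = (\<lambda>l. 2 * (h 0 l)\<^sup>2 + (- 2 * chi) * (h 1 l)\<^sup>2 + 2 * chi * (h 2 l)\<^sup>2)"
  by (simp add: second_integral_def algebra_simps)

lemma casimir_quadratic: "casimir k = (\<lambda>l. 2 * (k 0 l)\<^sup>2 + (2 * (\<kappa> - chi)) * (k 1 l)\<^sup>2 + (2 * (\<kappa> + chi)) * (k 2 l)\<^sup>2)"
  by (simp add: casimir_def algebra_simps)

lemma energy_smooth: "smooth_near TA l energy"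
  unfolding energy_quadratic by (rule T.quadratic3(1)) (auto intro: h_smooth)

lemma second_integral_smooth: "smooth_near TA l second_integral"
  unfolding second_integral_quadratic by (rule T.quadratic3(1)) (auto intro: h_smooth)

lemma casimir_smooth: "(\<And>i. i \<in> {0,1,2} \<Longrightarrow> smooth_near TA l (k i)) \<Longrightarrow> smooth_near TA l (casimir k)"
  unfolding casimir_quadratic by (rule T.quadratic3(1)) auto

lemma derivative_energy: "v \<in> tangent_space TA l \<Longrightarrow> v energy = h 1 l * v (h 1) + h 2 l * v (h 2)"
  unfolding energy_quadratic by (subst T.quadratic3(2)) (auto intro: h_smooth)

lemma derivative_second_integral: "v \<in> tangent_space TA l \<Longrightarrow>
    v second_integral = 4 * h 0 l * v (h 0) - 4 * chi * (h 1 l * v (h 1) - h 2 l * v (h 2))"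
  unfolding second_integral_quadratic by (subst T.quadratic3(2)) (auto intro: h_smooth simp: algebra_simps)

lemma derivative_casimir: "v \<in> tangent_space TA l \<Longrightarrow> (\<And>i. i \<in> {0,1,2} \<Longrightarrow> smooth_near TA l (k i)) \<Longrightarrow>
    v (casimir k) = 4 * (k 0 l * v (k 0) + (\<kappa> - chi) * k 1 l * v (k 1) + (\<kappa> + chi) * k 2 l * v (k 2))"
  unfolding casimir_quadratic by (subst T.quadratic3(2)) (auto simp: algebra_simps)

lemma PB_tangent: "smooth_near TA l a \<Longrightarrow> ham_field TA \<omega> a l \<in> tangent_space TA l"
  by (rule ham_field_tangent[OF l])

lemma PB_casimir:
  assumes "smooth_near TA l a" "\<And>i. i \<in> {0,1,2} \<Longrightarrow> smooth_near TA l (k i)"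
  shows "PB a (casimir k) l = 4 * (k 0 l * PB a (k 0) l + (\<kappa> - chi) * k 1 l * PB a (k 1) l + (\<kappa> + chi) * k 2 l * PB a (k 2) l)"
  unfolding poisson_def by (rule derivative_casimir[OF PB_tangent]) (use assms in auto)

lemma PB_casimir_of_h:
  assumes "smooth_near TA l a"
  shows "PB a (casimir h) l = 4 * (h 0 l * PB a (h 0) l + (\<kappa> - chi) * h 1 l * PB a (h 1) l + (\<kappa> + chi) * h 2 l * PB a (h 2) l)"
  by (rule PB_casimir[OF assms h_smooth])

lemma PB_casimir_of_g:
  assumes "smooth_near TA l a"
  shows "PB a (casimir g) l = 4 * (g 0 l * PB a (g 0) l + (\<kappa> - chi) * g 1 l * PB a (g 1) l + (\<kappa> + chi) * g 2 l * PB a (g 2) l)"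
  by (rule PB_casimir[OF assms g_smooth])

lemma PB_energy:
  assumes "smooth_near TA l a"
  shows "PB a energy l = h 1 l * PB a (h 1) l + h 2 l * PB a (h 2) l"
  unfolding poisson_def by (rule derivative_energy[OF PB_tangent[OF assms]])

lemma PB_second_integral:
  assumes "smooth_near TA l a"
  shows "PB a second_integral l = 4 * h 0 l * PB a (h 0) l - 4 * chi * (h 1 l * PB a (h 1) l - h 2 l * PB a (h 2) l)"
  unfolding poisson_def by (rule derivative_second_integral[OF PB_tangent[OF assms]])

lemma PB_casimir_h: "i \<in> {0,1,2} \<Longrightarrow> PB (h i) (casimir h) l = 0"
  unfolding insert_iff empty_iff
  by (elim disjE; simp only: PB_casimir_of_h[OF h_smooth] PB_h insert_iff simp_thms) (simp_all add: algebra_simps)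

lemma PB_casimir_g: "i \<in> {0,1,2} \<Longrightarrow> PB (g i) (casimir g) l = 0"
  unfolding insert_iff empty_iff
  by (elim disjE; simp only: PB_casimir_of_g[OF g_smooth] PB_g insert_iff simp_thms) (simp_all add: algebra_simps)

lemma PB_h_casimir_g: "i \<in> {0,1,2} \<Longrightarrow> PB (h i) (casimir g) l = 0"
  by (simp add: PB_casimir_of_g[OF h_smooth] PB_h_g del: One_nat_def)

lemma PB_g_casimir_h: "i \<in> {0,1,2} \<Longrightarrow> PB (g i) (casimir h) l = 0"
  by (simp add: PB_casimir_of_h[OF g_smooth] PB_g_h del: One_nat_def)

lemma PB_g_energy: "i \<in> {0,1,2} \<Longrightarrow> PB (g i) energy l = 0"
  by (simp add: PB_energy[OF g_smooth] PB_g_h del: One_nat_def)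

lemma PB_g_second_integral: "i \<in> {0,1,2} \<Longrightarrow> PB (g i) second_integral l = 0"
  by (simp add: PB_second_integral[OF g_smooth] PB_g_h del: One_nat_def)

lemma PB_self: "smooth_near TA l a \<Longrightarrow> PB a a l = 0"
  using poisson_antisym[OF l, of a a] by simp

lemma PB_h_energy:
  "PB (h 0) energy l = - 2 * chi * (h 1 l * h 2 l)" "PB (h 1) energy l = - (h 0 l * h 2 l)"
  "PB (h 2) energy l = h 0 l * h 1 l"
  by (simp_all only: PB_energy[OF h_smooth] PB_h insert_iff simp_thms) (simp_all add: algebra_simps)

text \<open>Behind the cancellation is that \<open>second_integral\<close> is a Casimir minus a multiple of \<open>energy\<close>, and \<open>energy\<close>
  commutes with both.\<close>
lemma PB_energy_second_integral: "PB energy second_integral l = 0"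
proof -
  note I = three_indices
  note a = poisson_antisym[OF l energy_smooth h_smooth[OF I(1)]] poisson_antisym[OF l energy_smooth h_smooth[OF I(2)]]
    poisson_antisym[OF l energy_smooth h_smooth[OF I(3)]]
  show ?thesis unfolding PB_second_integral[OF energy_smooth] a PB_h_energy by (simp add: algebra_simps)
qed

end

lemma casimir_h: "4 * \<kappa> * energy l + second_integral l = casimir h l"
  by (simp add: energy_def second_integral_def casimir_def algebra_simps)

text \<open>Fix a covector and extend it to the right-invariant one-form \<open>\<lambda>\<close> with \<open>\<lambda>(e i) = \<eta>\<^sub>i\<close>; in the proof
  \<open>u j = \<lambda>(f j)\<close>. Because \<open>[f k, e i] = 0\<close>, the derivative of \<open>u j\<close> along \<open>f k\<close> is \<open>\<lambda>([f k, f j])\<close>, so the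
  Casimir polynomial in the \<open>u j\<close> has derivative zero. On the connected group it is constant, and at the
  unit \<open>u j = - \<eta>\<^sub>j\<close>.\<close>
lemma casimir_identity:
  assumes l: "l \<in> cotangent_bundle A"
  shows "casimir h l = casimir g l"
proof -
  let ?q = "fst l"
  note I = three_indices
  have q: "?q \<in> points A" and m: "snd l \<in> cotangent_space A ?q" using l by (auto simp: bundle_covector)
  have "\<forall>j\<in>{0,1,2}. \<exists>c. (\<forall>i\<in>{0,1,2::nat}. \<forall>q\<in>points A. smooth_near A q (c i)) \<and>
    (\<forall>q\<in>points A. f j q = c 0 q *\<^sub>R e 0 q + c 1 q *\<^sub>R e 1 q + c 2 q *\<^sub>R e 2 q)"
    using spanning_coefficients[OF e_spanning f_field] by blast
  from bchoice[OF this] obtain c :: "nat \<Rightarrow> nat \<Rightarrow> 'g \<Rightarrow> real" where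
    cc: "\<forall>j\<in>{0,1,2}. (\<forall>i\<in>{0,1,2::nat}. \<forall>q\<in>points A. smooth_near A q (c j i)) \<and>
      (\<forall>q\<in>points A. f j q = c j 0 q *\<^sub>R e 0 q + c j 1 q *\<^sub>R e 1 q + c j 2 q *\<^sub>R e 2 q)" ..
  have c: "\<And>i j q. i \<in> {0,1,2} \<Longrightarrow> j \<in> {0,1,2} \<Longrightarrow> q \<in> points A \<Longrightarrow> smooth_near A q (c j i)"
    "\<And>j q. j \<in> {0,1,2} \<Longrightarrow> q \<in> points A \<Longrightarrow> f j q = c j 0 q *\<^sub>R e 0 q + c j 1 q *\<^sub>R e 1 q + c j 2 q *\<^sub>R e 2 q"
    using bspec[OF cc] by (simp_all only: Ball_def)
  define \<eta> where "\<eta> i = g i l" for i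
  define u where "u j p = \<eta> 0 * c j 0 p + \<eta> 1 * c j 1 p + \<eta> 2 * c j 2 p" for j p
  have usm: "smooth_near A p (u j)" if "p \<in> points A" "j \<in> {0,1,2}" for p j
    unfolding u_def by (intro combination3(1) c(1) that I)
  have der: "f k p (u j) = r * u n p"
    if p: "p \<in> points A" and k: "k \<in> {0,1,2}" and j: "j \<in> {0,1,2}" and n: "n \<in> {0,1,2}"
      and b: "lie_bracket A (f k) (f j) p = r *\<^sub>R f n p" for k j n p r
  proof -
    have tk: "f k p \<in> tangent_space A p" by (rule field_tangent[OF f_field[OF k] p])
    have "lie_bracket A (f k) (f j) p = f k p (c j 0) *\<^sub>R e 0 p + f k p (c j 1) *\<^sub>R e 1 p + f k p (c j 2) *\<^sub>R e 2 p"
      by (rule bracket_of_combination[OF p f_field[OF k] e_field f_e_bracket[OF k _ p] c(1)[OF _ j p] f_field[OF j] c(2)[OF j]])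
    also have "lie_bracket A (f k) (f j) p
        = (r * c n 0 p) *\<^sub>R e 0 p + (r * c n 1 p) *\<^sub>R e 1 p + (r * c n 2 p) *\<^sub>R e 2 p"
      unfolding b c(2)[OF n p] by (simp add: scaleR_add_right)
    finally have "f k p (c j 0) = r * c n 0 p" "f k p (c j 1) = r * c n 1 p" "f k p (c j 2) = r * c n 2 p"
      using spanning_unique[OF e_spanning p] by metis+
    moreover have "f k p (u j) = \<eta> 0 * f k p (c j 0) + \<eta> 1 * f k p (c j 1) + \<eta> 2 * f k p (c j 2)"
      unfolding u_def by (rule combination3(2)[OF c(1)[OF I(1) j p] c(1)[OF I(2) j p] c(1)[OF I(3) j p] tk])
    ultimately show ?thesis by (simp add: u_def algebra_simps)
  qed
  \<comment> \<open>half the Casimir polynomial; the factor \<open>1\<close> matches \<open>quadratic3\<close>\<close>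
  define D where "D p = 1 * (u 0 p)\<^sup>2 + (\<kappa> - chi) * (u 1 p)\<^sup>2 + (\<kappa> + chi) * (u 2 p)\<^sup>2" for p
  have Dsm: "smooth_near A p D" if "p \<in> points A" for p
    unfolding D_def by (intro quadratic3(1) usm that I)
  have dD: "v D = 2 * (1 * u 0 p * v (u 0) + (\<kappa> - chi) * u 1 p * v (u 1) + (\<kappa> + chi) * u 2 p * v (u 2))"
    if p: "p \<in> points A" and v: "v \<in> tangent_space A p" for v p
    unfolding D_def by (rule quadratic3(2)[OF usm[OF p I(1)] usm[OF p I(2)] usm[OF p I(3)] v])
  have fD: "f k p D = 0" if p: "p \<in> points A" and k: "k \<in> {0,1,2}" for k p
  proof -
    note b = f_brackets[OF p]
    note d = der[OF p I(1) I(1) I(1) b(1)] der[OF p I(2) I(2) I(1) b(2)] der[OF p I(3) I(3) I(1) b(3)]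
      der[OF p I(3) I(2) I(1) b(4)] der[OF p I(2) I(3) I(1) b(5)] der[OF p I(2) I(1) I(3) b(6)]
      der[OF p I(1) I(2) I(3) b(7)] der[OF p I(3) I(1) I(2) b(8)] der[OF p I(1) I(3) I(2) b(9)]
    have "f 0 p D = 0" unfolding dD[OF p field_tangent[OF f_field[OF I(1)] p]] d by (simp add: algebra_simps)
    moreover have "f 1 p D = 0" unfolding dD[OF p field_tangent[OF f_field[OF I(2)] p]] d by (simp add: algebra_simps)
    moreover have "f 2 p D = 0" unfolding dD[OF p field_tangent[OF f_field[OF I(3)] p]] d by (simp add: algebra_simps)
    ultimately show ?thesis using k by blast
  qed
  have vD: "v D = 0" if p: "p \<in> points A" and v: "v \<in> tangent_space A p" for v p
  proof -
    obtain r s t where "v = r *\<^sub>R f 0 p + s *\<^sub>R f 1 p + t *\<^sub>R f 2 p"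
      using f_spanning p v unfolding spanning_fields_def by blast
    then show ?thesis using fD[OF p I(1)] fD[OF p I(2)] fD[OF p I(3)] by (simp add: scaleR_fun_def)
  qed
  have "D ?q = D \<one>"
  proof (rule constant_if_derivatives_vanish[OF connected _ _ q one_points])
    show "smooth_near A p D" if "p \<in> points A" for p by (rule Dsm[OF that])
    show "v D = 0" if "p \<in> points A" "v \<in> tangent_space A p" for p v by (rule vD[OF that])
  qed
  moreover have "u j ?q = h j l" if j: "j \<in> {0,1,2}" for j
  proof -
    have t: "e i ?q \<in> tangent_space A ?q" if "i \<in> {0,1,2}" for i by (rule field_tangent[OF e_field[OF that] q])
    show ?thesis
      unfolding pairing_def[of "f j"] c(2)[OF j q] covector_combination[OF q m t[OF I(1)] t[OF I(2)] t[OF I(3)]]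
      by (simp add: u_def \<eta>_def pairing_def mult.commute)
  qed
  moreover have "u j \<one> = - \<eta> j" if j: "j \<in> {0,1,2}" for j
  proof -
    have fe: "f j \<one> = (-1) *\<^sub>R e j \<one>"
      unfolding i_push_one[OF f_left[OF j]] by simp
    have "c j 0 \<one> *\<^sub>R e 0 \<one> + c j 1 \<one> *\<^sub>R e 1 \<one> + c j 2 \<one> *\<^sub>R e 2 \<one>
      = (if j = 0 then -1 else 0) *\<^sub>R e 0 \<one> + (if j = 1 then -1 else 0) *\<^sub>R e 1 \<one> + (if j = 2 then -1 else 0) *\<^sub>R e 2 \<one>"
      unfolding c(2)[OF j one_points, symmetric] fe using j by auto
    from spanning_unique[OF e_spanning one_points this] show ?thesis using j by (auto simp: u_def)
  qed
  ultimately show ?thesis by (simp add: D_def casimir_def \<eta>_def)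
qed

end

section \<open>Independence and integrability\<close>

text \<open>The linear form \<open>\<beta>\<close> is a component of the cross product of \<open>(x, (\<kappa> - chi) y, (\<kappa> + chi) z)\<close> with \<open>\<alpha>\<close>;
  where it does not vanish, the two vectors are linearly independent. The hypothesis on \<open>\<alpha>\<close> makes one of
  two components a nonzero form: \<open>\<kappa> - chi\<close> and \<open>\<kappa> + chi\<close> cannot both vanish if \<open>chi \<noteq> 0\<close>.\<close>
lemma cross_component:
  fixes \<alpha>0 \<alpha>1 \<alpha>2 chi \<kappa> :: real
  assumes "(chi \<noteq> 0 \<and> (\<alpha>0, \<alpha>1, \<alpha>2) \<noteq> (0, 0, 0)) \<or> \<alpha>1\<^sup>2 + \<alpha>2\<^sup>2 \<noteq> 0"
  obtains \<beta>0 \<beta>1 \<beta>2 where "\<not> (\<beta>0 = 0 \<and> \<beta>1 = 0 \<and> \<beta>2 = 0)"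
    "\<And>x y z a b. \<beta>0 * x + \<beta>1 * y + \<beta>2 * z \<noteq> 0 \<Longrightarrow> a * x + b * \<alpha>0 = 0 \<Longrightarrow>
       a * ((\<kappa> - chi) * y) + b * \<alpha>1 = 0 \<Longrightarrow> a * ((\<kappa> + chi) * z) + b * \<alpha>2 = 0 \<Longrightarrow> a = 0 \<and> b = 0"
proof -
  have nz: "\<alpha>0 \<noteq> 0 \<or> \<alpha>1 \<noteq> 0 \<or> \<alpha>2 \<noteq> 0" using assms by auto
  have b0: "b = 0" if "a = 0" "a * x + b * \<alpha>0 = 0" "a * y + b * \<alpha>1 = 0" "a * z + b * \<alpha>2 = 0" for a b x y z
    using that nz by auto
  have cross: "a * (\<alpha>1 * x - \<alpha>0 * y) = 0" "a * (\<alpha>0 * z - \<alpha>2 * x) = 0"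
    if "a * x + b * \<alpha>0 = 0" "a * y + b * \<alpha>1 = 0" "a * z + b * \<alpha>2 = 0" for a b x y z
  proof -
    have "a * (\<alpha>1 * x - \<alpha>0 * y) = \<alpha>1 * (a * x + b * \<alpha>0) - \<alpha>0 * (a * y + b * \<alpha>1)"
      "a * (\<alpha>0 * z - \<alpha>2 * x) = \<alpha>0 * (a * z + b * \<alpha>2) - \<alpha>2 * (a * x + b * \<alpha>0)" by (simp_all add: algebra_simps)
    then show "a * (\<alpha>1 * x - \<alpha>0 * y) = 0" "a * (\<alpha>0 * z - \<alpha>2 * x) = 0" using that by simp_all
  qed
  show ?thesis
  proof (cases "\<alpha>1 \<noteq> 0 \<or> (\<alpha>0 \<noteq> 0 \<and> \<kappa> \<noteq> chi)")
    case True
    show ?thesis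
    proof (rule that[of "\<alpha>1" "- (\<alpha>0 * (\<kappa> - chi))" 0])
      show "\<not> (\<alpha>1 = 0 \<and> - (\<alpha>0 * (\<kappa> - chi)) = 0 \<and> (0::real) = 0)" using True by auto
      fix x y z a b assume nz: "\<alpha>1 * x + - (\<alpha>0 * (\<kappa> - chi)) * y + 0 * z \<noteq> 0" and
        eq: "a * x + b * \<alpha>0 = 0" "a * ((\<kappa> - chi) * y) + b * \<alpha>1 = 0" "a * ((\<kappa> + chi) * z) + b * \<alpha>2 = 0"
      have "a * (\<alpha>1 * x - \<alpha>0 * ((\<kappa> - chi) * y)) = 0" by (rule cross(1)[OF eq])
      moreover have "\<alpha>1 * x - \<alpha>0 * ((\<kappa> - chi) * y) \<noteq> 0" using nz by (simp add: mult.assoc)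
      ultimately have "a = 0" by simp
      then show "a = 0 \<and> b = 0" using b0[OF _ eq] by blast
    qed
  next
    case False
    show ?thesis
    proof (rule that[of "- \<alpha>2" 0 "\<alpha>0 * (\<kappa> + chi)"])
      show "\<not> (- \<alpha>2 = 0 \<and> (0::real) = 0 \<and> \<alpha>0 * (\<kappa> + chi) = 0)" using False assms by auto
      fix x y z a b assume nz: "- \<alpha>2 * x + 0 * y + \<alpha>0 * (\<kappa> + chi) * z \<noteq> 0" and
        eq: "a * x + b * \<alpha>0 = 0" "a * ((\<kappa> - chi) * y) + b * \<alpha>1 = 0" "a * ((\<kappa> + chi) * z) + b * \<alpha>2 = 0"
      have "a * (\<alpha>0 * ((\<kappa> + chi) * z) - \<alpha>2 * x) = 0" by (rule cross(2)[OF eq])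
      moreover have "\<alpha>0 * ((\<kappa> + chi) * z) - \<alpha>2 * x \<noteq> 0" using nz by (simp add: mult.assoc)
      ultimately have "a = 0" by simp
      then show "a = 0 \<and> b = 0" using b0[OF _ eq] by blast
    qed
  qed
qed

lemma (in smooth_atlas) vector_field_combination:
  assumes X: "vector_field A X" and Y: "vector_field A Y"
  shows "vector_field A (\<lambda>q. r *\<^sub>R X q + s *\<^sub>R Y q)"
  unfolding vector_field_on_def
proof (intro conjI ballI allI impI)
  show "q \<in> points A \<Longrightarrow> r *\<^sub>R X q + s *\<^sub>R Y q \<in> tangent_space A q" for q
    by (intro tangent_closed field_tangent[OF X] field_tangent[OF Y])
  fix W a assume W: "openin (mtop A) W \<and> W \<subseteq> points A \<and> smooth_fun_on A W a"
  show "smooth_fun_on A W (\<lambda>q. (r *\<^sub>R X q + s *\<^sub>R Y q) a)"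
  proof (rule smooth_fun_onI)
    fix q assume q: "q \<in> W"
    have "smooth_near A q a" using q W smooth_near_fun_on by blast
    then have "smooth_near A q (\<lambda>p. X p a)" "smooth_near A q (\<lambda>p. Y p a)"
      using smooth_near_field[OF openin_points X] smooth_near_field[OF openin_points Y] q W by blast+
    then show "smooth_near A q (\<lambda>q. (r *\<^sub>R X q + s *\<^sub>R Y q) a)"
      by (simp add: scaleR_fun_def smooth_near_add smooth_near_cmult)
  qed (use W in blast)
qed

context unimodular_frame
begin

interpretation T: smooth_atlas TA
  by (rule cot_smooth_atlas)

lemma dense_triple:
  assumes "vector_field A X" "vector_field A Y" "vector_field A Z"
    and "\<And>q. q \<in> points A \<Longrightarrow> X q \<noteq> 0" "\<And>q. q \<in> points A \<Longrightarrow> Y q \<noteq> 0" "\<And>q. q \<in> points A \<Longrightarrow> Z q \<noteq> 0"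
  defines "S \<equiv> {l \<in> cotangent_bundle A. pairing X l \<noteq> 0 \<and> pairing Y l \<noteq> 0 \<and> pairing Z l \<noteq> 0}"
  shows "openin (mtop TA) S" and "mtop TA closure_of S = points TA"
proof -
  let ?S = "\<lambda>X. {l \<in> cotangent_bundle A. pairing X l \<noteq> 0}"
  note X = dense_pairing_nonzero[OF assms(1,4)] and Y = dense_pairing_nonzero[OF assms(2,5)]
    and Z = dense_pairing_nonzero[OF assms(3,6)]
  have S: "S = ?S X \<inter> (?S Y \<inter> ?S Z)" by (auto simp: S_def)
  have YZ: "mtop TA closure_of (?S Y \<inter> ?S Z) = cotangent_bundle A"
    using closure_of_openin_Int_closure_of[OF Y(1), of "?S Z"] Z(2) Y(2)
    by (simp add: Int_absorb2 Collect_conj_eq[symmetric])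
  show "openin (mtop TA) S" unfolding S using X(1) Y(1) Z(1) by blast
  have "?S X \<inter> cotangent_bundle A = ?S X" by blast
  then show "mtop TA closure_of S = points TA"
    using closure_of_openin_Int_closure_of[OF X(1), of "?S Y \<inter> ?S Z"] X(2)
    unfolding S YZ points_cot by simp
qed

lemma spanning_nonzero:
  assumes "spanning_fields A X" "q \<in> points A" "r *\<^sub>R X 0 q + s *\<^sub>R X 1 q + t *\<^sub>R X 2 q = 0"
  shows "r = 0 \<and> s = 0 \<and> t = 0"
  by (rule spanning_unique[OF assms(1,2)]) (use assms(3) in simp)

definition momentum :: "real \<Rightarrow> real \<Rightarrow> real \<Rightarrow> 'g covec \<Rightarrow> real" where
  "momentum \<alpha>0 \<alpha>1 \<alpha>2 = (\<lambda>l. \<alpha>0 * g 0 l + \<alpha>1 * g 1 l + \<alpha>2 * g 2 l)"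

lemma momentum_smooth: "l \<in> cotangent_bundle A \<Longrightarrow> smooth_near TA l (momentum \<alpha>0 \<alpha>1 \<alpha>2)"
  unfolding momentum_def by (rule T.combination3(1)) (auto intro: g_smooth)

lemma derivative_momentum: "l \<in> cotangent_bundle A \<Longrightarrow> v \<in> tangent_space TA l \<Longrightarrow>
    v (momentum \<alpha>0 \<alpha>1 \<alpha>2) = \<alpha>0 * v (g 0) + \<alpha>1 * v (g 1) + \<alpha>2 * v (g 2)"
  unfolding momentum_def by (rule T.combination3(2)) (auto intro: g_smooth)

lemma PB_momentum:
  assumes l: "l \<in> cotangent_bundle A" and a: "smooth_near TA l a" and g: "\<And>i. i \<in> {0,1,2} \<Longrightarrow> PB (g i) a l = 0"
  shows "PB a (momentum \<alpha>0 \<alpha>1 \<alpha>2) l = 0" "PB (momentum \<alpha>0 \<alpha>1 \<alpha>2) a l = 0"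
proof -
  have ag: "PB a (g i) l = 0" if "i \<in> {0,1,2}" for i
    using poisson_antisym[OF l a g_smooth[OF l that]] g[OF that] by simp
  show 1: "PB a (momentum \<alpha>0 \<alpha>1 \<alpha>2) l = 0"
    unfolding poisson_def derivative_momentum[OF l PB_tangent[OF l a]]
    using ag by (simp add: poisson_def)
  show "PB (momentum \<alpha>0 \<alpha>1 \<alpha>2) a l = 0"
    using poisson_antisym[OF l momentum_smooth[OF l] a] 1 by simp
qed

lemma involution:
  "in_involution TA \<omega> [energy, second_integral, momentum \<alpha>0 \<alpha>1 \<alpha>2]"
proof -
  have "PB a b l = 0" if l: "l \<in> cotangent_bundle A"
    and "a \<in> {energy, second_integral, momentum \<alpha>0 \<alpha>1 \<alpha>2}" "b \<in> {energy, second_integral, momentum \<alpha>0 \<alpha>1 \<alpha>2}" for a b l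
  proof -
    note s = energy_smooth[OF l] second_integral_smooth[OF l] momentum_smooth[OF l]
    have "PB energy (momentum \<alpha>0 \<alpha>1 \<alpha>2) l = 0" "PB (momentum \<alpha>0 \<alpha>1 \<alpha>2) energy l = 0"
      "PB second_integral (momentum \<alpha>0 \<alpha>1 \<alpha>2) l = 0" "PB (momentum \<alpha>0 \<alpha>1 \<alpha>2) second_integral l = 0"
      by (rule PB_momentum[OF l s(1) PB_g_energy[OF l]] PB_momentum[OF l s(2) PB_g_second_integral[OF l]]; assumption)+
    moreover have "PB second_integral energy l = 0"
      using poisson_antisym[OF l s(2,1)] PB_energy_second_integral[OF l] by simp
    ultimately show ?thesis
      using that(2,3) PB_energy_second_integral[OF l] PB_self[OF l s(1)] PB_self[OF l s(2)] PB_self[OF l s(3)] by auto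
  qed
  then show ?thesis unfolding in_involution_def points_cot by simp
qed

lemma integral_if_commutes:
  assumes "\<And>l. l \<in> cotangent_bundle A \<Longrightarrow> smooth_near TA l a" "\<And>l. l \<in> cotangent_bundle A \<Longrightarrow> PB energy a l = 0"
  shows "is_integral TA \<omega> energy a"
  unfolding is_integral_def points_cot
  using T.smooth_fun_onI[OF T.openin_points, of a] assms unfolding points_cot by blast

lemma integrals:
  "is_integral TA \<omega> energy energy" "is_integral TA \<omega> energy second_integral"
  "i \<in> {0,1,2} \<Longrightarrow> is_integral TA \<omega> energy (g i)" "is_integral TA \<omega> energy (momentum \<alpha>0 \<alpha>1 \<alpha>2)"
proof -
  show "is_integral TA \<omega> energy energy"
    by (rule integral_if_commutes[OF energy_smooth PB_self[OF _ energy_smooth]])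
  show "is_integral TA \<omega> energy second_integral"
    by (rule integral_if_commutes[OF second_integral_smooth PB_energy_second_integral])
  show "is_integral TA \<omega> energy (momentum \<alpha>0 \<alpha>1 \<alpha>2)"
    by (rule integral_if_commutes[OF momentum_smooth PB_momentum(1)[OF _ energy_smooth PB_g_energy]])
  show "is_integral TA \<omega> energy (g i)" if i: "i \<in> {0,1,2}"
  proof (rule integral_if_commutes[OF g_smooth[OF _ i]])
    show "PB energy (g i) l = 0" if l: "l \<in> cotangent_bundle A" for l
      using poisson_antisym[OF l energy_smooth[OF l] g_smooth[OF l i]] PB_g_energy[OF l i] by simp
  qed
qed

text \<open>This is the Casimir identity, differentiated: the left side is the derivative of the Casimir in the
  \<open>h i\<close>, the right side that of the Casimir in the \<open>g i\<close>.\<close>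
lemma derivative_casimir_eq:
  assumes l: "l \<in> cotangent_bundle A" and v: "v \<in> tangent_space TA l"
  shows "4 * \<kappa> * v energy + v second_integral
    = 4 * (g 0 l * v (g 0) + (\<kappa> - chi) * g 1 l * v (g 1) + (\<kappa> + chi) * g 2 l * v (g 2))"
proof -
  have "v (casimir g) = v (\<lambda>l. 4 * \<kappa> * energy l + second_integral l)"
    by (rule T.tangent_cong[OF v T.openin_points]) (use l casimir_identity casimir_h in \<open>auto simp: points_cot\<close>)
  also have "\<dots> = 4 * \<kappa> * v energy + v second_integral"
    using T.tangent_add[OF v T.smooth_near_cmult[OF energy_smooth[OF l]] second_integral_smooth[OF l]]
      T.tangent_cmult[OF v energy_smooth[OF l]] by simp
  finally show ?thesis using derivative_casimir[OF l v g_smooth[OF l]] by simp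
qed

lemma dependent: "functionally_dependent_on TA (cotangent_bundle A) [energy, second_integral, g 0, g 1, g 2]"
  unfolding functionally_dependent_on_def
proof
  fix l assume l: "l \<in> cotangent_bundle A"
  \<comment> \<open>the coefficients of \<open>derivative_casimir_eq\<close>; the second one is \<open>1\<close>\<close>
  let ?c = "\<lambda>i::nat. if i = 0 then 4 * \<kappa> else if i = 1 then 1 else if i = 2 then - 4 * g 0 l
    else if i = 3 then - 4 * (\<kappa> - chi) * g 1 l else - 4 * (\<kappa> + chi) * g 2 l"
  have five: "{..<5::nat} = {0, 1, 2, 3, 4}" by auto
  have "differentials_relation TA [energy, second_integral, g 0, g 1, g 2] l ?c"
    unfolding differentials_relation_def
  proof
    fix v assume v: "v \<in> tangent_space TA l"
    show "(\<Sum>i<length [energy, second_integral, g 0, g 1, g 2]. ?c i * v ([energy, second_integral, g 0, g 1, g 2] ! i)) = 0"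
      using derivative_casimir_eq[OF l v] by (simp add: five algebra_simps)
  qed
  moreover have "?c 1 \<noteq> 0" by simp
  ultimately show "\<exists>c. differentials_relation TA [energy, second_integral, g 0, g 1, g 2] l c \<and>
      (\<exists>i<length [energy, second_integral, g 0, g 1, g 2]. c i \<noteq> 0)"
    by (intro exI[of _ ?c] conjI exI[of _ 1]) auto
qed

text \<open>Applied to the Hamiltonian field of \<open>h 2\<close>, a relation between the three differentials has no \<open>g\<close>-term and
  determines the ratio of the first two coefficients. Vertical vectors, which take arbitrary values on
  the \<open>g i\<close>, then compare the coefficients of the \<open>dg i\<close>.\<close>
lemma independent_triple:
  assumes \<alpha>: "(chi \<noteq> 0 \<and> (\<alpha>0, \<alpha>1, \<alpha>2) \<noteq> (0, 0, 0)) \<or> \<alpha>1\<^sup>2 + \<alpha>2\<^sup>2 \<noteq> 0"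
  shows "independent_on_open_dense TA [energy, second_integral, momentum \<alpha>0 \<alpha>1 \<alpha>2]"
proof -
  note I = three_indices
  obtain \<beta>0 \<beta>1 \<beta>2 where \<beta>: "\<not> (\<beta>0 = 0 \<and> \<beta>1 = 0 \<and> \<beta>2 = 0)"
    and cross: "\<And>x y z a b. \<beta>0 * x + \<beta>1 * y + \<beta>2 * z \<noteq> 0 \<Longrightarrow> a * x + b * \<alpha>0 = 0 \<Longrightarrow>
       a * ((\<kappa> - chi) * y) + b * \<alpha>1 = 0 \<Longrightarrow> a * ((\<kappa> + chi) * z) + b * \<alpha>2 = 0 \<Longrightarrow> a = 0 \<and> b = 0"
    using cross_component[OF \<alpha>] by blast
  define Z where "Z q = \<beta>0 *\<^sub>R e 0 q + \<beta>1 *\<^sub>R e 1 q + \<beta>2 *\<^sub>R e 2 q" for q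
  have Z: "vector_field A Z"
    using vector_field_combination[OF vector_field_combination[OF e_field[OF I(1)] e_field[OF I(2)], of \<beta>0 \<beta>1] e_field[OF I(3)], of 1 \<beta>2]
    unfolding Z_def[abs_def] scaleR_one .
  have Znz: "Z q \<noteq> 0" if "q \<in> points A" for q
    using spanning_nonzero[OF e_spanning that] \<beta> unfolding Z_def by blast
  have fnz: "f 0 q \<noteq> 0" "f 1 q \<noteq> 0" if "q \<in> points A" for q
    using spanning_nonzero[OF f_spanning that, of 1 0 0] spanning_nonzero[OF f_spanning that, of 0 1 0] by auto
  let ?S = "{l \<in> cotangent_bundle A. pairing (f 0) l \<noteq> 0 \<and> pairing (f 1) l \<noteq> 0 \<and> pairing Z l \<noteq> 0}"
  note S = dense_triple[OF f_field[OF I(1)] f_field[OF I(2)] Z fnz Znz]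
  have "functionally_independent_on TA ?S [energy, second_integral, momentum \<alpha>0 \<alpha>1 \<alpha>2]"
    unfolding functionally_independent_on_def
  proof (intro ballI allI impI)
    fix l c i assume "l \<in> ?S" and rel: "differentials_relation TA [energy, second_integral, momentum \<alpha>0 \<alpha>1 \<alpha>2] l c"
      and i: "i < length [energy, second_integral, momentum \<alpha>0 \<alpha>1 \<alpha>2]"
    then have l: "l \<in> cotangent_bundle A" and h0: "h 0 l \<noteq> 0" and h1: "h 1 l \<noteq> 0" and hZ: "pairing Z l \<noteq> 0" by auto
    have q: "fst l \<in> points A" and m: "snd l \<in> cotangent_space A (fst l)" using l by (auto simp: bundle_covector)

    have rel': "c 0 * v energy + c 1 * v second_integral + c 2 * v (momentum \<alpha>0 \<alpha>1 \<alpha>2) = 0"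
      if "v \<in> tangent_space TA l" for v
      using rel that unfolding differentials_relation_def by (auto simp: numeral_2_eq_2 algebra_simps)
    have t2: "ham_field TA \<omega> (h 2) l \<in> tangent_space TA l" by (rule PB_tangent[OF l h_smooth[OF l I(3)]])
    have "c 0 * PB (h 2) energy l + c 1 * PB (h 2) second_integral l + c 2 * PB (h 2) (momentum \<alpha>0 \<alpha>1 \<alpha>2) l = 0"
      using rel'[OF t2] by (simp add: poisson_def)
    moreover have "PB (h 2) (momentum \<alpha>0 \<alpha>1 \<alpha>2) l = 0"
      by (rule PB_momentum(1)[OF l h_smooth[OF l I(3)] PB_g_h[OF l _ I(3)]])
    moreover have "PB (h 2) second_integral l = - 4 * \<kappa> * (h 0 l * h 1 l)"
      unfolding PB_second_integral[OF l h_smooth[OF l I(3)]] PB_h[OF l] by (simp add: algebra_simps)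
    ultimately have "(c 0 - 4 * \<kappa> * c 1) * (h 0 l * h 1 l) = 0"
      unfolding PB_h_energy[OF l] by (simp add: algebra_simps)
    then have c0: "c 0 = 4 * \<kappa> * c 1" using h0 h1 by simp
    have key: "4 * c 1 * (g 0 l * t0 + (\<kappa> - chi) * g 1 l * t1 + (\<kappa> + chi) * g 2 l * t2)
        + c 2 * (\<alpha>0 * t0 + \<alpha>1 * t1 + \<alpha>2 * t2) = 0" for t0 t1 t2
    proof -
      obtain \<mu> where \<mu>: "\<mu> \<in> cotangent_space A (fst l)" "\<mu> (e 0 (fst l)) = t0" "\<mu> (e 1 (fst l)) = t1" "\<mu> (e 2 (fst l)) = t2"
        using dual_covector[OF e_spanning q] by metis
      obtain v where v: "v \<in> tangent_space TA l" "\<And>X. vector_field A X \<Longrightarrow> v (pairing X) = \<mu> (X (fst l))"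
        using vertical_vector[OF l \<mu>(1)] by blast
      have vg: "v (g 0) = t0" "v (g 1) = t1" "v (g 2) = t2"
        using v(2)[OF e_field[OF I(1)]] v(2)[OF e_field[OF I(2)]] v(2)[OF e_field[OF I(3)]] \<mu> by simp_all
      have "c 1 * (4 * \<kappa> * v energy + v second_integral) + c 2 * v (momentum \<alpha>0 \<alpha>1 \<alpha>2) = 0"
        using rel'[OF v(1)] unfolding c0 by (simp add: algebra_simps)
      then show ?thesis
        unfolding derivative_casimir_eq[OF l v(1)] derivative_momentum[OF l v(1)] vg by (simp add: algebra_simps)
    qed
    have t: "e i (fst l) \<in> tangent_space A (fst l)" if "i \<in> {0,1,2}" for i by (rule field_tangent[OF e_field[OF that] q])
    have "pairing Z l = \<beta>0 * g 0 l + \<beta>1 * g 1 l + \<beta>2 * g 2 l"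
      unfolding pairing_def Z_def by (rule covector_combination[OF q m t[OF I(1)] t[OF I(2)] t[OF I(3)]])
    then have "\<beta>0 * g 0 l + \<beta>1 * g 1 l + \<beta>2 * g 2 l \<noteq> 0" using hZ by simp
    from cross[OF this, of "4 * c 1" "c 2"] have "4 * c 1 = 0 \<and> c 2 = 0"
      using key[of 1 0 0] key[of 0 1 0] key[of 0 0 1] by (simp add: mult.assoc)
    then have "c 0 = 0" "c 1 = 0" "c 2 = 0" using c0 by auto
    moreover have "i = 0 \<or> i = 1 \<or> i = 2" using i by auto
    ultimately show "c i = 0" by auto
  qed
  then show ?thesis unfolding independent_on_open_dense_def using S by blast
qed

text \<open>The momentum \<open>g 1\<close> is admissible whether or not \<open>chi\<close> vanishes.\<close>
lemma integrable: "liouville_integrable TA \<omega> energy"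
  unfolding liouville_integrable_def
proof (intro exI[of _ "[second_integral, momentum 0 1 0]"] conjI)
  show "2 * length [energy, second_integral, momentum 0 1 0] = DIM((real ^ 3) \<times> (real ^ 3))" by simp
  show "\<forall>a\<in>set [energy, second_integral, momentum 0 1 0]. smooth_fun TA a"
    using integrals unfolding is_integral_def by auto
  show "in_involution TA \<omega> [energy, second_integral, momentum 0 1 0]" by (rule involution)
  show "independent_on_open_dense TA [energy, second_integral, momentum 0 1 0]"
    by (rule independent_triple) simp
qed

end

theorem theorem1:
  fixes G :: "('g, 'x) monoid_scheme"
    and A :: "('g, real ^ 3) chart set"
    and \<Delta> :: "'g \<Rightarrow> (('g \<Rightarrow> real) \<Rightarrow> real) set"
    and ip :: "'g \<Rightarrow> (('g \<Rightarrow> real) \<Rightarrow> real) \<Rightarrow> (('g \<Rightarrow> real) \<Rightarrow> real) \<Rightarrow> real"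
    and f e :: "nat \<Rightarrow> 'g vfield"
    and chi \<kappa> :: real
    and TG :: "('g covec, (real ^ 3) \<times> (real ^ 3)) chart set"
    and \<sigma> :: "'g covec twoform"
    and pb :: "('g covec \<Rightarrow> real) \<Rightarrow> ('g covec \<Rightarrow> real) \<Rightarrow> 'g covec \<Rightarrow> real"
    and h g :: "nat \<Rightarrow> 'g covec \<Rightarrow> real"
    and H E :: "'g covec \<Rightarrow> real"
  assumes "lie_group G A"
    and "connected_space (mtop A)"
    and "unimodular G A"
    and "contact_sub_riemannian G A \<Delta> ip"
    and "is_frame A {0, 1, 2} f"
    and "\<forall>i\<in>{0, 1, 2}. left_invariant_field G A (f i)"
    and "\<forall>q\<in>carrier G. f 1 q \<in> \<Delta> q \<and> f 2 q \<in> \<Delta> q \<and>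
           ip q (f 1 q) (f 1 q) = 1 \<and> ip q (f 2 q) (f 2 q) = 1 \<and> ip q (f 1 q) (f 2 q) = 0"
    and "chi \<ge> 0"
    and "\<forall>q\<in>carrier G. lie_bracket A (f 2) (f 1) q = f 0 q"
    and "\<forall>q\<in>carrier G. lie_bracket A (f 1) (f 0) q = (chi + \<kappa>) *\<^sub>R f 2 q"
    and "\<forall>q\<in>carrier G. lie_bracket A (f 2) (f 0) q = (chi - \<kappa>) *\<^sub>R f 1 q"
    and TG_def: "TG = cotangent_atlas A"
    and \<sigma>_def: "\<sigma> = symplectic_form A"
    and pb_def: "pb = poisson TG \<sigma>"
    and e_def: "e = (\<lambda>i. inversion_push G A (f i))"
    and h_def: "h = (\<lambda>i. pairing (f i))"
    and g_def: "g = (\<lambda>i. pairing (e i))"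
    and H_def: "H = (\<lambda>l. 1 / 2 * ((h 1 l)\<^sup>2 + (h 2 l)\<^sup>2))"
    and E_def: "E = (\<lambda>l. 2 * (h 0 l)\<^sup>2 - 2 * chi * ((h 1 l)\<^sup>2 - (h 2 l)\<^sup>2))"
  shows
    "(\<forall>a\<in>{H, E, g 0, g 1, g 2}. is_integral TG \<sigma> H a) \<and>
     (\<forall>l\<in>cotangent_bundle A.
        pb (g 2) (g 1) l = g 0 l \<and>
        pb (g 1) (g 0) l = (chi + \<kappa>) * g 2 l \<and>
        pb (g 2) (g 0) l = (chi - \<kappa>) * g 1 l \<and>
        pb H E l = 0 \<and>
        (\<forall>i\<in>{0, 1, 2}. pb H (g i) l = 0 \<and> pb E (g i) l = 0)) \<and>
     functionally_dependent_on TG (cotangent_bundle A) [H, E, g 0, g 1, g 2] \<and>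
     (\<forall>l\<in>cotangent_bundle A.
        4 * \<kappa> * H l + E l
          = 2 * ((g 0 l)\<^sup>2 + (\<kappa> - chi) * (g 1 l)\<^sup>2 + (\<kappa> + chi) * (g 2 l)\<^sup>2)) \<and>
     (\<forall>C\<in>{\<lambda>l. 4 * \<kappa> * H l + E l,
          \<lambda>l. 2 * ((g 0 l)\<^sup>2 + (\<kappa> - chi) * (g 1 l)\<^sup>2 + (\<kappa> + chi) * (g 2 l)\<^sup>2)}.
        \<forall>i\<in>{0, 1, 2}. \<forall>l\<in>cotangent_bundle A. pb C (h i) l = 0 \<and> pb C (g i) l = 0) \<and>
     liouville_integrable TG \<sigma> H \<and>
     (chi \<noteq> 0 \<longrightarrow> (\<forall>\<alpha>0 \<alpha>1 \<alpha>2. (\<alpha>0, \<alpha>1, \<alpha>2) \<noteq> (0, 0, 0) \<longrightarrow>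
        (let gg = (\<lambda>l. \<alpha>0 * g 0 l + \<alpha>1 * g 1 l + \<alpha>2 * g 2 l) in
           (\<forall>a\<in>{H, E, gg}. is_integral TG \<sigma> H a) \<and>
           in_involution TG \<sigma> [H, E, gg] \<and> independent_on_open_dense TG [H, E, gg]))) \<and>
     (chi = 0 \<longrightarrow> (\<forall>\<alpha>0 \<alpha>1 \<alpha>2. \<alpha>1\<^sup>2 + \<alpha>2\<^sup>2 \<noteq> 0 \<longrightarrow>
        (let gg = (\<lambda>l. \<alpha>0 * g 0 l + \<alpha>1 * g 1 l + \<alpha>2 * g 2 l) in
           (\<forall>a\<in>{H, E, gg}. is_integral TG \<sigma> H a) \<and>
           in_involution TG \<sigma> [H, E, gg] \<and> independent_on_open_dense TG [H, E, gg])))"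
proof -
  interpret U: unimodular_frame G A f chi \<kappa>
    by (intro unimodular_frame.intro unimodular_frame_axioms.intro smooth_group.intro) (use assms(1,2,5,6,9-11) in auto)
  have h: "h i = U.h i" and g: "g i = U.g i" for i
    unfolding h_def g_def e_def by simp_all
  have H: "H = U.energy" unfolding H_def U.energy_def h ..
  have E: "E = U.second_integral" unfolding E_def U.second_integral_def h ..
  have gg: "(\<lambda>l. \<alpha>0 * g 0 l + \<alpha>1 * g 1 l + \<alpha>2 * g 2 l) = U.momentum \<alpha>0 \<alpha>1 \<alpha>2" for \<alpha>0 \<alpha>1 \<alpha>2
    unfolding U.momentum_def g ..
  have C: "(\<lambda>l. 4 * \<kappa> * H l + E l) = U.casimir U.h"
    "(\<lambda>l. 2 * ((g 0 l)\<^sup>2 + (\<kappa> - chi) * (g 1 l)\<^sup>2 + (\<kappa> + chi) * (g 2 l)\<^sup>2)) = U.casimir U.g"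
    unfolding H E U.casimir_h U.casimir_def g by simp_all
  have pbC: "pb C (h i) l = 0 \<and> pb C (g i) l = 0"
    if C: "C \<in> {U.casimir U.h, U.casimir U.g}" and i: "i \<in> {0, 1, 2}" and l: "l \<in> cotangent_bundle A" for C i l
  proof -
    have s: "smooth_near TG l C"
      using C U.casimir_smooth[OF l U.h_smooth[OF l]] U.casimir_smooth[OF l U.g_smooth[OF l]] by (auto simp: TG_def)
    have "pb (h i) C l = 0" "pb (g i) C l = 0"
      using C U.PB_casimir_h[OF l i] U.PB_casimir_g[OF l i] U.PB_h_casimir_g[OF l i] U.PB_g_casimir_h[OF l i]
      unfolding pb_def TG_def \<sigma>_def h g by auto
    then show ?thesis
      using U.poisson_antisym[OF l s[unfolded TG_def] U.h_smooth[OF l i]]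
        U.poisson_antisym[OF l s[unfolded TG_def] U.g_smooth[OF l i]]
      unfolding pb_def TG_def \<sigma>_def h g by simp
  qed
  have triple: "(\<forall>a\<in>{H, E, U.momentum \<alpha>0 \<alpha>1 \<alpha>2}. is_integral TG \<sigma> H a) \<and>
      in_involution TG \<sigma> [H, E, U.momentum \<alpha>0 \<alpha>1 \<alpha>2] \<and> independent_on_open_dense TG [H, E, U.momentum \<alpha>0 \<alpha>1 \<alpha>2]"
    if "(chi \<noteq> 0 \<and> (\<alpha>0, \<alpha>1, \<alpha>2) \<noteq> (0, 0, 0)) \<or> \<alpha>1\<^sup>2 + \<alpha>2\<^sup>2 \<noteq> 0" for \<alpha>0 \<alpha>1 \<alpha>2
    using U.integrals U.involution U.independent_triple[OF that] unfolding H E TG_def \<sigma>_def by blast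
  show ?thesis
  proof (intro conjI)
    show "\<forall>a\<in>{H, E, g 0, g 1, g 2}. is_integral TG \<sigma> H a"
      using U.integrals unfolding H E TG_def \<sigma>_def g by blast
    show "\<forall>l\<in>cotangent_bundle A.
        pb (g 2) (g 1) l = g 0 l \<and>
        pb (g 1) (g 0) l = (chi + \<kappa>) * g 2 l \<and>
        pb (g 2) (g 0) l = (chi - \<kappa>) * g 1 l \<and>
        pb H E l = 0 \<and>
        (\<forall>i\<in>{0, 1, 2}. pb H (g i) l = 0 \<and> pb E (g i) l = 0)"
    proof
      fix l assume l: "l \<in> cotangent_bundle A"
      have "pb H (g i) l = 0 \<and> pb E (g i) l = 0" if i: "i \<in> {0, 1, 2}" for i
        using U.poisson_antisym[OF l U.energy_smooth[OF l] U.g_smooth[OF l i]] U.PB_g_energy[OF l i]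
          U.poisson_antisym[OF l U.second_integral_smooth[OF l] U.g_smooth[OF l i]] U.PB_g_second_integral[OF l i]
        unfolding H E TG_def \<sigma>_def pb_def g by simp
      then show "pb (g 2) (g 1) l = g 0 l \<and> pb (g 1) (g 0) l = (chi + \<kappa>) * g 2 l \<and>
          pb (g 2) (g 0) l = (chi - \<kappa>) * g 1 l \<and> pb H E l = 0 \<and>
          (\<forall>i\<in>{0, 1, 2}. pb H (g i) l = 0 \<and> pb E (g i) l = 0)"
        using U.PB_g(4,6,8)[OF l] U.PB_energy_second_integral[OF l]
        unfolding H E TG_def \<sigma>_def pb_def g by blast
    qed
    show "functionally_dependent_on TG (cotangent_bundle A) [H, E, g 0, g 1, g 2]"
      using U.dependent unfolding H E TG_def g .
    show "\<forall>l\<in>cotangent_bundle A. 4 * \<kappa> * H l + E l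
        = 2 * ((g 0 l)\<^sup>2 + (\<kappa> - chi) * (g 1 l)\<^sup>2 + (\<kappa> + chi) * (g 2 l)\<^sup>2)"
      using U.casimir_identity fun_cong[OF C(1)] fun_cong[OF C(2)] by metis
    show "\<forall>C\<in>{\<lambda>l. 4 * \<kappa> * H l + E l,
          \<lambda>l. 2 * ((g 0 l)\<^sup>2 + (\<kappa> - chi) * (g 1 l)\<^sup>2 + (\<kappa> + chi) * (g 2 l)\<^sup>2)}.
        \<forall>i\<in>{0, 1, 2}. \<forall>l\<in>cotangent_bundle A. pb C (h i) l = 0 \<and> pb C (g i) l = 0"
      unfolding C using pbC by blast
    show "liouville_integrable TG \<sigma> H"
      using U.integrable unfolding H TG_def \<sigma>_def .
  qed (unfold Let_def gg, (intro impI allI, rule triple, blast)+)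
qed

end
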